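(* Let $p$ be an odd prime and let $i\in\{1,2,\dots,p-1\}$. Let $\zeta_{p,i}$ be the $i$-th branch of the $p$-adic zeta function. Then: (i) If $i\neq p-1$, then $\zeta_{p,i}$ is analytic at $s=1$. (ii) The function $\zeta_{p,p-1}$ has a simple pole at $s=1$ with residue $1-p^{-1}$, that is, $\lim_{s\to1}(s-1)\zeta_{p,p-1}(s)=1-p^{-1}$.
   Context: For $x\in\mathbf{Z}_p^\times$ let $\omega(x)\in\mu_{p-1}$ be the Teichmüller lift of $x\bmod p$ and $\langle x\rangle=\omega(x)^{-1}x\in1+p\mathbf{Z}_p$; for $s\in\mathbf{Z}_p$, $\langle x\rangle^s=\exp(s\log\langle x\rangle)$. $\Lambda(\mathbf{Z}_p^\times)=\varprojlim_n\mathbf{Z}_p[(\mathbf{Z}/p^n\mathbf{Z})^\times]$ is identified with the algebra (under convolution) of $\mathbf{Z}_p$-valued measures on $\mathbf{Z}_p^\times$. A pseudo-measure is an element $\lambda$ of the total ring of fractions of $\Lambda(\mathbf{Z}_p^\times)$ with $([g]-[1])\lambda\in\Lambda(\mathbf{Z}_p^\times)$ for all $g$; for a non-trivial continuous character $\kappa:\mathbf{Z}_p^\times\to\mathbf{C}_p^\times$, $\int\kappa\cdot\lambda:=(\kappa(g)-1)^{-1}\int\kappa\cdot([g]-[1])\lambda$ for any $g$ with $\kappa(g)\ne1$ (independent of $g$). $\zeta_p$ is the unique pseudo-measure on $\mathbf{Z}_p^\times$ with $\int x^k\cdot\zeta_p=(1-p^{k-1})\zeta(1-k)$ for all integers $k>0$.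 The $i$-th branch is $$\zeta_{p,i}(s)=\int_{\mathbf{Z}_p^\times}\omega(x)^i\langle x\rangle^{1-s}\cdot\zeta_p,\qquad s\in\mathbf{Z}_p,$$ defined whenever the character $\omega^i\langle\cdot\rangle^{1-s}$ is non-trivial. *)

theory Defs
  imports
    "HOL-Complex_Analysis.Complex_Analysis"
    "HOL-Number_Theory.Number_Theory"
    "Berlekamp_Zassenhaus.Finite_Field"
begin

section \<open>The field of \<open>p\<close>-adic numbers\<close>

text \<open>
  The prime is carried by a type \<open>'p\<close> of class \<^class>\<open>prime_card\<close>, namely \<open>p = CARD('p)\<close>;
  every prime is the cardinality of some type, so a free \<open>'p\<close> ranges over all primes.
  \<open>'p padic\<close> is the completion of the rationals with respect to the \<open>p\<close>-adic absolute value,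
  built from Cauchy sequences in the same way as the type \<^typ>\<open>real\<close>.
\<close>

subsection \<open>The \<open>p\<close>-adic absolute value on the rationals\<close>

definition padic_abs :: "nat \<Rightarrow> rat \<Rightarrow> real" where
  "padic_abs p q = (if q = 0 then 0 else
     real p powi (int (multiplicity (int p) (snd (quotient_of q)))
                - int (multiplicity (int p) (fst (quotient_of q)))))"

lemma padic_abs_0 [simp]: "padic_abs p 0 = 0"
  by (simp add: padic_abs_def)

lemma padic_abs_frac:
  assumes p: "prime p" and a: "a \<noteq> 0" and b: "b \<noteq> 0"
  shows "padic_abs p (of_int a / of_int b)
       = real p powi (int (multiplicity (int p) b) - int (multiplicity (int p) a))"
proof -
  define q :: rat where "q = of_int a / of_int b"
  obtain c d where cd: "quotient_of q = (c, d)" by force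
  from cd have d: "d > 0" by (rule quotient_of_denom_pos)
  from cd have q: "q = of_int c / of_int d" by (rule quotient_of_div)
  have q0: "q \<noteq> 0" using a b by (simp add: q_def)
  with q have c: "c \<noteq> 0" by auto
  have "of_int a * of_int d = (of_int c * of_int b :: rat)"
    using q b d unfolding q_def by (simp add: field_simps)
  hence "a * d = c * b" by (metis of_int_eq_iff of_int_mult)
  hence "multiplicity (int p) (a * d) = multiplicity (int p) (c * b)" by simp
  hence "multiplicity (int p) a + multiplicity (int p) d
       = multiplicity (int p) c + multiplicity (int p) b"
    using p a b c d by (simp add: prime_elem_multiplicity_mult_distrib)
  hence "int (multiplicity (int p) d) - int (multiplicity (int p) c)
       = int (multiplicity (int p) b) - int (multiplicity (int p) a)" by linarith
  thus ?thesis
    using q0 cd unfolding q_def[symmetric] padic_abs_def by simp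
qed

lemma rat_frac_cases:
  obtains a b where "(q::rat) = of_int a / of_int b" "b \<noteq> 0"
  by (metis less_irrefl prod.exhaust_sel quotient_of_denom_pos quotient_of_div)

lemma padic_abs_nonneg [simp]: "padic_abs p q \<ge> 0"
  by (simp add: padic_abs_def)

lemma padic_abs_eq_0_iff: "prime p \<Longrightarrow> padic_abs p q = 0 \<longleftrightarrow> q = 0"
  by (auto simp: padic_abs_def power_int_eq_0_iff dest: prime_gt_0_nat)

lemma padic_abs_1 [simp]: "prime p \<Longrightarrow> padic_abs p 1 = 1"
  using padic_abs_frac[of p 1 1] by simp

lemma padic_abs_mult:
  assumes p: "prime p"
  shows "padic_abs p (x * y) = padic_abs p x * padic_abs p y"
proof (cases "x = 0 \<or> y = 0")
  case False
  obtain a b where x: "x = of_int a / of_int b" "b \<noteq> 0" by (rule rat_frac_cases)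
  obtain c d where y: "y = of_int c / of_int d" "d \<noteq> 0" by (rule rat_frac_cases)
  from False x y have ac: "a \<noteq> 0" "c \<noteq> 0" by auto
  have xy: "x * y = of_int (a * c) / of_int (b * d)" using x y by simp
  have "real p \<noteq> 0" using p prime_gt_0_nat by fastforce
  thus ?thesis
    unfolding xy unfolding x y using p ac x y
    by (simp add: padic_abs_frac prime_elem_multiplicity_mult_distrib algebra_simps
             del: of_int_mult flip: power_int_add)
qed auto

lemma padic_abs_minus [simp]:
  assumes p: "prime p"
  shows "padic_abs p (- x) = padic_abs p x"
proof -
  have "padic_abs p (- 1) * padic_abs p (- 1) = 1"
    using padic_abs_mult[OF p, of "-1" "-1"] p by simp
  hence "padic_abs p (- 1) = 1"
    using padic_abs_nonneg[of p "-1"] by (simp add: square_eq_1_iff)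
  thus ?thesis using padic_abs_mult[OF p, of "-1" x] by simp
qed

lemma padic_abs_minus_commute: "prime p \<Longrightarrow> padic_abs p (x - y) = padic_abs p (y - x)"
  using padic_abs_minus[of p "x - y"] by simp

lemma padic_abs_inverse:
  assumes p: "prime p"
  shows "padic_abs p (inverse x) = inverse (padic_abs p x)"
proof (cases "x = 0")
  case False
  hence "padic_abs p x * padic_abs p (inverse x) = 1"
    using padic_abs_mult[OF p, of x "inverse x"] p by simp
  thus ?thesis by (simp add: inverse_unique)
qed auto

lemma padic_abs_add:
  assumes p: "prime p"
  shows "padic_abs p (x + y) \<le> max (padic_abs p x) (padic_abs p y)"
proof (cases "x = 0 \<or> y = 0 \<or> x + y = 0")
  case True
  thus ?thesis by (auto simp: le_max_iff_disj)
next
  case False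
  obtain a b where x: "x = of_int a / of_int b" "b \<noteq> 0" by (rule rat_frac_cases)
  obtain c d where y: "y = of_int c / of_int d" "d \<noteq> 0" by (rule rat_frac_cases)
  define A C D where "A = a * d" "C = c * b" "D = b * d"
  have xy: "x = of_int A / of_int D" "y = of_int C / of_int D" "x + y = of_int (A + C) / of_int D"
    using x y by (simp_all add: A_C_D_def field_simps)
  have nz: "A \<noteq> 0" "C \<noteq> 0" "D \<noteq> 0" "A + C \<noteq> 0" using False xy by (auto simp del: of_int_add)
  define m where "m = min (multiplicity (int p) A) (multiplicity (int p) C)"
  have "int p ^ m dvd A" "int p ^ m dvd C"
    unfolding m_def by (auto intro: multiplicity_dvd')
  hence "int p ^ m dvd A + C" by simp
  moreover have "\<not> is_unit (int p)" using prime_gt_1_nat[OF p] by simp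
  ultimately have m: "m \<le> multiplicity (int p) (A + C)"
    using nz by (intro multiplicity_geI) auto
  have p1: "1 \<le> real p" using prime_gt_1_nat[OF p] by simp
  have "real p powi (int (multiplicity (int p) D) - int (multiplicity (int p) (A + C)))
      \<le> real p powi (int (multiplicity (int p) D) - int m)"
    using m p1 by (intro power_int_increasing) auto
  also have "\<dots> \<le> max (padic_abs p x) (padic_abs p y)"
    unfolding xy(1,2) using p nz by (auto simp: padic_abs_frac m_def min_def)
  finally show ?thesis
    unfolding xy(3) using p nz by (simp add: padic_abs_frac del: of_int_add)
qed

lemma padic_abs_diff_le:
  assumes p: "prime p"
  shows "\<bar>padic_abs p x - padic_abs p y\<bar> \<le> padic_abs p (x - y)"
proof -
  have "padic_abs p x \<le> padic_abs p y + padic_abs p (x - y)"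
    using padic_abs_add[OF p, of y "x - y"] padic_abs_nonneg[of p y] padic_abs_nonneg[of p "x - y"]
    unfolding max_def by (simp split: if_splits del: padic_abs_nonneg)
  moreover have "padic_abs p y \<le> padic_abs p x + padic_abs p (x - y)"
    using padic_abs_add[OF p, of x "y - x"] padic_abs_nonneg[of p x] padic_abs_nonneg[of p "x - y"]
    unfolding max_def padic_abs_minus_commute[OF p, of y x]
    by (simp split: if_splits del: padic_abs_nonneg)
  ultimately show ?thesis by linarith
qed

lemma padic_abs_of_int_le_iff:
  assumes p: "prime p"
  shows "padic_abs p (of_int a) \<le> 1 / real p ^ n \<longleftrightarrow> int p ^ n dvd a"
proof (cases "a = 0")
  case False
  have nu: "\<not> is_unit (int p)" using prime_gt_1_nat[OF p] by simp
  have p1: "1 < real p" using prime_gt_1_nat[OF p] by simp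
  have "padic_abs p (of_int a) = inverse (real p ^ multiplicity (int p) a)"
    using padic_abs_frac[of p a 1] p False by (simp add: power_int_minus)
  moreover have "1 / real p ^ n = inverse (real p ^ n)" by (simp add: inverse_eq_divide)
  ultimately have "padic_abs p (of_int a) \<le> 1 / real p ^ n
                     \<longleftrightarrow> real p ^ n \<le> real p ^ multiplicity (int p) a"
    using p1 by (simp only: inverse_le_iff_le zero_less_power)
  also have "\<dots> \<longleftrightarrow> n \<le> multiplicity (int p) a"
    using p1 by (rule power_increasing_iff)
  also have "\<dots> \<longleftrightarrow> int p ^ n dvd a"
    using False nu by (simp add: power_dvd_iff_le_multiplicity)
  finally show ?thesis .
qed auto


subsection \<open>Cauchy sequences and null sequences\<close>

definition padic_cauchy :: "nat \<Rightarrow> (nat \<Rightarrow> rat) \<Rightarrow> bool" where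
  "padic_cauchy p X \<longleftrightarrow> (\<forall>e>0. \<exists>k. \<forall>m\<ge>k. \<forall>n\<ge>k. padic_abs p (X m - X n) < e)"

definition padic_null :: "nat \<Rightarrow> (nat \<Rightarrow> rat) \<Rightarrow> bool" where
  "padic_null p X \<longleftrightarrow> (\<lambda>n. padic_abs p (X n)) \<longlonglongrightarrow> 0"

context
  fixes p :: nat
  assumes p: "prime p"
begin

lemma padic_null_le:
  assumes "padic_null p X" "\<And>n. padic_abs p (Y n) \<le> padic_abs p (X n)"
  shows "padic_null p Y"
  using assms(1) unfolding padic_null_def
  by (rule tendsto_0_le[where K = 1]) (simp add: assms(2))

lemma padic_null_minus: "padic_null p X \<Longrightarrow> padic_null p (\<lambda>n. - X n)"
  by (erule padic_null_le) (simp add: p)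

lemma padic_null_add:
  assumes "padic_null p X" "padic_null p Y"
  shows "padic_null p (\<lambda>n. X n + Y n)"
proof -
  have "(\<lambda>n. max (padic_abs p (X n)) (padic_abs p (Y n))) \<longlonglongrightarrow> max 0 0"
    using assms unfolding padic_null_def by (intro tendsto_max)
  hence lim: "(\<lambda>n. max (padic_abs p (X n)) (padic_abs p (Y n))) \<longlonglongrightarrow> 0" by simp
  show ?thesis unfolding padic_null_def
    by (rule tendsto_0_le[OF lim, where K = 1])
       (simp add: padic_abs_add[OF p] max.coboundedI1)
qed

lemma padic_cauchy_const [simp]: "padic_cauchy p (\<lambda>_. c)"
  by (simp add: padic_cauchy_def)

lemma padic_cauchy_minus: "padic_cauchy p X \<Longrightarrow> padic_cauchy p (\<lambda>n. - X n)"
  unfolding padic_cauchy_def by (simp add: padic_abs_minus_commute[OF p])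

lemma padic_cauchy_add:
  assumes "padic_cauchy p X" "padic_cauchy p Y"
  shows "padic_cauchy p (\<lambda>n. X n + Y n)"
  unfolding padic_cauchy_def
proof (intro allI impI)
  fix e :: real assume e: "e > 0"
  obtain k where k: "\<And>m n. m \<ge> k \<Longrightarrow> n \<ge> k \<Longrightarrow> padic_abs p (X m - X n) < e"
    using assms(1) e unfolding padic_cauchy_def by blast
  obtain l where l: "\<And>m n. m \<ge> l \<Longrightarrow> n \<ge> l \<Longrightarrow> padic_abs p (Y m - Y n) < e"
    using assms(2) e unfolding padic_cauchy_def by blast
  have "padic_abs p (X m + Y m - (X n + Y n)) < e" if "m \<ge> max k l" "n \<ge> max k l" for m n
  proof -
    have "X m + Y m - (X n + Y n) = (X m - X n) + (Y m - Y n)" by simp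
    hence "padic_abs p (X m + Y m - (X n + Y n))
         \<le> max (padic_abs p (X m - X n)) (padic_abs p (Y m - Y n))"
      by (metis padic_abs_add[OF p])
    also have "\<dots> < e" using k[of m n] l[of m n] that by simp
    finally show ?thesis .
  qed
  thus "\<exists>k. \<forall>m\<ge>k. \<forall>n\<ge>k. padic_abs p (X m + Y m - (X n + Y n)) < e" by blast
qed

lemma padic_cauchy_diff: "padic_cauchy p X \<Longrightarrow> padic_cauchy p Y \<Longrightarrow> padic_cauchy p (\<lambda>n. X n - Y n)"
  using padic_cauchy_add[of X "\<lambda>n. - Y n"] padic_cauchy_minus[of Y] by simp

lemma padic_null_diff: "padic_null p X \<Longrightarrow> padic_null p Y \<Longrightarrow> padic_null p (\<lambda>n. X n - Y n)"
  using padic_null_add[of X "\<lambda>n. - Y n"] padic_null_minus[of Y] by simp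

lemma padic_cauchy_abs:
  assumes "padic_cauchy p X"
  shows "convergent (\<lambda>n. padic_abs p (X n))"
proof (rule real_Cauchy_convergent, rule metric_CauchyI)
  fix e :: real assume "e > 0"
  then obtain k where "\<And>m n. m \<ge> k \<Longrightarrow> n \<ge> k \<Longrightarrow> padic_abs p (X m - X n) < e"
    using assms unfolding padic_cauchy_def by blast
  thus "\<exists>M. \<forall>m\<ge>M. \<forall>n\<ge>M. dist (padic_abs p (X m)) (padic_abs p (X n)) < e"
    unfolding dist_real_def using padic_abs_diff_le[OF p] le_less_trans by blast
qed

lemma padic_cauchy_bounded:
  assumes "padic_cauchy p X"
  obtains B where "B > 0" "\<And>n. padic_abs p (X n) \<le> B"
proof -
  have "Bseq (\<lambda>n. padic_abs p (X n))"
    using padic_cauchy_abs[OF assms] by (rule convergent_imp_Bseq)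
  thus ?thesis using that by (auto elim!: BseqE)
qed

lemma padic_null_mult_bounded:
  assumes "padic_cauchy p X" "padic_null p Y"
  shows "padic_null p (\<lambda>n. X n * Y n)"
proof -
  obtain B where B: "B > 0" "\<And>n. padic_abs p (X n) \<le> B" using padic_cauchy_bounded[OF assms(1)] by blast
  show ?thesis using assms(2) unfolding padic_null_def
    by (rule tendsto_0_le[where K = B])
       (use B in \<open>auto simp: padic_abs_mult[OF p] mult.commute intro!: always_eventually mult_right_mono\<close>)
qed

lemma padic_cauchy_mult:
  assumes "padic_cauchy p X" "padic_cauchy p Y"
  shows "padic_cauchy p (\<lambda>n. X n * Y n)"
  unfolding padic_cauchy_def
proof (intro allI impI)
  fix e :: real assume e: "e > 0"
  obtain A where A: "A > 0" "\<And>n. padic_abs p (X n) \<le> A" using padic_cauchy_bounded[OF assms(1)] by blast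
  obtain B where B: "B > 0" "\<And>n. padic_abs p (Y n) \<le> B" using padic_cauchy_bounded[OF assms(2)] by blast
  have eAB: "e / A > 0" "e / B > 0" using e A(1) B(1) by simp_all
  obtain k where k: "\<And>m n. m \<ge> k \<Longrightarrow> n \<ge> k \<Longrightarrow> padic_abs p (X m - X n) < e / B"
    using assms(1) eAB(2) unfolding padic_cauchy_def by blast
  obtain l where l: "\<And>m n. m \<ge> l \<Longrightarrow> n \<ge> l \<Longrightarrow> padic_abs p (Y m - Y n) < e / A"
    using assms(2) eAB(1) unfolding padic_cauchy_def by blast
  have "padic_abs p (X m * Y m - X n * Y n) < e" if "m \<ge> max k l" "n \<ge> max k l" for m n
  proof -
    have "padic_abs p (X m * (Y m - Y n)) \<le> A * padic_abs p (Y m - Y n)"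
      using A by (auto simp: padic_abs_mult[OF p] intro!: mult_right_mono)
    also have "\<dots> < e" using l[of m n] that A(1) by (simp add: field_simps)
    finally have 1: "padic_abs p (X m * (Y m - Y n)) < e" .
    have "padic_abs p ((X m - X n) * Y n) \<le> padic_abs p (X m - X n) * B"
      using B by (auto simp: padic_abs_mult[OF p] intro!: mult_left_mono)
    also have "\<dots> < e" using k[of m n] that B(1) by (simp add: field_simps)
    finally have 2: "padic_abs p ((X m - X n) * Y n) < e" .
    have "X m * Y m - X n * Y n = X m * (Y m - Y n) + (X m - X n) * Y n"
      by (simp add: algebra_simps)
    thus ?thesis using 1 2 padic_abs_add[OF p, of "X m * (Y m - Y n)" "(X m - X n) * Y n"] by simp
  qed
  thus "\<exists>k. \<forall>m\<ge>k. \<forall>n\<ge>k. padic_abs p (X m * Y m - X n * Y n) < e" by blast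
qed

lemma padic_not_null:
  assumes "padic_cauchy p X" "\<not> padic_null p X"
  obtains b k where "b > 0" "\<And>n. n \<ge> k \<Longrightarrow> padic_abs p (X n) > b"
proof -
  obtain L where L: "(\<lambda>n. padic_abs p (X n)) \<longlonglongrightarrow> L"
    using padic_cauchy_abs[OF assms(1)] by (auto simp: convergent_def)
  have "L \<ge> 0" by (rule LIMSEQ_le_const[OF L]) auto
  moreover have "L \<noteq> 0" using L assms(2) by (auto simp: padic_null_def)
  ultimately have "L > 0" by simp
  hence "eventually (\<lambda>n. padic_abs p (X n) > L / 2) sequentially"
    using order_tendstoD(1)[OF L, of "L / 2"] by simp
  thus ?thesis using that[of "L / 2"] \<open>L > 0\<close> by (auto simp: eventually_sequentially)
qed

lemma padic_abs_inverse_diff: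
  assumes "x \<noteq> 0" "y \<noteq> 0"
  shows "padic_abs p (inverse x - inverse y)
       = inverse (padic_abs p x) * padic_abs p (x - y) * inverse (padic_abs p y)"
proof -
  have "inverse x - inverse y = inverse x * (y - x) * inverse y"
    using assms by (simp add: field_simps)
  thus ?thesis
    by (simp add: padic_abs_mult[OF p] padic_abs_inverse[OF p] padic_abs_minus_commute[OF p, of y x])
qed

lemma padic_abs_inverse_diff_le:
  assumes "b > 0" "padic_abs p x > b" "padic_abs p y > b"
  shows "padic_abs p (inverse x - inverse y) \<le> padic_abs p (x - y) / b\<^sup>2"
proof -
  have xy: "x \<noteq> 0" "y \<noteq> 0" using assms by auto
  have "inverse (padic_abs p x) * padic_abs p (x - y) * inverse (padic_abs p y)
      \<le> inverse b * padic_abs p (x - y) * inverse b"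
    using assms by (intro mult_mono le_imp_inverse_le) auto
  thus ?thesis
    unfolding padic_abs_inverse_diff[OF xy]
    by (simp add: divide_inverse power2_eq_square mult_ac)
qed

lemma padic_cauchy_inverse:
  assumes "padic_cauchy p X" "\<not> padic_null p X"
  shows "padic_cauchy p (\<lambda>n. inverse (X n))"
  unfolding padic_cauchy_def
proof (intro allI impI)
  fix e :: real assume e: "e > 0"
  obtain b k where b: "b > 0" "\<And>n. n \<ge> k \<Longrightarrow> padic_abs p (X n) > b"
    using padic_not_null[OF assms] by metis
  have "e * b\<^sup>2 > 0" using e b by simp
  then obtain l where l: "\<And>m n. m \<ge> l \<Longrightarrow> n \<ge> l \<Longrightarrow> padic_abs p (X m - X n) < e * b\<^sup>2"
    using assms(1) unfolding padic_cauchy_def by blast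
  have "padic_abs p (inverse (X m) - inverse (X n)) < e" if "m \<ge> max k l" "n \<ge> max k l" for m n
  proof -
    have "padic_abs p (inverse (X m) - inverse (X n)) \<le> padic_abs p (X m - X n) / b\<^sup>2"
      using that b by (intro padic_abs_inverse_diff_le) auto
    also have "\<dots> < e" using l[of m n] that b(1) by (simp add: field_simps)
    finally show ?thesis .
  qed
  thus "\<exists>k. \<forall>m\<ge>k. \<forall>n\<ge>k. padic_abs p (inverse (X m) - inverse (X n)) < e" by blast
qed

lemma padic_null_inverse_diff:
  assumes X: "padic_cauchy p X" "\<not> padic_null p X" and Y: "padic_cauchy p Y" "\<not> padic_null p Y"
    and XY: "padic_null p (\<lambda>n. X n - Y n)"
  shows "padic_null p (\<lambda>n. inverse (X n) - inverse (Y n))"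
proof -
  obtain a k where a: "a > 0" "\<And>n. n \<ge> k \<Longrightarrow> padic_abs p (X n) > a"
    using padic_not_null[OF X] by metis
  obtain b l where b: "b > 0" "\<And>n. n \<ge> l \<Longrightarrow> padic_abs p (Y n) > b"
    using padic_not_null[OF Y] by metis
  define c where "c = min a b"
  have c: "c > 0" using a b by (simp add: c_def)
  have "padic_abs p (inverse (X n) - inverse (Y n)) \<le> padic_abs p (X n - Y n) / c\<^sup>2"
    if "n \<ge> max k l" for n
    using that a(2)[of n] b(2)[of n] c by (intro padic_abs_inverse_diff_le) (auto simp: c_def)
  hence ev: "eventually (\<lambda>n. norm (padic_abs p (inverse (X n) - inverse (Y n)))
             \<le> norm (padic_abs p (X n - Y n)) * (1 / c\<^sup>2)) sequentially"
    unfolding eventually_sequentially by (intro exI[of _ "max k l"]) simp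
  show ?thesis
    using tendsto_0_le[OF XY[unfolded padic_null_def] ev] unfolding padic_null_def .
qed

lemma padic_null_const_iff: "padic_null p (\<lambda>_. c) \<longleftrightarrow> c = 0"
  unfolding padic_null_def by (simp add: LIMSEQ_const_iff padic_abs_eq_0_iff[OF p])

end


subsection \<open>The type of \<open>p\<close>-adic numbers as a field\<close>

typedef (overloaded) 'p padic_seq = "{X. padic_cauchy CARD('p::prime_card) X}"
  by (rule exI[of _ "\<lambda>_. 0"]) (simp add: prime_card)

setup_lifting type_definition_padic_seq

instantiation padic_seq :: (prime_card) comm_ring_1
begin

lift_definition zero_padic_seq :: "'a padic_seq" is "\<lambda>_. 0"
  by (simp add: prime_card)

lift_definition one_padic_seq :: "'a padic_seq" is "\<lambda>_. 1"
  by (simp add: prime_card)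

lift_definition plus_padic_seq :: "'a padic_seq \<Rightarrow> 'a padic_seq \<Rightarrow> 'a padic_seq"
  is "\<lambda>X Y n. X n + Y n" by (simp add: padic_cauchy_add prime_card)

lift_definition uminus_padic_seq :: "'a padic_seq \<Rightarrow> 'a padic_seq"
  is "\<lambda>X n. - X n" by (simp add: padic_cauchy_minus prime_card)

lift_definition times_padic_seq :: "'a padic_seq \<Rightarrow> 'a padic_seq \<Rightarrow> 'a padic_seq"
  is "\<lambda>X Y n. X n * Y n" by (simp add: padic_cauchy_mult prime_card)

lift_definition minus_padic_seq :: "'a padic_seq \<Rightarrow> 'a padic_seq \<Rightarrow> 'a padic_seq"
  is "\<lambda>X Y n. X n - Y n" by (simp add: padic_cauchy_diff prime_card)

instance
proof
  fix a b c :: "'a padic_seq"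
  show "a + b + c = a + (b + c)" by transfer (simp add: add.assoc)
  show "a + b = b + a" by transfer (simp add: add.commute)
  show "0 + a = a" by transfer simp
  show "- a + a = 0" by transfer simp
  show "a - b = a + - b" by transfer simp
  show "a * b * c = a * (b * c)" by transfer (simp add: mult.assoc)
  show "a * b = b * a" by transfer (simp add: mult.commute)
  show "1 * a = a" by transfer simp
  show "(a + b) * c = a * c + b * c" by transfer (simp add: distrib_right)
  show "(0::'a padic_seq) \<noteq> 1" by transfer (simp add: fun_eq_iff)
qed

end

lift_definition padic_seq_null :: "'p::prime_card padic_seq \<Rightarrow> bool" is "padic_null CARD('p)" .

lift_definition padic_seq_inverse :: "'p::prime_card padic_seq \<Rightarrow> 'p padic_seq"
  is "\<lambda>X. if padic_null CARD('p) X then (\<lambda>_. 0) else (\<lambda>n. inverse (X n))"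
  by (auto simp: prime_card intro: padic_cauchy_inverse)

lift_definition padic_seq_norm :: "'p::prime_card padic_seq \<Rightarrow> real"
  is "\<lambda>X. lim (\<lambda>n. padic_abs CARD('p) (X n))" .

lift_definition padic_seq_const :: "rat \<Rightarrow> 'p::prime_card padic_seq" is "\<lambda>q _. q"
  by (simp add: prime_card)

lemma padic_seq_null_0 [simp]: "padic_seq_null 0"
  by transfer (simp add: padic_null_def)

lemma padic_seq_null_minus: "padic_seq_null X \<Longrightarrow> padic_seq_null (- X)"
  by transfer (rule padic_null_minus[OF prime_card])

lemma padic_seq_null_add: "padic_seq_null X \<Longrightarrow> padic_seq_null Y \<Longrightarrow> padic_seq_null (X + Y)"
  by transfer (rule padic_null_add[OF prime_card])

lemma padic_seq_null_diff: "padic_seq_null X \<Longrightarrow> padic_seq_null Y \<Longrightarrow> padic_seq_null (X - Y)"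
  by transfer (rule padic_null_diff[OF prime_card])

lemma padic_seq_null_mult: "padic_seq_null Y \<Longrightarrow> padic_seq_null (X * Y)"
  by transfer (rule padic_null_mult_bounded[OF prime_card])

lemma padic_seq_null_const_iff: "padic_seq_null (padic_seq_const q) \<longleftrightarrow> q = 0"
  by transfer (rule padic_null_const_iff[OF prime_card])

lemma padic_seq_null_inverse:
  assumes "\<not> padic_seq_null X"
  shows "padic_seq_null (padic_seq_inverse X * X - 1)"
  using assms
proof (transfer, goal_cases)
  case (1 X)
  obtain b k where b: "b > 0" "\<And>n. n \<ge> k \<Longrightarrow> padic_abs CARD('a) (X n) > b"
    using padic_not_null[OF prime_card, of X] 1 by metis
  have "padic_abs CARD('a) (inverse (X n) * X n - 1) = 0" if "n \<ge> k" for n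
  proof -
    have "X n \<noteq> 0" using b(1) b(2)[OF that] by auto
    thus ?thesis by simp
  qed
  hence "eventually (\<lambda>n. padic_abs CARD('a) (inverse (X n) * X n - 1) = 0) sequentially"
    unfolding eventually_sequentially by blast
  hence "padic_null CARD('a) (\<lambda>n. inverse (X n) * X n - 1)"
    unfolding padic_null_def by (rule tendsto_eventually)
  thus ?case using 1 by simp
qed

lemma padic_seq_inverse_null: "padic_seq_null X \<Longrightarrow> padic_seq_inverse X = 0"
  by transfer simp

lemma padic_seq_norm_LIMSEQ:
  "(\<lambda>n. padic_abs CARD('p) (Rep_padic_seq X n)) \<longlonglongrightarrow> padic_seq_norm (X :: 'p::prime_card padic_seq)"
  using padic_cauchy_abs[OF prime_card, of "Rep_padic_seq X"] Rep_padic_seq[of X]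
  by (simp add: convergent_LIMSEQ_iff padic_seq_norm.rep_eq)

quotient_type (overloaded) 'p padic = "'p::prime_card padic_seq" / "\<lambda>X Y. padic_seq_null (X - Y)"
proof (rule equivpI)
  show "symp (\<lambda>X Y :: 'p padic_seq. padic_seq_null (X - Y))"
  proof (rule sympI)
    fix X Y :: "'p padic_seq" assume "padic_seq_null (X - Y)"
    from padic_seq_null_minus[OF this] show "padic_seq_null (Y - X)" by simp
  qed
  show "transp (\<lambda>X Y :: 'p padic_seq. padic_seq_null (X - Y))"
  proof (rule transpI)
    fix X Y Z :: "'p padic_seq" assume "padic_seq_null (X - Y)" "padic_seq_null (Y - Z)"
    from padic_seq_null_add[OF this] show "padic_seq_null (X - Z)" by simp
  qed
qed (auto simp: reflp_def)

instantiation padic :: (prime_card) field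
begin

lift_definition zero_padic :: "'a padic" is "0" .

lift_definition one_padic :: "'a padic" is "1" .

lift_definition plus_padic :: "'a padic \<Rightarrow> 'a padic \<Rightarrow> 'a padic" is "(+)"
  by (simp only: add_diff_add padic_seq_null_add)

lift_definition uminus_padic :: "'a padic \<Rightarrow> 'a padic" is "uminus"
  by (simp only: minus_diff_minus padic_seq_null_minus)

lift_definition times_padic :: "'a padic \<Rightarrow> 'a padic \<Rightarrow> 'a padic" is "(*)"
proof -
  fix X X' Y Y' :: "'a padic_seq"
  assume *: "padic_seq_null (X - X')" "padic_seq_null (Y - Y')"
  have "X * Y - X' * Y' = X * (Y - Y') + Y' * (X - X')" by (simp add: algebra_simps)
  thus "padic_seq_null (X * Y - X' * Y')"
    using * by (simp add: padic_seq_null_add padic_seq_null_mult)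
qed

lift_definition inverse_padic :: "'a padic \<Rightarrow> 'a padic" is "padic_seq_inverse"
proof -
  fix X Y :: "'a padic_seq"
  assume XY: "padic_seq_null (X - Y)"
  have iff: "padic_seq_null X \<longleftrightarrow> padic_seq_null Y"
  proof
    assume "padic_seq_null X"
    from padic_seq_null_diff[OF this XY] show "padic_seq_null Y" by simp
  next
    assume "padic_seq_null Y"
    from padic_seq_null_add[OF XY this] show "padic_seq_null X" by simp
  qed
  show "padic_seq_null (padic_seq_inverse X - padic_seq_inverse Y)"
  proof (cases "padic_seq_null X")
    case True
    thus ?thesis using iff by (simp add: padic_seq_inverse_null)
  next
    case False
    let ?X' = "padic_seq_inverse X" and ?Y' = "padic_seq_inverse Y"
    have "?X' - ?Y' = ?Y' * (?X' * X - 1) - ?X' * (?Y' * Y - 1) - ?X' * ?Y' * (X - Y)"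
      by (simp add: algebra_simps)
    thus ?thesis
      using False iff XY
      by (simp only: padic_seq_null_diff padic_seq_null_mult padic_seq_null_inverse not_False_eq_True)
  qed
qed

lift_definition minus_padic :: "'a padic \<Rightarrow> 'a padic \<Rightarrow> 'a padic" is "(-)"
proof -
  fix X X' Y Y' :: "'a padic_seq"
  assume *: "padic_seq_null (X - X')" "padic_seq_null (Y - Y')"
  have "X - Y - (X' - Y') = (X - X') - (Y - Y')" by simp
  thus "padic_seq_null (X - Y - (X' - Y'))" using padic_seq_null_diff[OF *] by (simp only:)
qed

definition "x div y = x * inverse y" for x y :: "'a padic"

instance
proof
  fix a b c :: "'a padic"
  show "a + b + c = a + (b + c)" by transfer (simp add: add.assoc)
  show "a + b = b + a" by transfer (simp add: add.commute)
  show "0 + a = a" by transfer simp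
  show "- a + a = 0" by transfer simp
  show "a - b = a + - b" by transfer simp
  show "a * b * c = a * (b * c)" by transfer (simp add: mult.assoc)
  show "a * b = b * a" by transfer (simp add: mult.commute)
  show "1 * a = a" by transfer simp
  show "(a + b) * c = a * c + b * c" by transfer (simp add: distrib_right)
  show "a div b = a * inverse b" by (rule divide_padic_def)
  show "a \<noteq> 0 \<Longrightarrow> inverse a * a = 1" by transfer (simp add: padic_seq_null_inverse)
  show "inverse (0::'a padic) = 0" by transfer (simp add: padic_seq_inverse_null)
  show "(0::'a padic) \<noteq> 1"
  proof (transfer, rule notI)
    assume "padic_seq_null (0 - 1 :: 'a padic_seq)"
    from padic_seq_null_minus[OF this] have "padic_seq_null (1 :: 'a padic_seq)" by simp
    thus False by transfer (simp add: padic_null_const_iff prime_card)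
  qed
qed

end

lift_definition padic_of_rat :: "rat \<Rightarrow> 'p::prime_card padic" is "padic_seq_const" .

lemma padic_of_rat_0: "padic_of_rat 0 = 0"
  by (simp add: padic_of_rat_def zero_padic_def zero_padic_seq_def padic_seq_const_def)

lemma padic_of_rat_1: "padic_of_rat 1 = 1"
  by (simp add: padic_of_rat_def one_padic_def one_padic_seq_def padic_seq_const_def)

lemma padic_seq_const_hom:
  "padic_seq_const (q + r) = padic_seq_const q + padic_seq_const r"
  "padic_seq_const (q * r) = padic_seq_const q * padic_seq_const r"
  "padic_seq_const (- q) = - padic_seq_const q"
  by (transfer, simp)+

lemma padic_of_rat_add: "padic_of_rat (q + r) = padic_of_rat q + padic_of_rat r"
  by transfer (simp add: padic_seq_const_hom)

lemma padic_of_rat_mult: "padic_of_rat (q * r) = padic_of_rat q * padic_of_rat r"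
  by transfer (simp add: padic_seq_const_hom)

lemma padic_of_rat_minus: "padic_of_rat (- q) = - padic_of_rat q"
  by transfer (simp add: padic_seq_const_hom)

lemma padic_of_rat_diff: "padic_of_rat (q - r) = padic_of_rat q - padic_of_rat r"
  using padic_of_rat_add[of q "- r"] by (simp add: padic_of_rat_minus)

lemma padic_of_rat_of_nat: "padic_of_rat (of_nat n) = of_nat n"
  by (induction n) (simp_all add: padic_of_rat_0 padic_of_rat_1 padic_of_rat_add)

lemma padic_of_rat_eq_0_iff: "padic_of_rat q = 0 \<longleftrightarrow> q = 0"
  by transfer (simp add: padic_seq_null_const_iff)

instance padic :: (prime_card) field_char_0
proof
  show "inj (of_nat :: nat \<Rightarrow> 'a padic)"
  proof (rule injI)
    fix m n :: nat assume "of_nat m = (of_nat n :: 'a padic)"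
    hence "padic_of_rat (of_nat m - of_nat n) = (0 :: 'a padic)"
      by (simp add: padic_of_rat_diff padic_of_rat_of_nat)
    thus "m = n" by (simp add: padic_of_rat_eq_0_iff)
  qed
qed

lemma padic_of_rat_eq_of_rat: "(padic_of_rat q :: 'p::prime_card padic) = of_rat q"
proof -
  have int: "padic_of_rat (of_int k) = (of_int k :: 'p padic)" for k
    by (cases k rule: int_cases2) (simp_all add: padic_of_rat_of_nat padic_of_rat_minus)
  obtain a b where q: "q = of_int a / of_int b" "b \<noteq> 0" by (rule rat_frac_cases)
  have "of_int a = q * of_int b" using q by simp
  hence "of_int a = padic_of_rat q * (of_int b :: 'p padic)"
    using padic_of_rat_mult[of q "of_int b", where 'a = 'p] by (simp only: flip: int)
  hence "padic_of_rat q = of_int a / (of_int b :: 'p padic)" using q(2) by (simp add: field_simps)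
  also have "\<dots> = of_rat q" using q(1) by (simp add: of_rat_divide)
  finally show ?thesis .
qed


subsection \<open>The norm and the topology\<close>

lift_definition padic_norm :: "'a::prime_card padic \<Rightarrow> real" is "padic_seq_norm"
proof -
  fix X Y :: "'a padic_seq" assume *: "padic_seq_null (X - Y)"
  have XY: "(\<lambda>n. padic_abs CARD('a) (Rep_padic_seq X n - Rep_padic_seq Y n)) \<longlonglongrightarrow> 0"
    using * by (simp add: minus_padic_seq.rep_eq padic_seq_null.rep_eq padic_null_def)
  have "(\<lambda>n. padic_abs CARD('a) (Rep_padic_seq X n) - padic_abs CARD('a) (Rep_padic_seq Y n)) \<longlonglongrightarrow> 0"
    by (rule tendsto_0_le[OF XY, where K = 1]) (simp add: padic_abs_diff_le[OF prime_card])
  from tendsto_diff[OF padic_seq_norm_LIMSEQ[of X] this]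
  have "(\<lambda>n. padic_abs CARD('a) (Rep_padic_seq Y n)) \<longlonglongrightarrow> padic_seq_norm X" by simp
  thus "padic_seq_norm X = padic_seq_norm Y"
    by (rule LIMSEQ_unique) (rule padic_seq_norm_LIMSEQ)
qed

lemma padic_norm_of_rat: "padic_norm (of_rat q :: 'p::prime_card padic) = padic_abs CARD('p) q"
proof -
  have "padic_seq_norm (padic_seq_const q :: 'p padic_seq) = padic_abs CARD('p) q"
    by transfer simp
  hence "padic_norm (padic_of_rat q :: 'p padic) = padic_abs CARD('p) q" by transfer
  thus ?thesis by (simp add: padic_of_rat_eq_of_rat)
qed

lemma padic_norm_nonneg [simp]: "padic_norm (x :: 'p::prime_card padic) \<ge> 0"
  by transfer (rule LIMSEQ_le_const[OF padic_seq_norm_LIMSEQ], auto)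

lemma padic_norm_eq_0_iff [simp]: "padic_norm (x :: 'p::prime_card padic) = 0 \<longleftrightarrow> x = 0"
proof (transfer, goal_cases)
  case (1 X)
  have "padic_seq_norm X = 0 \<longleftrightarrow> padic_seq_null X"
    unfolding padic_seq_null.rep_eq padic_null_def
    using padic_seq_norm_LIMSEQ[of X] LIMSEQ_unique by metis
  thus ?case by simp
qed

lemma padic_norm_0 [simp]: "padic_norm (0 :: 'p::prime_card padic) = 0"
  by simp

lemma padic_norm_minus [simp]: "padic_norm (- x) = padic_norm (x :: 'p::prime_card padic)"
proof (transfer, goal_cases)
  case (1 X)
  show ?case by transfer (simp add: prime_card)
qed

lemma padic_norm_minus_commute: "padic_norm (x - y) = padic_norm (y - x :: 'p::prime_card padic)"
  using padic_norm_minus[of "x - y"] by simp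

lemma padic_norm_mult: "padic_norm (x * y) = padic_norm x * padic_norm (y :: 'p::prime_card padic)"
proof (transfer, goal_cases)
  case (1 X Y)
  show ?case
    using tendsto_mult[OF padic_seq_norm_LIMSEQ[of X] padic_seq_norm_LIMSEQ[of Y]]
      padic_seq_norm_LIMSEQ[of "X * Y"] LIMSEQ_unique
    by (simp add: times_padic_seq.rep_eq padic_abs_mult prime_card) blast
qed

lemma padic_norm_add: "padic_norm (x + y) \<le> max (padic_norm x) (padic_norm (y :: 'p::prime_card padic))"
proof (transfer, goal_cases)
  case (1 X Y)
  show ?case
    by (rule LIMSEQ_le[OF padic_seq_norm_LIMSEQ
               tendsto_max[OF padic_seq_norm_LIMSEQ padic_seq_norm_LIMSEQ]])
       (auto simp: plus_padic_seq.rep_eq padic_abs_add prime_card)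
qed

lemma padic_norm_add_le: "padic_norm x \<le> r \<Longrightarrow> padic_norm y \<le> r \<Longrightarrow> padic_norm (x + y :: 'p::prime_card padic) \<le> r"
  using padic_norm_add[of x y] by simp

lemma padic_norm_diff_le: "padic_norm x \<le> r \<Longrightarrow> padic_norm y \<le> r \<Longrightarrow> padic_norm (x - y :: 'p::prime_card padic) \<le> r"
  using padic_norm_add[of x "- y"] by simp

lemma padic_norm_1 [simp]: "padic_norm (1 :: 'p::prime_card padic) = 1"
  using padic_norm_of_rat[of 1, where 'p = 'p] by (simp add: prime_card)

lemma padic_norm_sum_le:
  "r \<ge> 0 \<Longrightarrow> (\<And>i. i \<in> A \<Longrightarrow> padic_norm (f i) \<le> r) \<Longrightarrow> padic_norm (sum f A :: 'p::prime_card padic) \<le> r"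
  by (induction A rule: infinite_finite_induct) (auto intro: padic_norm_add_le)

instantiation padic :: (prime_card) metric_space
begin

definition dist_padic :: "'a padic \<Rightarrow> 'a padic \<Rightarrow> real" where
  "dist_padic x y = padic_norm (x - y)"

definition uniformity_padic :: "('a padic \<times> 'a padic) filter" where
  "uniformity_padic = (INF e\<in>{0<..}. principal {(x, y). dist x y < e})"

definition open_padic :: "'a padic set \<Rightarrow> bool" where
  "open_padic U \<longleftrightarrow> (\<forall>x\<in>U. eventually (\<lambda>(x', y). x' = x \<longrightarrow> y \<in> U) uniformity)"

instance
proof
  show "(uniformity :: ('a padic \<times> 'a padic) filter) = (INF e\<in>{0<..}. principal {(x, y). dist x y < e})"
    by (rule uniformity_padic_def)
  show "open U \<longleftrightarrow> (\<forall>x\<in>U. eventually (\<lambda>(x', y). x' = x \<longrightarrow> y \<in> U) uniformity)"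
    for U :: "'a padic set" by (rule open_padic_def)
  fix x y z :: "'a padic"
  show "dist x y = 0 \<longleftrightarrow> x = y" by (simp add: dist_padic_def)
  have "padic_norm (x - y) \<le> max (padic_norm (x - z)) (padic_norm (z - y))"
    using padic_norm_add[of "x - z" "z - y"] by simp
  thus "dist x y \<le> dist x z + dist y z"
    using padic_norm_nonneg[of "x - z"] padic_norm_nonneg[of "z - y"]
    by (simp add: dist_padic_def padic_norm_minus_commute[of y z] del: padic_norm_nonneg)
qed

end

definition padic_ints :: "'p::prime_card padic set" where
  "padic_ints = {x. padic_norm x \<le> 1}"

definition padic_units :: "'p::prime_card padic set" where
  "padic_units = {x \<in> padic_ints. x \<noteq> 0 \<and> inverse x \<in> padic_ints}"

lemma padic_units_norm: "x \<in> padic_units \<longleftrightarrow> padic_norm (x :: 'p::prime_card padic) = 1"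
proof (cases "x = 0")
  case False
  have "padic_norm x * padic_norm (inverse x) = 1"
    using padic_norm_mult[of x "inverse x"] False by simp
  hence inv: "padic_norm (inverse x) = inverse (padic_norm x)" by (simp add: inverse_unique)
  have "padic_norm x > 0" using False padic_norm_nonneg[of x] by (simp add: less_le del: padic_norm_nonneg)
  hence "padic_norm x \<le> 1 \<and> inverse (padic_norm x) \<le> 1 \<longleftrightarrow> padic_norm x = 1"
    by (auto simp: inverse_le_1_iff)
  thus ?thesis using False by (simp add: padic_units_def padic_ints_def inv)
qed (simp add: padic_units_def)


subsection \<open>Approximating \<open>p\<close>-adic integers by natural numbers\<close>

lemma padic_rat_dense:
  fixes x :: "'p::prime_card padic"
  assumes e: "e > 0"
  obtains q where "padic_norm (x - of_rat q) \<le> e"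
proof -
  have "\<exists>q\<in>UNIV. padic_norm (x - padic_of_rat q) \<le> e"
  proof (transfer fixing: e)
    fix X :: "'p padic_seq"
    have "padic_cauchy CARD('p) (Rep_padic_seq X)" using Rep_padic_seq[of X] by simp
    then obtain k where
      k: "\<And>m n. m \<ge> k \<Longrightarrow> n \<ge> k \<Longrightarrow> padic_abs CARD('p) (Rep_padic_seq X m - Rep_padic_seq X n) < e"
      using e unfolding padic_cauchy_def by blast
    have "padic_seq_norm (X - padic_seq_const (Rep_padic_seq X k)) \<le> e"
      by (rule LIMSEQ_le_const2[OF padic_seq_norm_LIMSEQ])
         (use k in \<open>auto simp: minus_padic_seq.rep_eq padic_seq_const.rep_eq
                         intro!: exI[of _ k] less_imp_le\<close>)
    thus "\<exists>q\<in>UNIV. padic_seq_norm (X - padic_seq_const q) \<le> e" by blast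
  qed
  thus ?thesis using that by (auto simp: padic_of_rat_eq_of_rat)
qed

lemma padic_norm_of_int_le_iff:
  "padic_norm (of_int a :: 'p::prime_card padic) \<le> 1 / real CARD('p) ^ n \<longleftrightarrow> int CARD('p) ^ n dvd a"
  using padic_norm_of_rat[of "of_int a", where 'p = 'p]
  by (simp add: padic_abs_of_int_le_iff prime_card)

lemma padic_norm_of_nat_diff_le_iff:
  "padic_norm (of_nat a - of_nat b :: 'p::prime_card padic) \<le> 1 / real CARD('p) ^ n
     \<longleftrightarrow> [a = b] (mod CARD('p) ^ n)"
  using padic_norm_of_int_le_iff[of "int a - int b" n, where 'p = 'p]
  by (simp add: cong_iff_dvd_diff flip: cong_int_iff)

lemma padic_nat_dense:
  fixes x :: "'p::prime_card padic"
  assumes x: "padic_norm x \<le> 1"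
  obtains a where "a < CARD('p) ^ n" "padic_norm (x - of_nat a) \<le> 1 / real CARD('p) ^ n"
proof -
  define p where "p = CARD('p)"
  have p: "prime p" unfolding p_def by (rule prime_card)
  have p1: "real p > 1" using prime_gt_1_nat[OF p] by simp
  define e where "e = 1 / real p ^ n"
  have e: "e > 0" "e \<le> 1" using p1 by (auto simp: e_def)
  obtain q where q: "padic_norm (x - of_rat q) \<le> e" using padic_rat_dense[OF e(1)] .
  have "padic_norm (x - of_rat q) \<le> 1" using q e(2) by linarith
  from padic_norm_diff_le[OF x this] have "padic_norm (of_rat q :: 'p padic) \<le> 1" by simp
  hence q1: "padic_abs p q \<le> 1" by (simp add: padic_norm_of_rat p_def)
  obtain c d where cd: "quotient_of q = (c, d)" by force
  have d: "d > 0" using cd by (rule quotient_of_denom_pos)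
  have qcd: "q = of_int c / of_int d" using cd by (rule quotient_of_div)
  have cop: "coprime c d" using cd by (rule quotient_of_coprime)
  have nd: "\<not> int p dvd d"
  proof
    assume pd: "int p dvd d"
    hence npc: "\<not> int p dvd c" using cop p
      by (metis coprime_common_divisor not_prime_unit prime_nat_int_transfer)
    hence c: "c \<noteq> 0" by auto
    have "multiplicity (int p) d \<ge> 1"
      using pd d p by (intro multiplicity_geI) (auto simp: not_prime_unit)
    moreover have "multiplicity (int p) c = 0" using npc by (rule not_dvd_imp_multiplicity_0)
    ultimately have "padic_abs p q = real p ^ multiplicity (int p) d" "multiplicity (int p) d > 0"
      using padic_abs_frac[OF p c, of d] d qcd by auto
    thus False using q1 p1 by (metis not_le one_less_power)
  qed
  have "coprime d (int p ^ n)"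
    using nd p by (metis coprime_commute coprime_power_left_iff prime_imp_coprime prime_nat_int_transfer)
  then obtain y where y: "[d * y = 1] (mod int p ^ n)" using cong_solve_coprime_int by blast
  define a where "a = nat ((c * y) mod int p ^ n)"
  have pn: "int p ^ n > 0" using prime_gt_0_nat[OF p] by simp
  have a: "int a = (c * y) mod int p ^ n" unfolding a_def using pn by simp
  have "[d * int a = c * 1] (mod int p ^ n)"
  proof -
    have "[d * int a = d * (c * y)] (mod int p ^ n)"
      unfolding a by (intro cong_mult) (auto simp: cong_def)
    also have "d * (c * y) = c * (d * y)" by simp
    also have "[c * (d * y) = c * 1] (mod int p ^ n)" using y by (intro cong_mult) auto
    finally show ?thesis .
  qed
  hence "int p ^ n dvd c - d * int a" by (simp add: cong_iff_dvd_diff dvd_diff_commute)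
  hence le: "padic_abs p (of_int (c - d * int a)) \<le> e"
    by (simp only: padic_abs_of_int_le_iff[OF p] e_def)
  have dabs: "padic_abs p (of_int d) = 1"
    using padic_abs_frac[OF p, of d 1] d nd by (simp add: not_dvd_imp_multiplicity_0)
  have "of_int (c - d * int a) = of_int d * (q - of_nat a)"
    using d by (simp add: qcd field_simps)
  with le have "padic_abs p (q - of_nat a) \<le> e" using dabs by (simp add: padic_abs_mult[OF p])
  hence "padic_norm (of_rat q - of_nat a :: 'p padic) \<le> e"
    using padic_norm_of_rat[of "q - of_nat a", where 'p = 'p]
    by (simp add: of_rat_diff p_def)
  with q have "padic_norm ((x - of_rat q) + (of_rat q - of_nat a)) \<le> e"
    by (intro padic_norm_add_le)
  moreover have "a < p ^ n"
    using a pn by (metis of_nat_less_iff of_nat_power pos_mod_bound)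
  ultimately show ?thesis using that[of a] by (simp add: e_def p_def)
qed


section \<open>The Teichmueller character, logarithm, exponential and \<open>p\<close>-adic powers\<close>

definition teichmuller :: "'p::prime_card padic \<Rightarrow> 'p padic" where
  "teichmuller x = (THE z. z ^ (CARD('p) - 1) = 1 \<and> padic_norm (z - x) < 1)"

text \<open>Usually written \<open>\<langle>x\<rangle>\<close>; it lies in \<open>1 + p Z_p\<close> for a unit \<open>x\<close>.\<close>

definition principal_unit :: "'p::prime_card padic \<Rightarrow> 'p padic" where
  "principal_unit x = inverse (teichmuller x) * x"

definition padic_exp :: "'p::prime_card padic \<Rightarrow> 'p padic" where
  "padic_exp x = (\<Sum>n. x ^ n / fact n)"

definition padic_log :: "'p::prime_card padic \<Rightarrow> 'p padic" where
  "padic_log x = (\<Sum>n. (- 1) ^ n * (x - 1) ^ Suc n / of_nat (Suc n))"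

text \<open>
  The power \<open>x^s\<close> is meant for \<open>x\<close> in \<open>1 + p Z_p\<close> and \<open>s\<close> in \<open>Z_p\<close>; for odd \<open>p\<close> both series
  then converge.
\<close>

definition padic_power :: "'p::prime_card padic \<Rightarrow> 'p padic \<Rightarrow> 'p padic" where
  "padic_power x s = padic_exp (s * padic_log x)"


section \<open>The Iwasawa algebra of the group of \<open>p\<close>-adic units\<close>

definition unit_residues :: "nat \<Rightarrow> nat \<Rightarrow> nat set" where
  "unit_residues p n = {a. a < p ^ n \<and> coprime a (p ^ n)}"

lemma finite_unit_residues [simp]: "finite (unit_residues p n)"
  by (rule finite_subset[of _ "{..<p ^ n}"]) (auto simp: unit_residues_def)

text \<open>
  An element of \<open>Z_p[(Z/p^n)*]\<close> is a function on \<^term>\<open>unit_residues p n\<close> with values in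
  \<open>Z_p\<close>, extended by \<open>0\<close>; an element of the inverse limit is a sequence of such functions that is
  compatible with the maps \<open>Z_p[(Z/p^(n+1))*] \<rightarrow> Z_p[(Z/p^n)*]\<close>, which sum over the fibres
  of reduction. For the corresponding measure \<open>\<mu>\<close>, the coefficient of \<open>a\<close> at level \<open>n\<close> is
  \<open>\<mu>(a + p^n Z_p)\<close>.
\<close>

definition compatible_family :: "(nat \<Rightarrow> nat \<Rightarrow> 'p::prime_card padic) \<Rightarrow> bool" where
  "compatible_family \<mu> \<longleftrightarrow>
    (\<forall>n a. \<mu> n a \<in> padic_ints) \<and>
    (\<forall>n a. a \<notin> unit_residues CARD('p) n \<longrightarrow> \<mu> n a = 0) \<and>
    (\<forall>n. \<forall>a\<in>unit_residues CARD('p) n.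
       \<mu> n a = (\<Sum>b\<in>{b \<in> unit_residues CARD('p) (Suc n). b mod CARD('p) ^ n = a}. \<mu> (Suc n) b))"

lemma compatible_familyI:
  fixes \<mu> :: "nat \<Rightarrow> nat \<Rightarrow> 'p::prime_card padic"
  assumes "\<And>n a. padic_norm (\<mu> n a) \<le> 1"
    and "\<And>n a. a \<notin> unit_residues CARD('p) n \<Longrightarrow> \<mu> n a = 0"
    and "\<And>n a. a \<in> unit_residues CARD('p) n \<Longrightarrow>
      \<mu> n a = (\<Sum>b\<in>{b \<in> unit_residues CARD('p) (Suc n). b mod CARD('p) ^ n = a}. \<mu> (Suc n) b)"
  shows "compatible_family \<mu>"
  unfolding compatible_family_def padic_ints_def using assms by blast

lemma compatible_familyD:
  fixes \<mu> :: "nat \<Rightarrow> nat \<Rightarrow> 'p::prime_card padic"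
  assumes "compatible_family \<mu>"
  shows "padic_norm (\<mu> n a) \<le> 1"
    and "a \<notin> unit_residues CARD('p) n \<Longrightarrow> \<mu> n a = 0"
    and "a \<in> unit_residues CARD('p) n \<Longrightarrow>
      \<mu> n a = (\<Sum>b\<in>{b \<in> unit_residues CARD('p) (Suc n). b mod CARD('p) ^ n = a}. \<mu> (Suc n) b)"
  using assms unfolding compatible_family_def padic_ints_def by blast+

typedef (overloaded) 'p iwasawa = "{\<mu> :: nat \<Rightarrow> nat \<Rightarrow> 'p::prime_card padic. compatible_family \<mu>}"
  morphisms iwasawa_coeff Abs_iwasawa
  by (rule exI[of _ "\<lambda>_ _. 0"]) (auto intro: compatible_familyI)

setup_lifting type_definition_iwasawa

definition unit_conv ::
  "nat \<Rightarrow> (nat \<Rightarrow> nat \<Rightarrow> 'a::comm_ring_1) \<Rightarrow> (nat \<Rightarrow> nat \<Rightarrow> 'a) \<Rightarrow> nat \<Rightarrow> nat \<Rightarrow> 'a" where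
  "unit_conv p \<mu> \<nu> n c = (\<Sum>a\<in>unit_residues p n.
     \<Sum>b\<in>{b \<in> unit_residues p n. a * b mod p ^ n = c}. \<mu> n a * \<nu> n b)"

context
  fixes p :: nat
  assumes p: "prime p"
begin

lemma unit_residues_mod:
  assumes "a \<in> unit_residues p m" "n \<le> m"
  shows "a mod p ^ n \<in> unit_residues p n"
proof -
  have "p ^ n dvd p ^ m" using assms(2) by (rule le_imp_power_dvd)
  hence "coprime a (p ^ n)" using assms(1) coprime_divisors[of a a "p ^ n" "p ^ m"]
    by (simp add: unit_residues_def)
  hence "coprime (a mod p ^ n) (p ^ n)"
    using prime_gt_0_nat[OF p] by (subst coprime_mod_left_iff) auto
  thus ?thesis using prime_gt_0_nat[OF p] by (simp add: unit_residues_def del: coprime_power_right_iff)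
qed

lemma unit_residues_mult_mod:
  assumes "a \<in> unit_residues p n" "b \<in> unit_residues p n"
  shows "a * b mod p ^ n \<in> unit_residues p n"
proof -
  have "coprime (a * b) (p ^ n)"
    using assms by (simp add: unit_residues_def del: coprime_power_right_iff)
  hence "coprime (a * b mod p ^ n) (p ^ n)"
    using prime_gt_0_nat[OF p] by (subst coprime_mod_left_iff) auto
  thus ?thesis using prime_gt_0_nat[OF p] by (simp add: unit_residues_def del: coprime_power_right_iff)
qed

lemma unit_residues_one_mod: "1 mod p ^ n \<in> unit_residues p n"
proof -
  have "coprime (1 mod p ^ n) (p ^ n)"
    using prime_gt_0_nat[OF p] by (subst coprime_mod_left_iff) auto
  moreover have "1 mod p ^ n < p ^ n" using prime_gt_0_nat[OF p] by (intro mod_less_divisor) simp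
  ultimately show ?thesis by (simp only: unit_residues_def mem_Collect_eq)
qed

lemma sum_fibre_delta:
  "finite A \<Longrightarrow> (\<Sum>b\<in>{b \<in> A. P b}. f b) = (\<Sum>b\<in>A. if P b then f b else (0::'a::comm_ring_1))"
  by (simp add: sum.inter_filter)

lemma unit_conv_pairing:
  "(\<Sum>c\<in>unit_residues p n. unit_conv p \<mu> \<nu> n c * h c)
     = (\<Sum>a\<in>unit_residues p n. \<Sum>b\<in>unit_residues p n. \<mu> n a * \<nu> n b * h (a * b mod p ^ n))"
proof -
  let ?U = "unit_residues p n"
  have "(\<Sum>c\<in>?U. unit_conv p \<mu> \<nu> n c * h c)
      = (\<Sum>c\<in>?U. \<Sum>a\<in>?U. \<Sum>b\<in>?U. if a * b mod p ^ n = c then \<mu> n a * \<nu> n b * h c else 0)"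
    unfolding unit_conv_def sum_distrib_right sum_fibre_delta[OF finite_unit_residues]
    by (intro sum.cong refl) simp
  also have "\<dots> = (\<Sum>a\<in>?U. \<Sum>b\<in>?U. \<Sum>c\<in>?U. if a * b mod p ^ n = c then \<mu> n a * \<nu> n b * h c else 0)"
    by (rule trans[OF sum.swap]) (intro sum.cong refl sum.swap)
  also have "\<dots> = (\<Sum>a\<in>?U. \<Sum>b\<in>?U. \<mu> n a * \<nu> n b * h (a * b mod p ^ n))"
    by (intro sum.cong refl) (simp add: unit_residues_mult_mod)
  finally show ?thesis .
qed

lemma unit_conv_eq_pairing:
  "unit_conv p \<mu> \<nu> n c = (\<Sum>a\<in>unit_residues p n. \<Sum>b\<in>unit_residues p n.
     \<mu> n a * \<nu> n b * (if a * b mod p ^ n = c then 1 else 0))"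
  unfolding unit_conv_def sum_fibre_delta[OF finite_unit_residues]
  by (intro sum.cong refl) simp

lemma unit_conv_commute: "unit_conv p \<mu> \<nu> n c = unit_conv p \<nu> \<mu> n c"
  unfolding unit_conv_eq_pairing by (subst sum.swap) (simp add: mult.commute)

lemma unit_conv_assoc:
  "unit_conv p (unit_conv p \<mu> \<nu>) \<rho> n d = unit_conv p \<mu> (unit_conv p \<nu> \<rho>) n d"
proof -
  let ?U = "unit_residues p n" and ?N = "p ^ n"
  let ?\<delta> = "\<lambda>x. if x mod ?N = d then 1 else (0::'a)"
  have "unit_conv p (unit_conv p \<mu> \<nu>) \<rho> n d
      = (\<Sum>c\<in>?U. \<Sum>x\<in>?U. unit_conv p \<mu> \<nu> n x * (\<rho> n c * ?\<delta> (x * c)))"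
    unfolding unit_conv_eq_pairing[of "unit_conv p \<mu> \<nu>"] by (subst sum.swap) (simp add: mult.assoc)
  also have "\<dots> = (\<Sum>c\<in>?U. \<Sum>a\<in>?U. \<Sum>b\<in>?U. \<mu> n a * \<nu> n b * (\<rho> n c * ?\<delta> ((a * b mod ?N) * c)))"
    by (intro sum.cong refl unit_conv_pairing)
  also have "\<dots> = (\<Sum>a\<in>?U. \<Sum>c\<in>?U. \<Sum>b\<in>?U. \<mu> n a * \<nu> n b * (\<rho> n c * ?\<delta> ((a * b mod ?N) * c)))"
    by (rule sum.swap)
  also have "\<dots> = (\<Sum>a\<in>?U. \<Sum>b\<in>?U. \<Sum>c\<in>?U. \<mu> n a * \<nu> n b * (\<rho> n c * ?\<delta> ((a * b mod ?N) * c)))"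
    by (intro sum.cong refl sum.swap)
  also have "\<dots> = (\<Sum>a\<in>?U. \<Sum>b\<in>?U. \<Sum>c\<in>?U. \<nu> n b * \<rho> n c * (\<mu> n a * ?\<delta> (a * (b * c mod ?N))))"
    by (intro sum.cong refl) (simp add: mod_mult_left_eq mod_mult_right_eq mult_ac)
  also have "\<dots> = (\<Sum>a\<in>?U. \<Sum>x\<in>?U. unit_conv p \<nu> \<rho> n x * (\<mu> n a * ?\<delta> (a * x)))"
    by (intro sum.cong refl unit_conv_pairing[symmetric])
  also have "\<dots> = unit_conv p \<mu> (unit_conv p \<nu> \<rho>) n d"
    unfolding unit_conv_eq_pairing[of \<mu>] by (intro sum.cong refl) (simp add: mult_ac)
  finally show ?thesis .
qed

lemma unit_conv_outside: "c \<notin> unit_residues p n \<Longrightarrow> unit_conv p \<mu> \<nu> n c = 0"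
  unfolding unit_conv_def using unit_residues_mult_mod by (intro sum.neutral ballI) auto

lemma unit_conv_one:
  assumes "\<And>a. a \<notin> unit_residues p n \<Longrightarrow> \<mu> n a = 0"
  shows "unit_conv p (\<lambda>n a. if a = 1 mod p ^ n then 1 else 0) \<mu> n c = \<mu> n c"
proof -
  let ?U = "unit_residues p n"
  have "unit_conv p (\<lambda>n a. if a = 1 mod p ^ n then 1 else 0) \<mu> n c
      = (\<Sum>a\<in>?U. if a = 1 mod p ^ n then \<Sum>b\<in>?U. \<mu> n b * (if a * b mod p ^ n = c then 1 else 0) else 0)"
    unfolding unit_conv_eq_pairing by (intro sum.cong refl) auto
  also have "\<dots> = (\<Sum>b\<in>?U. \<mu> n b * (if (1 mod p ^ n) * b mod p ^ n = c then 1 else 0))"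
    using unit_residues_one_mod[of n] by simp
  also have "\<dots> = (\<Sum>b\<in>?U. if b = c then \<mu> n b else 0)"
  proof (intro sum.cong refl)
    fix b assume "b \<in> ?U"
    hence "(1 mod p ^ n) * b mod p ^ n = b" by (subst mod_mult_left_eq) (simp add: unit_residues_def)
    thus "\<mu> n b * (if (1 mod p ^ n) * b mod p ^ n = c then 1 else 0) = (if b = c then \<mu> n b else 0)"
      by simp
  qed
  also have "\<dots> = \<mu> n c" using assms by simp
  finally show ?thesis .
qed

lemma unit_conv_compatible:
  assumes \<mu>: "\<And>a. a \<in> unit_residues p n \<Longrightarrow>
      \<mu> n a = (\<Sum>b\<in>{b \<in> unit_residues p (Suc n). b mod p ^ n = a}. \<mu> (Suc n) b)"
    and \<nu>: "\<And>a. a \<in> unit_residues p n \<Longrightarrow>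
      \<nu> n a = (\<Sum>b\<in>{b \<in> unit_residues p (Suc n). b mod p ^ n = a}. \<nu> (Suc n) b)"
  shows "unit_conv p \<mu> \<nu> n c
       = (\<Sum>d\<in>{d \<in> unit_residues p (Suc n). d mod p ^ n = c}. unit_conv p \<mu> \<nu> (Suc n) d)"
proof -
  let ?U = "unit_residues p n" and ?V = "unit_residues p (Suc n)" and ?N = "p ^ n"
  let ?\<delta> = "\<lambda>x. if x mod ?N = c then 1 else (0::'a)"
  have push: "(\<Sum>a\<in>?U. (\<Sum>b\<in>{b \<in> ?V. b mod ?N = a}. f b) * g a) = (\<Sum>b\<in>?V. f b * g (b mod ?N))"
    for f g :: "nat \<Rightarrow> 'a"
  proof -
    have "(\<Sum>a\<in>?U. (\<Sum>b\<in>{b \<in> ?V. b mod ?N = a}. f b) * g a)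
        = (\<Sum>a\<in>?U. \<Sum>b\<in>{b \<in> ?V. b mod ?N = a}. f b * g (b mod ?N))"
      unfolding sum_distrib_right by (intro sum.cong refl) auto
    also have "\<dots> = (\<Sum>b\<in>?V. f b * g (b mod ?N))"
      by (rule sum.group) (auto intro: unit_residues_mod)
    finally show ?thesis .
  qed
  have push\<mu>: "(\<Sum>b\<in>?V. \<mu> (Suc n) b * g (b mod ?N)) = (\<Sum>a\<in>?U. \<mu> n a * g a)" for g
    unfolding push[symmetric] by (intro sum.cong refl) (simp add: \<mu>)
  have push\<nu>: "(\<Sum>b\<in>?V. \<nu> (Suc n) b * g (b mod ?N)) = (\<Sum>a\<in>?U. \<nu> n a * g a)" for g
    unfolding push[symmetric] by (intro sum.cong refl) (simp add: \<nu>)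
  have "(\<Sum>d\<in>{d \<in> ?V. d mod ?N = c}. unit_conv p \<mu> \<nu> (Suc n) d)
      = (\<Sum>d\<in>?V. unit_conv p \<mu> \<nu> (Suc n) d * ?\<delta> d)"
    unfolding sum_fibre_delta[OF finite_unit_residues] by (intro sum.cong refl) simp
  also have "\<dots> = (\<Sum>a\<in>?V. \<Sum>b\<in>?V. \<mu> (Suc n) a * \<nu> (Suc n) b * ?\<delta> (a * b mod p ^ Suc n))"
    by (rule unit_conv_pairing)
  also have "\<dots> = (\<Sum>a\<in>?V. \<Sum>b\<in>?V. \<mu> (Suc n) a * (\<nu> (Suc n) b * ?\<delta> ((a mod ?N) * (b mod ?N))))"
    by (intro sum.cong refl) (simp add: mod_mod_cancel mod_mult_eq mult.assoc)
  also have "\<dots> = (\<Sum>a\<in>?V. \<mu> (Suc n) a * (\<Sum>b\<in>?V. \<nu> (Suc n) b * ?\<delta> ((a mod ?N) * (b mod ?N))))"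
    by (simp only: sum_distrib_left)
  also have "\<dots> = (\<Sum>a\<in>?V. \<mu> (Suc n) a * (\<Sum>b\<in>?U. \<nu> n b * ?\<delta> ((a mod ?N) * b)))"
  proof (rule sum.cong[OF refl])
    fix a
    show "\<mu> (Suc n) a * (\<Sum>b\<in>?V. \<nu> (Suc n) b * ?\<delta> ((a mod ?N) * (b mod ?N)))
        = \<mu> (Suc n) a * (\<Sum>b\<in>?U. \<nu> n b * ?\<delta> ((a mod ?N) * b))"
      by (simp only: push\<nu>[of "\<lambda>x. ?\<delta> ((a mod ?N) * x)"])
  qed
  also have "\<dots> = (\<Sum>a\<in>?U. \<mu> n a * (\<Sum>b\<in>?U. \<nu> n b * ?\<delta> (a * b)))"
    by (rule push\<mu>)
  also have "\<dots> = unit_conv p \<mu> \<nu> n c"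
    unfolding unit_conv_eq_pairing sum_distrib_left by (simp add: mult.assoc)
  finally show ?thesis ..
qed

end

lemma compatible_family_conv:
  fixes \<mu> \<nu> :: "nat \<Rightarrow> nat \<Rightarrow> 'p::prime_card padic"
  assumes \<mu>: "compatible_family \<mu>" and \<nu>: "compatible_family \<nu>"
  shows "compatible_family (unit_conv CARD('p) \<mu> \<nu>)"
proof (rule compatible_familyI)
  fix n c
  have "padic_norm (\<mu> n a * \<nu> n b) \<le> 1" for a b
    using compatible_familyD(1)[OF \<mu>] compatible_familyD(1)[OF \<nu>]
    by (simp add: padic_norm_mult mult_le_one)
  thus "padic_norm (unit_conv CARD('p) \<mu> \<nu> n c) \<le> 1"
    unfolding unit_conv_def by (intro padic_norm_sum_le) simp_all
  show "unit_conv CARD('p) \<mu> \<nu> n c = 0" if "c \<notin> unit_residues CARD('p) n"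
    by (rule unit_conv_outside[OF prime_card that])
  show "unit_conv CARD('p) \<mu> \<nu> n c
      = (\<Sum>d\<in>{d \<in> unit_residues CARD('p) (Suc n). d mod CARD('p) ^ n = c}.
           unit_conv CARD('p) \<mu> \<nu> (Suc n) d)"
    by (rule unit_conv_compatible[OF prime_card])
       (erule compatible_familyD(3)[OF \<mu>], erule compatible_familyD(3)[OF \<nu>])
qed

instantiation iwasawa :: (prime_card) comm_ring_1
begin

lift_definition zero_iwasawa :: "'a iwasawa" is "\<lambda>_ _. 0"
  by (rule compatible_familyI) simp_all

lift_definition one_iwasawa :: "'a iwasawa" is "\<lambda>n a. if a = 1 mod CARD('a) ^ n then 1 else 0"
proof -
  let ?p = "CARD('a)" let ?e = "\<lambda>n a. if a = 1 mod ?p ^ n then 1 else (0 :: 'a padic)"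
  have U: "1 mod ?p ^ n \<in> unit_residues ?p n" for n
    by (rule unit_residues_one_mod[OF prime_card])
  have "?e n a = (\<Sum>b\<in>{b \<in> unit_residues ?p (Suc n). b mod ?p ^ n = a}. ?e (Suc n) b)" for n a
  proof -
    have "(\<Sum>b\<in>{b \<in> unit_residues ?p (Suc n). b mod ?p ^ n = a}. ?e (Suc n) b)
        = (if 1 mod ?p ^ Suc n \<in> {b \<in> unit_residues ?p (Suc n). b mod ?p ^ n = a} then 1 else 0)"
      by (rule sum.delta) simp
    also have "1 mod ?p ^ Suc n \<in> {b \<in> unit_residues ?p (Suc n). b mod ?p ^ n = a}
                 \<longleftrightarrow> 1 mod ?p ^ Suc n mod ?p ^ n = a"
      using U[of "Suc n"] by (simp only: mem_Collect_eq simp_thms)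
    also have "1 mod ?p ^ Suc n mod ?p ^ n = 1 mod ?p ^ n"
      by (rule mod_mod_cancel) (simp add: le_imp_power_dvd)
    finally show ?thesis by (simp only: eq_commute[of a])
  qed
  moreover have "padic_norm (?e n a) \<le> 1" for n a by simp
  moreover have "?e n a = 0" if "a \<notin> unit_residues ?p n" for n a using U[of n] that by metis
  ultimately show "compatible_family ?e" by (intro compatible_familyI)
qed

lift_definition plus_iwasawa :: "'a iwasawa \<Rightarrow> 'a iwasawa \<Rightarrow> 'a iwasawa"
  is "\<lambda>\<mu> \<nu> n a. \<mu> n a + \<nu> n a"
  by (rule compatible_familyI)
     (simp_all add: compatible_familyD(1,2) padic_norm_add_le sum.distrib flip: compatible_familyD(3))

lift_definition minus_iwasawa :: "'a iwasawa \<Rightarrow> 'a iwasawa \<Rightarrow> 'a iwasawa"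
  is "\<lambda>\<mu> \<nu> n a. \<mu> n a - \<nu> n a"
  by (rule compatible_familyI)
     (simp_all add: compatible_familyD(1,2) padic_norm_diff_le sum_subtractf flip: compatible_familyD(3))

lift_definition uminus_iwasawa :: "'a iwasawa \<Rightarrow> 'a iwasawa" is "\<lambda>\<mu> n a. - \<mu> n a"
  by (rule compatible_familyI)
     (simp_all add: compatible_familyD(1,2) sum_negf flip: compatible_familyD(3))

lift_definition times_iwasawa :: "'a iwasawa \<Rightarrow> 'a iwasawa \<Rightarrow> 'a iwasawa"
  is "unit_conv CARD('a)"
  by (rule compatible_family_conv)

instance
proof
  fix a b c :: "'a iwasawa"
  show "a + b + c = a + (b + c)" by transfer (simp add: add.assoc)
  show "a + b = b + a" by transfer (simp add: add.commute)
  show "0 + a = a" by transfer simp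
  show "- a + a = 0" by transfer simp
  show "a - b = a + - b" by transfer simp
  show "a * b * c = a * (b * c)"
    by transfer (intro ext unit_conv_assoc prime_card)
  show "a * b = b * a"
    by transfer (intro ext unit_conv_commute prime_card)
  show "1 * a = a"
    by transfer (intro ext unit_conv_one prime_card, erule compatible_familyD(2))
  show "(a + b) * c = a * c + b * c"
    by transfer (simp add: fun_eq_iff unit_conv_def distrib_right sum.distrib)
  show "(0::'a iwasawa) \<noteq> 1"
    by transfer (auto simp: fun_eq_iff)
qed

end

text \<open>The group element \<open>[g]\<close> (that is, the Dirac measure at \<open>g\<close>) of a unit \<open>g\<close>.\<close>

lift_definition dirac :: "'p::prime_card padic \<Rightarrow> 'p iwasawa" is
  "\<lambda>g n a. if g \<in> padic_units \<and> a \<in> unit_residues CARD('p) n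
              \<and> padic_norm (g - of_nat a) \<le> 1 / real CARD('p) ^ n then 1 else 0"
proof -
  fix g :: "'p padic"
  let ?p = "CARD('p)"
  let ?R = "\<lambda>n a. padic_norm (g - of_nat a) \<le> 1 / real ?p ^ n"
  let ?e = "\<lambda>n a. if g \<in> padic_units \<and> a \<in> unit_residues ?p n \<and> ?R n a then 1 else (0 :: 'p padic)"
  have "?e n a = (\<Sum>b\<in>{b \<in> unit_residues ?p (Suc n). b mod ?p ^ n = a}. ?e (Suc n) b)"
    if a: "a \<in> unit_residues ?p n" for n a
  proof (cases "g \<in> padic_units")
    case g: True
    have p: "prime ?p" by (rule prime_card)
    have p1: "real ?p > 1" using prime_gt_1_nat[OF p] by simp
    have g1: "padic_norm g = 1" using g by (simp add: padic_units_norm)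
    then obtain h where h: "h < ?p ^ Suc n" "?R (Suc n) h"
      using padic_nat_dense[of g "Suc n"] by auto
    have R_iff: "?R m b \<longleftrightarrow> [h = b] (mod ?p ^ m)" if "m \<le> Suc n" for m b
    proof -
      have "1 / real ?p ^ Suc n \<le> 1 / real ?p ^ m"
        using p1 that by (intro divide_left_mono power_increasing) auto
      hence Rh: "?R m h" using h(2) by linarith
      have "?R m b \<longleftrightarrow> padic_norm (of_nat h - of_nat b :: 'p padic) \<le> 1 / real ?p ^ m"
      proof
        assume "?R m b"
        from padic_norm_diff_le[OF this Rh]
        show "padic_norm (of_nat h - of_nat b :: 'p padic) \<le> 1 / real ?p ^ m" by simp
      next
        assume "padic_norm (of_nat h - of_nat b :: 'p padic) \<le> 1 / real ?p ^ m"
        from padic_norm_add_le[OF Rh this] show "?R m b" by simp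
      qed
      thus ?thesis by (simp only: padic_norm_of_nat_diff_le_iff)
    qed
    have "\<not> ?p dvd h"
    proof
      assume "?p dvd h"
      hence "?R 1 0" using R_iff[of 1 0] by (simp add: cong_0_iff)
      thus False using g1 p1 by simp
    qed
    hence "coprime h (?p ^ Suc n)"
      using p by (metis coprime_commute coprime_power_right_iff prime_imp_coprime)
    hence hU: "h \<in> unit_residues ?p (Suc n)" using h(1) by (simp add: unit_residues_def)
    have "(\<Sum>b\<in>{b \<in> unit_residues ?p (Suc n). b mod ?p ^ n = a}. ?e (Suc n) b)
        = (\<Sum>b\<in>{b \<in> unit_residues ?p (Suc n). b mod ?p ^ n = a}. if b = h then 1 else 0)"
    proof (intro sum.cong refl)
      fix b assume b: "b \<in> {b \<in> unit_residues ?p (Suc n). b mod ?p ^ n = a}"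
      hence "?R (Suc n) b \<longleftrightarrow> b = h"
        using h(1) R_iff[of "Suc n" b] by (auto simp: unit_residues_def cong_def)
      thus "?e (Suc n) b = (if b = h then 1 else 0)" using b g by simp
    qed
    also have "\<dots> = (if h mod ?p ^ n = a then 1 else 0)"
      using hU by (subst sum.delta) auto
    also have "h mod ?p ^ n = a \<longleftrightarrow> ?R n a"
      using R_iff[of n a] a by (auto simp: cong_def unit_residues_def)
    finally show ?thesis using g a by simp
  qed simp
  moreover have "padic_norm (?e n a) \<le> 1" for n a by simp
  moreover have "?e n a = 0" if "a \<notin> unit_residues ?p n" for n a using that by simp
  ultimately show "compatible_family ?e" by (intro compatible_familyI)
qed

text \<open>The limit of Riemann sums exists for continuous \<open>f\<close>.\<close>

definition iwasawa_integral :: "'p::prime_card iwasawa \<Rightarrow> ('p padic \<Rightarrow> 'p padic) \<Rightarrow> 'p padic" where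
  "iwasawa_integral \<mu> f =
     lim (\<lambda>n. \<Sum>a\<in>unit_residues CARD('p) n. f (of_nat a) * iwasawa_coeff \<mu> n a)"


section \<open>The total ring of fractions\<close>

definition regular_elem :: "'a::comm_ring_1 \<Rightarrow> bool" where
  "regular_elem a \<longleftrightarrow> (\<forall>x. a * x = 0 \<longrightarrow> x = 0)"

lemma regular_elem_1 [simp]: "regular_elem 1"
  by (simp add: regular_elem_def)

lemma regular_elem_mult [simp]: "regular_elem a \<Longrightarrow> regular_elem b \<Longrightarrow> regular_elem (a * b)"
  unfolding regular_elem_def mult.assoc by blast

lemma regular_elem_cancel: "regular_elem a \<Longrightarrow> a * x = a * y \<Longrightarrow> x = y"
proof -
  assume a: "regular_elem a" and "a * x = a * y"
  hence "a * (x - y) = 0" by (simp add: right_diff_distrib)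
  with a have "x - y = 0" unfolding regular_elem_def by blast
  thus "x = y" by simp
qed

definition total_fract_rel :: "'a::comm_ring_1 \<times> 'a \<Rightarrow> 'a \<times> 'a \<Rightarrow> bool" where
  "total_fract_rel x y \<longleftrightarrow> regular_elem (snd x) \<and> regular_elem (snd y)
                            \<and> fst x * snd y = fst y * snd x"

lemma part_equivp_total_fract_rel: "part_equivp (total_fract_rel :: 'a::comm_ring_1 \<times> 'a \<Rightarrow> _)"
proof (rule part_equivpI)
  show "\<exists>x. total_fract_rel x (x :: 'a \<times> 'a)"
    by (rule exI[of _ "(0, 1)"]) (simp add: total_fract_rel_def)
  show "symp (total_fract_rel :: 'a \<times> 'a \<Rightarrow> _)"
    by (rule sympI) (simp add: total_fract_rel_def)
  show "transp (total_fract_rel :: 'a \<times> 'a \<Rightarrow> _)"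
  proof (rule transpI)
    fix x y z :: "'a \<times> 'a"
    assume xy: "total_fract_rel x y" and yz: "total_fract_rel y z"
    have eqs: "fst x * snd y = fst y * snd x" "fst y * snd z = fst z * snd y"
      and y: "regular_elem (snd y)"
      using xy yz unfolding total_fract_rel_def by blast+
    have "snd y * (fst x * snd z) = (fst x * snd y) * snd z" by (simp add: mult_ac)
    also have "\<dots> = (fst y * snd z) * snd x" unfolding eqs(1) by (simp add: mult_ac)
    also have "\<dots> = snd y * (fst z * snd x)" unfolding eqs(2) by (simp add: mult_ac)
    finally have "fst x * snd z = fst z * snd x" using y by (rule regular_elem_cancel[rotated])
    thus "total_fract_rel x z" using xy yz by (simp add: total_fract_rel_def)
  qed
qed

quotient_type (overloaded) 'a total_fract = "'a::comm_ring_1 \<times> 'a" / partial: total_fract_rel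
  by (rule part_equivp_total_fract_rel)

instantiation total_fract :: (comm_ring_1) comm_ring_1
begin

lift_definition zero_total_fract :: "'a total_fract" is "(0, 1)"
  by (simp add: total_fract_rel_def)

lift_definition one_total_fract :: "'a total_fract" is "(1, 1)"
  by (simp add: total_fract_rel_def)

lift_definition plus_total_fract :: "'a total_fract \<Rightarrow> 'a total_fract \<Rightarrow> 'a total_fract"
  is "\<lambda>x y. (fst x * snd y + fst y * snd x, snd x * snd y)"
proof -
  fix x x' y y' :: "'a \<times> 'a"
  assume *: "total_fract_rel x x'" "total_fract_rel y y'"
  hence eqs: "fst x * snd x' = fst x' * snd x" "fst y * snd y' = fst y' * snd y"
    unfolding total_fract_rel_def by blast+
  have "(fst x * snd y + fst y * snd x) * (snd x' * snd y')
      = (fst x * snd x') * (snd y * snd y') + (fst y * snd y') * (snd x * snd x')"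
    by (simp add: algebra_simps)
  also have "\<dots> = (fst x' * snd y' + fst y' * snd x') * (snd x * snd y)"
    unfolding eqs by (simp add: algebra_simps)
  finally show "total_fract_rel (fst x * snd y + fst y * snd x, snd x * snd y)
      (fst x' * snd y' + fst y' * snd x', snd x' * snd y')"
    using * by (simp add: total_fract_rel_def)
qed

lift_definition uminus_total_fract :: "'a total_fract \<Rightarrow> 'a total_fract"
  is "\<lambda>x. (- fst x, snd x)"
  by (simp add: total_fract_rel_def)

lift_definition minus_total_fract :: "'a total_fract \<Rightarrow> 'a total_fract \<Rightarrow> 'a total_fract"
  is "\<lambda>x y. (fst x * snd y - fst y * snd x, snd x * snd y)"
proof -
  fix x x' y y' :: "'a \<times> 'a"
  assume *: "total_fract_rel x x'" "total_fract_rel y y'"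
  hence eqs: "fst x * snd x' = fst x' * snd x" "fst y * snd y' = fst y' * snd y"
    unfolding total_fract_rel_def by blast+
  have "(fst x * snd y - fst y * snd x) * (snd x' * snd y')
      = (fst x * snd x') * (snd y * snd y') - (fst y * snd y') * (snd x * snd x')"
    by (simp add: algebra_simps)
  also have "\<dots> = (fst x' * snd y' - fst y' * snd x') * (snd x * snd y)"
    unfolding eqs by (simp add: algebra_simps)
  finally show "total_fract_rel (fst x * snd y - fst y * snd x, snd x * snd y)
      (fst x' * snd y' - fst y' * snd x', snd x' * snd y')"
    using * by (simp add: total_fract_rel_def)
qed

lift_definition times_total_fract :: "'a total_fract \<Rightarrow> 'a total_fract \<Rightarrow> 'a total_fract"
  is "\<lambda>x y. (fst x * fst y, snd x * snd y)"
proof -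
  fix x x' y y' :: "'a \<times> 'a"
  assume *: "total_fract_rel x x'" "total_fract_rel y y'"
  hence eqs: "fst x * snd x' = fst x' * snd x" "fst y * snd y' = fst y' * snd y"
    unfolding total_fract_rel_def by blast+
  have "fst x * fst y * (snd x' * snd y') = (fst x * snd x') * (fst y * snd y')"
    by (simp add: mult_ac)
  also have "\<dots> = fst x' * fst y' * (snd x * snd y)"
    unfolding eqs by (simp add: mult_ac)
  finally show "total_fract_rel (fst x * fst y, snd x * snd y) (fst x' * fst y', snd x' * snd y')"
    using * by (simp add: total_fract_rel_def)
qed

instance
proof
  fix a b c :: "'a total_fract"
  show "a + b + c = a + (b + c)"
    by transfer (simp add: total_fract_rel_def algebra_simps)
  show "a + b = b + a"
    by transfer (simp add: total_fract_rel_def algebra_simps)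
  show "0 + a = a"
    by transfer (simp add: total_fract_rel_def)
  show "- a + a = 0"
    by transfer (simp add: total_fract_rel_def)
  show "a - b = a + - b"
    by transfer (simp add: total_fract_rel_def)
  show "a * b * c = a * (b * c)"
    by transfer (simp add: total_fract_rel_def mult_ac)
  show "a * b = b * a"
    by transfer (simp add: total_fract_rel_def mult_ac)
  show "1 * a = a"
    by transfer (simp add: total_fract_rel_def)
  show "(a + b) * c = a * c + b * c"
    by transfer (simp add: total_fract_rel_def algebra_simps)
  show "(0::'a total_fract) \<noteq> 1"
    by transfer (simp add: total_fract_rel_def)
qed

end

lift_definition to_total_fract :: "'a::comm_ring_1 \<Rightarrow> 'a total_fract" is "\<lambda>a. (a, 1)"
  by (simp add: total_fract_rel_def)


section \<open>Pseudo-measures\<close>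

definition pseudo_measure :: "'p::prime_card iwasawa total_fract \<Rightarrow> bool" where
  "pseudo_measure lam \<longleftrightarrow>
     (\<forall>g\<in>padic_units. (to_total_fract (dirac g) - 1) * lam \<in> range to_total_fract)"

text \<open>
  Only characters with values in \<open>Q_p\<close> are needed below. The value is unspecified if \<open>\<kappa>\<close> is
  trivial on the units.
\<close>

definition pseudo_integral ::
  "'p::prime_card iwasawa total_fract \<Rightarrow> ('p padic \<Rightarrow> 'p padic) \<Rightarrow> 'p padic" where
  "pseudo_integral lam \<kappa> = (THE v. \<forall>g\<in>padic_units. \<kappa> g \<noteq> 1 \<longrightarrow>
     v = inverse (\<kappa> g - 1) *
         iwasawa_integral (THE \<mu>. to_total_fract \<mu> = (to_total_fract (dirac g) - 1) * lam) \<kappa>)"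


section \<open>The Riemann zeta function and the \<open>p\<close>-adic zeta function\<close>

text \<open>The analytic continuation of the Dirichlet series; the value at \<open>1\<close> is unspecified.\<close>

definition riemann_zeta :: "complex \<Rightarrow> complex" where
  "riemann_zeta = (SOME f. f holomorphic_on - {1} \<and>
     (\<forall>s. Re s > 1 \<longrightarrow> (\<lambda>n. of_nat (Suc n) powr (- s)) sums f s))"

text \<open>The rational number \<open>\<zeta>(1 - k)\<close> for \<open>k > 0\<close>.\<close>

definition zeta_one_minus :: "nat \<Rightarrow> rat" where
  "zeta_one_minus k = (THE q. of_rat q = riemann_zeta (1 - of_nat k))"

definition padic_zeta :: "'p::prime_card iwasawa total_fract" where
  "padic_zeta = (THE lam. pseudo_measure lam \<and>
     (\<forall>k>0. pseudo_integral lam (\<lambda>x. x ^ k) =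
             (1 - of_nat CARD('p) ^ (k - 1)) * of_rat (zeta_one_minus k)))"

definition padic_zeta_branch :: "nat \<Rightarrow> 'p::prime_card padic \<Rightarrow> 'p padic" where
  "padic_zeta_branch i s =
     pseudo_integral padic_zeta (\<lambda>x. teichmuller x ^ i * padic_power (principal_unit x) (1 - s))"


section \<open>Analyticity and simple poles for functions of a \<open>p\<close>-adic integer variable\<close>

definition padic_analytic_at :: "('p::prime_card padic \<Rightarrow> 'p padic) \<Rightarrow> 'p padic \<Rightarrow> bool" where
  "padic_analytic_at f s0 \<longleftrightarrow>
     (\<exists>c. \<exists>r>0. \<forall>s\<in>padic_ints. dist s s0 < r \<longrightarrow> (\<lambda>n. c n * (s - s0) ^ n) sums f s)"

text \<open>A simple pole with residue \<open>R\<close>.\<close>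

definition padic_simple_pole_at ::
  "('p::prime_card padic \<Rightarrow> 'p padic) \<Rightarrow> 'p padic \<Rightarrow> 'p padic \<Rightarrow> bool" where
  "padic_simple_pole_at f s0 R \<longleftrightarrow> R \<noteq> 0 \<and>
     (\<exists>h. padic_analytic_at h s0 \<and> h s0 = R \<and>
          (\<forall>\<^sub>F s in at s0 within padic_ints. f s = h s / (s - s0)))"

end

theory Submission
  imports Defs
begin


text \<open>
  A pseudo-measure is determined by its moments, so \<open>([g] - 1) \<zeta>\<^sub>p\<close> must be the measure \<open>\<mu>\<^sub>g\<close> with
  moments \<open>(g\<^sup>k - 1) (1 - p\<^sup>k\<^sup>-\<^sup>1) \<zeta>(1 - k)\<close>. This measure exists: it is \<open>x\<^sup>-\<^sup>1\<close> times the regularised first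
  Bernoulli distribution. Its Riemann sums of \<open>x \<phi>'(x)\<close> are, up to terms tending to \<open>0\<close>, of the form
  \<open>p\<^sup>-\<^sup>N \<Sum>\<^sub>a (\<phi>(a) - \<phi>(g a'))\<close> with \<open>a \<mapsto> a'\<close> a permutation of the units modulo \<open>p\<^sup>N\<close>. For
  \<open>\<phi>(x) = x\<^sup>k / k\<close> this gives \<open>(1 - g\<^sup>k) / k\<close> times the limit \<open>(1 - p\<^sup>k\<^sup>-\<^sup>1) B\<^sub>k\<close> of
  \<open>p\<^sup>-\<^sup>N \<Sum>\<^sub>a a\<^sup>k\<close>, and \<open>\<zeta>(1 - k) = - B\<^sub>k / k\<close> by Euler-Maclaurin summation. For \<open>\<phi> = log\<close> it gives
  the total mass \<open>- (1 - p\<^sup>-\<^sup>1) log g\<close> of \<open>\<mu>\<^sub>g\<close>.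

  Now \<open>\<zeta>\<^sub>p\<^sub>,\<^sub>i(s)\<close> is \<open>\<integral> \<omega>\<^sup>i \<langle>x\<rangle>\<^sup>1\<^sup>-\<^sup>s d\<mu>\<^sub>g\<close>, a power series in \<open>s - 1\<close>, divided by
  \<open>\<omega>(g)\<^sup>i \<langle>g\<rangle>\<^sup>1\<^sup>-\<^sup>s - 1\<close>. If \<open>i < p - 1\<close>, choose for \<open>g\<close> a primitive root of unity: the divisor is a
  non-zero constant. If \<open>i = p - 1\<close>, choose \<open>g = 1 + p\<close>: the divisor is \<open>(1 - s) log g\<close> times a power
  series with constant term \<open>1\<close>, and the residue is the total mass divided by \<open>- log g\<close>.
\<close>

subsection \<open>Bernoulli numbers\<close>

text \<open>Since \<open>padic_zeta\<close> and \<open>pseudo_integral\<close> are definite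
  descriptions, no branch can be evaluated before the pseudo-measure is known to exist uniquely and
  the choice of the auxiliary unit to be immaterial. Existence and uniqueness rest on recovering a
  measure from its moments of positive order, which also makes \<open>[1 + p] - 1\<close> a regular
  element. Evaluating \<open>x^-1\<close> at chosen residues spoils exact compatibility. Measures
  are therefore built from families that are compatible only modulo \<open>p^n\<close>, and
  integrands are taken to be Lipschitz, so that every error is an explicit multiple of
  \<open>p^-n\<close>. The passage from \<open>\<phi>'\<close> to \<open>\<phi>\<close> works
  because \<open>a\<close> and \<open>y = g a'\<close> agree modulo \<open>p^N\<close>: the
  difference between \<open>\<phi>(a) - \<phi>(y)\<close> and \<open>\<phi>'(a) (a - y)\<close> is
  quadratic in \<open>a - y\<close>, hence still small after division by \<open>p^N\<close>. The
  logarithm supplies the zeroth moment, where \<open>x^k / k\<close> breaks down; its additivity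
  replaces the homogeneity of \<open>x^k\<close>. Oddness of \<open>p\<close> is used for the
  exponential on \<open>p Z_p\<close>, for the integrality of its coefficients, and to divide by
  \<open>2\<close>.\<close>

fun bernoulli :: "nat \<Rightarrow> rat" where
  "bernoulli n = (if n = 0 then 1
     else - (\<Sum>j<n. of_nat (Suc n choose j) * bernoulli j) / of_nat (Suc n))"

declare bernoulli.simps [simp del]

text \<open>This is the defining recursion multiplied by \<open>n + 1\<close>, with the term
  \<open>j = n\<close> brought to the left; \<open>B_0 = 1\<close> accounts for the exception. The
  convention is \<open>B_1 = -1/2\<close>.\<close>

lemma sum_choose_bernoulli: "(\<Sum>j<l. of_nat (l choose j) * bernoulli j) = (if l = 1 then 1 else 0)"
proof (cases l)
  case (Suc n)
  have "of_nat (Suc n choose n) * bernoulli n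
      = (if n = 0 then 1 else - (\<Sum>j<n. of_nat (Suc n choose j) * bernoulli j))"
    by (subst bernoulli.simps) (simp del: of_nat_Suc)
  thus ?thesis by (auto simp: Suc)
qed simp

lemma sum_choose_of_rat_bernoulli:
  "(\<Sum>j<l. of_nat (l choose j) * of_rat (bernoulli j)) = (if l = 1 then 1 else (0::'a::field_char_0))"
proof -
  have "(\<Sum>j<l. of_nat (l choose j) * of_rat (bernoulli j))
      = (of_rat (\<Sum>j<l. of_nat (l choose j) * bernoulli j) :: 'a)"
    by (simp add: of_rat_sum of_rat_mult)
  thus ?thesis by (simp add: sum_choose_bernoulli)
qed

text \<open>Trinomial revision turns the two binomials into
  \<open>(a choose l) (l choose j)\<close>, after which the Bernoulli recursion applies. Keeping
  \<open>a\<close> arbitrary lets one identity serve both the Bernoulli polynomials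
  (\<open>a = k\<close>) and Euler-Maclaurin summation (\<open>a = 1 - s\<close>).\<close>

lemma sum_bernoulli_gbinomial:
  fixes a :: "'a::field_char_0"
  shows "(\<Sum>j<l. of_rat (bernoulli j) * (a gchoose j) * ((a - of_nat j) gchoose (l - j)))
       = (if l = 1 then a else 0)"
proof -
  have "(\<Sum>j<l. of_rat (bernoulli j) * (a gchoose j) * ((a - of_nat j) gchoose (l - j)))
      = (\<Sum>j<l. (a gchoose l) * (of_nat (l choose j) * of_rat (bernoulli j)))"
  proof (rule sum.cong[OF refl])
    fix j assume "j \<in> {..<l}"
    hence "(a gchoose l) * of_nat (l choose j) = (a gchoose j) * (a - of_nat j gchoose (l - j))"
      by (subst binomial_gbinomial) (simp add: gbinomial_trinomial_revision)
    thus "of_rat (bernoulli j) * (a gchoose j) * ((a - of_nat j) gchoose (l - j))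
        = (a gchoose l) * (of_nat (l choose j) * of_rat (bernoulli j))"
      by (simp add: mult_ac)
  qed
  also have "\<dots> = (a gchoose l) * (if l = 1 then 1 else 0)"
    by (simp only: sum_choose_of_rat_bernoulli flip: sum_distrib_left)
  finally show ?thesis by simp
qed

text \<open>Regroups a double expansion by the total order \<open>l = i + j\<close>, so that the
  coefficient of each power of \<open>x\<close> becomes a sum over \<open>j < l\<close>.\<close>

lemma sum_triangle_shift:
  fixes f :: "nat \<Rightarrow> nat \<Rightarrow> 'a::comm_monoid_add"
  shows "(\<Sum>j\<le>m. \<Sum>i\<in>{1..m - j}. f j (i + j)) = (\<Sum>l\<le>m. \<Sum>j<l. f j l)"
proof -
  have "(\<Sum>i\<in>{1..m - j}. f j (i + j)) = (\<Sum>l = Suc j..m. f j l)" for j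
  proof (cases "j \<le> m")
    case True
    have "(\<Sum>l = 1 + j..(m - j) + j. f j l) = (\<Sum>i\<in>{1..m - j}. f j (i + j))"
      by (rule sum.shift_bounds_cl_nat_ivl)
    thus ?thesis using True by simp
  qed simp
  hence "(\<Sum>j\<le>m. \<Sum>i\<in>{1..m - j}. f j (i + j)) = (\<Sum>j<Suc m. \<Sum>l = Suc j..m. f j l)"
    by (simp add: lessThan_Suc_atMost)
  also have "\<dots> = (\<Sum>j<m. \<Sum>l = Suc j..m. f j l)" by simp
  also have "\<dots> = (\<Sum>l\<le>m. \<Sum>j<l. f j l)" by (rule sum.nested_swap'[symmetric])
  finally show ?thesis .
qed

definition bernoulli_poly :: "nat \<Rightarrow> 'a::field_char_0 \<Rightarrow> 'a" where
  "bernoulli_poly k x = (\<Sum>j\<le>k. of_rat (bernoulli j) * of_nat (k choose j) * x ^ (k - j))"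

text \<open>After expansion by the binomial theorem, the coefficient of \<open>x^(k - l)\<close> is
  the sum in \<open>sum_bernoulli_gbinomial\<close>, which can be non-zero only at
  \<open>l = 1\<close>.\<close>

lemma bernoulli_poly_diff:
  fixes x :: "'a::field_char_0"
  shows "bernoulli_poly k (x + 1) - bernoulli_poly k x = of_nat k * x ^ (k - 1)"
proof -
  let ?c = "\<lambda>j. of_rat (bernoulli j) * (of_nat k gchoose j) :: 'a"
  let ?g = "\<lambda>j l. ?c j * ((of_nat k - of_nat j) gchoose (l - j)) * x ^ (k - l)"
  have "?c j * (x + 1) ^ (k - j) - ?c j * x ^ (k - j) = (\<Sum>i\<in>{1..k - j}. ?g j (i + j))"
    if "j \<le> k" for j
  proof -
    have "(x + 1) ^ (k - j) = (\<Sum>i\<in>{0..k - j}. of_nat (k - j choose i) * x ^ (k - j - i))"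
      by (subst add.commute, subst binomial_ring) (simp add: atMost_atLeast0)
    also have "\<dots> = x ^ (k - j) + (\<Sum>i\<in>{1..k - j}. of_nat (k - j choose i) * x ^ (k - j - i))"
      by (subst sum.atLeast_Suc_atMost) simp_all
    finally have "?c j * (x + 1) ^ (k - j) - ?c j * x ^ (k - j)
        = (\<Sum>i\<in>{1..k - j}. ?c j * of_nat (k - j choose i) * x ^ (k - j - i))"
      by (simp add: algebra_simps sum_distrib_left)
    also have "\<dots> = (\<Sum>i\<in>{1..k - j}. ?g j (i + j))"
      using that by (intro sum.cong refl) (simp add: binomial_gbinomial add.commute of_nat_diff)
    finally show ?thesis .
  qed
  hence "bernoulli_poly k (x + 1) - bernoulli_poly k x = (\<Sum>j\<le>k. \<Sum>i\<in>{1..k - j}. ?g j (i + j))"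
    unfolding bernoulli_poly_def sum_subtractf[symmetric]
    by (intro sum.cong refl) (simp add: binomial_gbinomial)
  also have "\<dots> = (\<Sum>l\<le>k. \<Sum>j<l. ?g j l)" by (rule sum_triangle_shift)
  also have "\<dots> = (\<Sum>l\<le>k. (if l = 1 then of_nat k * x ^ (k - 1) else 0))"
    by (intro sum.cong refl) (auto simp: sum_bernoulli_gbinomial simp flip: sum_distrib_right)
  also have "\<dots> = of_nat k * x ^ (k - 1)" by (cases k) auto
  finally show ?thesis .
qed

lemma bernoulli_poly_1: "k \<noteq> 1 \<Longrightarrow> bernoulli_poly k (1 :: 'a::field_char_0) = of_rat (bernoulli k)"
  using sum_choose_of_rat_bernoulli[of k, where 'a = 'a]
  by (simp add: bernoulli_poly_def mult.commute flip: lessThan_Suc_atMost)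

lemma sum_powers_bernoulli:
  "of_nat (Suc k) * (\<Sum>b<M. of_nat b ^ k) = bernoulli_poly (Suc k) (of_nat M) - bernoulli_poly (Suc k) (0 :: 'a::field_char_0)"
proof (induction M)
  case (Suc M)
  have "of_nat (Suc k) * (\<Sum>b<Suc M. of_nat b ^ k) = of_nat (Suc k) * (\<Sum>b<M. of_nat b ^ k) + of_nat (Suc k) * (of_nat M ^ k :: 'a)"
    by (simp add: distrib_left)
  also have "of_nat (Suc k) * (of_nat M ^ k :: 'a) = bernoulli_poly (Suc k) (of_nat M + 1) - bernoulli_poly (Suc k) (of_nat M)"
    by (subst bernoulli_poly_diff) simp
  finally show ?case using Suc by (simp add: add.commute)
qed simp


subsection \<open>The Riemann zeta function at negative integers\<close>

text \<open>
  For \<open>a = 1 - s\<close>, the function \<open>em_poly m a\<close> is \<open>1 - s\<close> times the Euler-Maclaurin approximation of a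
  solution \<open>F\<close> of \<open>F(x + 1) - F(x) = x\<^sup>-\<^sup>s\<close>; for \<open>a = k \<in> \<nat>\<close> and \<open>m \<ge> k\<close> it is the Bernoulli polynomial,
  and the error \<open>em_term m a\<close> vanishes.
\<close>

definition em_poly :: "nat \<Rightarrow> complex \<Rightarrow> complex \<Rightarrow> complex" where
  "em_poly m a x = (\<Sum>j\<le>m. of_rat (bernoulli j) * (a gchoose j) * x powr (a - of_nat j))"

definition em_bound :: "nat \<Rightarrow> complex \<Rightarrow> real" where
  "em_bound m a = (\<Sum>j\<le>m. cmod (of_rat (bernoulli j) * (a gchoose j)) *
     (real (Suc (m - j)) * cmod (a - of_nat j gchoose Suc (m - j))))"

definition em_term :: "nat \<Rightarrow> complex \<Rightarrow> complex \<Rightarrow> complex" where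
  "em_term m a x = a * x powr (a - 1) - (em_poly m a (x + 1) - em_poly m a x)"

text \<open>The derivatives of \<open>z^w\<close> are the \<open>f i\<close>, and
  \<open>Re w \<le> q + 1\<close> makes the one of order \<open>q + 1\<close> largest at the left
  end of the ray \<open>S\<close>. The factor \<open>q + 1\<close> is what remains of
  \<open>(q + 1)!\<close> after the division by \<open>q!\<close> in the remainder estimate.\<close>

lemma powr_Taylor_bound:
  fixes w :: complex and x :: real
  assumes x: "x > 0" and w: "Re w \<le> real (Suc q)"
  shows "cmod ((complex_of_real x + 1) powr w - (\<Sum>i\<le>q. (w gchoose i) * x powr (w - of_nat i)))
       \<le> real (Suc q) * cmod (w gchoose Suc q) * x powr (Re w - real (Suc q))"
proof -
  define f where "f = (\<lambda>i z. fact i * (w gchoose i) * z powr (w - of_nat i))"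
  define S where "S = complex_of_real ` {x..}"
  let ?B = "fact (Suc q) * cmod (w gchoose Suc q) * x powr (Re w - real (Suc q))"
  have conv: "convex S" unfolding S_def
    by (intro convex_linear_image linearI) (auto simp: scaleR_conv_of_real)
  have der: "(f i has_field_derivative f (Suc i) z) (at z within S)" if "z \<in> S" for i z
  proof -
    have z: "z \<notin> \<real>\<^sub>\<le>\<^sub>0" using that x by (auto simp: S_def complex_nonpos_Reals_iff)
    have "(f i has_field_derivative fact i * (w gchoose i) * ((w - of_nat i) * z powr (w - of_nat i - 1))) (at z within S)"
      unfolding f_def
      by (intro DERIV_cmult has_field_derivative_at_within[OF has_field_derivative_powr] z)
    moreover have "fact i * (w gchoose i) * ((w - of_nat i) * z powr (w - of_nat i - 1)) = f (Suc i) z"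
    proof -
      have "of_nat (Suc i) * (w gchoose Suc i) = (w - of_nat i) * (w gchoose i)"
        by (subst gbinomial_absorption, subst gbinomial_absorb_comp) simp
      moreover have "f (Suc i) z = fact i * (of_nat (Suc i) * (w gchoose Suc i)) * z powr (w - of_nat (Suc i))"
        by (simp add: f_def mult_ac del: of_nat_Suc)
      ultimately have "f (Suc i) z = fact i * ((w - of_nat i) * (w gchoose i)) * z powr (w - of_nat (Suc i))"
        by simp
      thus ?thesis by (simp add: algebra_simps)
    qed
    ultimately show ?thesis by simp
  qed
  have B: "cmod (f (Suc q) z) \<le> ?B" if "z \<in> S" for z
  proof -
    from that obtain t where t: "t \<ge> x" "z = complex_of_real t" by (auto simp: S_def)
    have "cmod (z powr (w - of_nat (Suc q))) = t powr (Re w - real (Suc q))"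
      using t x norm_powr_real_powr[of z "w - of_nat (Suc q)"] by (simp del: of_nat_Suc)
    also have "\<dots> \<le> x powr (Re w - real (Suc q))"
      using t x w by (intro powr_mono2') auto
    finally have "cmod (z powr (w - of_nat (Suc q))) \<le> x powr (Re w - real (Suc q))" .
    hence "fact (Suc q) * cmod (w gchoose Suc q) * cmod (z powr (w - of_nat (Suc q))) \<le> ?B"
      by (rule mult_left_mono) simp
    thus ?thesis unfolding f_def norm_mult norm_fact .
  qed
  have e: "complex_of_real (x + 1) - complex_of_real x = 1" by simp
  have S: "complex_of_real x \<in> S" "complex_of_real (x + 1) \<in> S"
    unfolding S_def by (rule imageI, simp)+
  have "cmod (f 0 (of_real (x + 1)) - (\<Sum>i\<le>q. f i (of_real x) * (of_real (x + 1) - of_real x) ^ i / fact i))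
      \<le> ?B * cmod (of_real (x + 1) - of_real x) ^ (Suc q) / fact q"
    by (rule complex_Taylor[OF conv der B S])
  also have "?B * cmod (complex_of_real (x + 1) - of_real x) ^ (Suc q) / fact q
      = real (Suc q) * cmod (w gchoose Suc q) * x powr (Re w - real (Suc q))"
    unfolding e fact_Suc by simp
  also have "(\<Sum>i\<le>q. f i (of_real x) * (of_real (x + 1) - of_real x) ^ i / fact i)
      = (\<Sum>i\<le>q. (w gchoose i) * of_real x powr (w - of_nat i))"
    unfolding e by (intro sum.cong refl) (simp add: f_def)
  also have "f 0 (complex_of_real (x + 1)) = (complex_of_real x + 1) powr w"
    by (simp add: f_def)
  finally show ?thesis .
qed

text \<open>Each \<open>(x + 1)^(a - j)\<close> is replaced by its Taylor polynomial of degree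
  \<open>m - j\<close>. The orders \<open>l \<le> m\<close> then cancel exactly, except for
  \<open>a x^(a - 1)\<close> at \<open>l = 1\<close>, and every remainder has the same order
  \<open>x^(Re a - m - 1)\<close>.\<close>

lemma em_term_bound:
  fixes x :: real
  assumes x: "x > 0" and a: "Re a \<le> real (Suc m)" and m: "m \<ge> 1"
  shows "cmod (em_term m a x) \<le> em_bound m a * x powr (Re a - real (Suc m))"
proof -
  let ?c = "\<lambda>j. of_rat (bernoulli j) * (a gchoose j)"
  let ?g = "\<lambda>j l. ?c j * ((a - of_nat j) gchoose (l - j)) * of_real x powr (a - of_nat l)"
  let ?T = "\<lambda>j. (\<Sum>i\<le>m - j. (a - of_nat j gchoose i) * of_real x powr (a - of_nat j - of_nat i))"
  have T: "?c j * ?T j = ?c j * of_real x powr (a - of_nat j) + (\<Sum>i\<in>{1..m - j}. ?g j (i + j))"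
    if "j \<le> m" for j
  proof -
    have "?T j = of_real x powr (a - of_nat j)
      + (\<Sum>i\<in>{1..m - j}. (a - of_nat j gchoose i) * of_real x powr (a - of_nat j - of_nat i))"
      unfolding atMost_atLeast0 by (subst sum.atLeast_Suc_atMost) simp_all
    thus ?thesis by (simp add: algebra_simps sum_distrib_left)
  qed
  have "(\<Sum>j\<le>m. ?c j * ?T j) = em_poly m a x + (\<Sum>j\<le>m. \<Sum>i\<in>{1..m - j}. ?g j (i + j))"
    by (simp add: T em_poly_def flip: sum.distrib)
  also have "(\<Sum>j\<le>m. \<Sum>i\<in>{1..m - j}. ?g j (i + j)) = (\<Sum>l\<le>m. \<Sum>j<l. ?g j l)"
    by (rule sum_triangle_shift)
  also have "\<dots> = (\<Sum>l\<le>m. (if l = 1 then a * of_real x powr (a - 1) else 0))"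
    by (intro sum.cong refl) (auto simp: sum_bernoulli_gbinomial simp flip: sum_distrib_right)
  also have "\<dots> = a * of_real x powr (a - 1)" using m by simp
  finally have main: "(\<Sum>j\<le>m. ?c j * ?T j) = em_poly m a x + a * of_real x powr (a - 1)" .
  have "em_term m a x = (\<Sum>j\<le>m. ?c j * ?T j) - em_poly m a (of_real x + 1)"
    unfolding main em_term_def by simp
  also have "\<dots> = (\<Sum>j\<le>m. - (?c j * ((of_real x + 1) powr (a - of_nat j) - ?T j)))"
    by (simp add: em_poly_def algebra_simps flip: sum_subtractf)
  finally have "cmod (em_term m a x) = cmod \<dots>" by (rule arg_cong)
  also have "\<dots> \<le> (\<Sum>j\<le>m. cmod (?c j) * (real (Suc (m - j)) *
      cmod (a - of_nat j gchoose Suc (m - j)) * x powr (Re a - real (Suc m))))"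
  proof (rule sum_norm_le)
    fix j assume j: "j \<in> {..m}"
    have e: "Re (a - of_nat j) - real (Suc (m - j)) = Re a - real (Suc m)"
      using j by (simp add: of_nat_diff)
    have "cmod ((of_real x + 1) powr (a - of_nat j) - ?T j) \<le> real (Suc (m - j)) *
      cmod (a - of_nat j gchoose Suc (m - j)) * x powr (Re (a - of_nat j) - real (Suc (m - j)))"
      by (rule powr_Taylor_bound[OF x]) (use e a in linarith)
    thus "cmod (- (?c j * ((of_real x + 1) powr (a - of_nat j) - ?T j))) \<le> cmod (?c j) * (real (Suc (m - j)) *
      cmod (a - of_nat j gchoose Suc (m - j)) * x powr (Re a - real (Suc m)))"
      unfolding e norm_minus_cancel norm_mult by (intro mult_left_mono) auto
  qed
  also have "\<dots> = em_bound m a * x powr (Re a - real (Suc m))"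
    by (simp only: em_bound_def sum_distrib_right mult.assoc)
  finally show ?thesis .
qed

lemma continuous_gbinomial [continuous_intros]:
  fixes f :: "'a::t2_space \<Rightarrow> complex"
  shows "continuous_on A f \<Longrightarrow> continuous_on A (\<lambda>x. f x gchoose n)"
  unfolding gbinomial_prod_rev by (intro continuous_intros) simp_all

lemma holomorphic_gbinomial [holomorphic_intros]:
  "f holomorphic_on A \<Longrightarrow> (\<lambda>x. f x gchoose n) holomorphic_on A"
  unfolding gbinomial_prod_rev by (intro holomorphic_intros) simp_all

lemma em_term_holomorphic: "x \<noteq> 0 \<Longrightarrow> x \<noteq> -1 \<Longrightarrow> (\<lambda>s. em_term m (1 - s) x) holomorphic_on A"
  unfolding em_term_def em_poly_def by (intro holomorphic_intros)

text \<open>With \<open>a = 1 - s\<close> the bound on \<open>em_term\<close> is of order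
  \<open>n^(- Re s - m)\<close>, so the series converges locally uniformly to the right of
  \<open>1 - m\<close>.\<close>

lemma zeta_series_holomorphic:
  assumes m: "m \<ge> 1"
  obtains g where "g holomorphic_on {s. Re s > 1 - real m}"
    "\<And>s. Re s > 1 - real m \<Longrightarrow> (\<lambda>n. em_term m (1 - s) (of_nat (Suc n))) sums g s"
proof -
  let ?S = "{s. Re s > 1 - real m}"
  have S: "open ?S" by (rule open_halfspace_Re_gt)
  obtain g where g: "\<forall>s\<in>?S. (\<lambda>n. em_term m (1 - s) (of_nat (Suc n))) sums g s \<and> g field_differentiable (at s)"
  proof (rule series_differentiable_comparison_complex[OF S, of "\<lambda>n s. em_term m (1 - s) (of_nat (Suc n))"])
    fix n s assume "s \<in> ?S"
    have "of_nat (Suc n) \<noteq> (0::complex)" "of_nat (Suc n) \<noteq> (-1::complex)"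
      by (simp_all add: complex_eq_iff del: of_nat_Suc)
    hence "(\<lambda>s. em_term m (1 - s) (of_nat (Suc n))) holomorphic_on UNIV"
      by (rule em_term_holomorphic)
    thus "(\<lambda>s. em_term m (1 - s) (of_nat (Suc n))) field_differentiable (at s)"
      by (auto simp: holomorphic_on_def)
  next
    fix s assume s: "s \<in> ?S"
    \<comment> \<open>Half the distance from \<open>s\<close> to the boundary line: on the whole
      ball the exponent stays below \<open>-1 - d\<close>.\<close>
    define d where "d = (Re s - (1 - real m)) / 2"
    have d: "d > 0" using s by (simp add: d_def)
    have "continuous_on (cball s d) (\<lambda>s. em_bound m (1 - s))"
      unfolding em_bound_def by (intro continuous_intros)
    hence "compact ((\<lambda>s. em_bound m (1 - s)) ` cball s d)"
      by (rule compact_continuous_image) simp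
    hence "bounded ((\<lambda>s. em_bound m (1 - s)) ` cball s d)" by (rule compact_imp_bounded)
    then obtain K where K: "K > 0" "\<And>y. y \<in> cball s d \<Longrightarrow> \<bar>em_bound m (1 - y)\<bar> \<le> K"
      unfolding bounded_pos by auto
    define h where "h = (\<lambda>n. complex_of_real (K * real (Suc n) powr (- 1 - d)))"
    have "summable (\<lambda>n. real (Suc n) powr (- 1 - d))"
      using d by (subst summable_Suc_iff) (simp add: summable_real_powr_iff)
    hence sh: "summable h" unfolding h_def by (intro summable_of_real summable_mult)
    have "cmod (em_term m (1 - y) (of_nat (Suc n))) \<le> cmod (h n)" if y: "y \<in> ball s d" for y n
    proof -
      have "\<bar>Re y - Re s\<bar> \<le> cmod (y - s)" using abs_Re_le_cmod[of "y - s"] by simp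
      also have "\<dots> < d" using y by (simp add: dist_norm norm_minus_commute)
      finally have Re_y: "Re y > 1 - real m + d" using s by (simp add: d_def abs_if field_simps split: if_splits)
      have "cmod (em_term m (1 - y) (of_real (real (Suc n))))
          \<le> em_bound m (1 - y) * real (Suc n) powr (Re (1 - y) - real (Suc m))"
        by (rule em_term_bound) (use Re_y d m in auto)
      also have "\<dots> \<le> K * real (Suc n) powr (- 1 - d)"
        using K y Re_y by (intro mult_mono powr_mono) (auto intro: order_trans[OF abs_ge_self])
      also have "\<dots> = cmod (h n)" using K
        by (simp add: h_def norm_mult del: of_nat_Suc)
      finally show ?thesis by simp
    qed
    thus "\<exists>d h. 0 < d \<and> summable h \<and> range h \<subseteq> \<real>\<^sub>\<ge>\<^sub>0 \<and>
        (\<forall>\<^sub>F n in sequentially. \<forall>y\<in>ball s d \<inter> ?S. cmod (em_term m (1 - y) (of_nat (Suc n))) \<le> cmod (h n))"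
      using d sh K by (intro exI[of _ d] exI[of _ h]) (auto simp: h_def)
  qed
  thus ?thesis by (intro that[of g]) (auto simp: holomorphic_on_def field_differentiable_at_within)
qed


lemma LIMSEQ_Suc_powr_0:
  assumes "Re w < 0"
  shows "(\<lambda>n. of_nat (Suc n) powr w :: complex) \<longlonglongrightarrow> 0"
proof (rule tendsto_norm_zero_cancel)
  have "filterlim (\<lambda>n. real (Suc n)) at_top sequentially"
    using filterlim_compose[OF filterlim_real_sequentially filterlim_Suc] by simp
  hence "(\<lambda>n. real (Suc n) powr Re w) \<longlonglongrightarrow> 0" by (rule tendsto_neg_powr[OF assms])
  moreover have "cmod (of_nat (Suc n) powr w) = real (Suc n) powr Re w" for n
    using norm_powr_real_powr[of "of_nat (Suc n)" w] by (simp del: of_nat_Suc)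
  ultimately show "(\<lambda>n. cmod (of_nat (Suc n) powr w)) \<longlonglongrightarrow> 0" by simp
qed

text \<open>For \<open>Re s > 1\<close> the differences of \<open>em_poly\<close> telescope from
  \<open>em_poly m (1 - s) 1\<close> to \<open>0\<close>; subtracting that value leaves
  \<open>1 - s\<close> times the Dirichlet series.\<close>

definition zeta_num_approx :: "nat \<Rightarrow> complex \<Rightarrow> complex" where
  "zeta_num_approx m s = (\<Sum>n. em_term m (1 - s) (of_nat (Suc n))) - em_poly m (1 - s) 1"

text \<open>The entire function \<open>(1 - s) \<zeta>(s)\<close>.\<close>

definition zeta_num :: "complex \<Rightarrow> complex" where
  "zeta_num s = zeta_num_approx (Suc (nat \<lceil>1 - Re s\<rceil>)) s"

text \<open>The new summand \<open>Q\<close> of \<open>em_poly\<close> tends to \<open>0\<close>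
  along the integers, so its differences sum to \<open>- Q 1\<close>, which cancels the change of
  the boundary value at \<open>1\<close>.\<close>

lemma zeta_num_approx_Suc:
  assumes m: "m \<ge> 1" and s: "Re s > 1 - real m"
  shows "zeta_num_approx (Suc m) s = zeta_num_approx m s"
proof -
  let ?a = "1 - s"
  define c where "c = of_rat (bernoulli (Suc m)) * (?a gchoose Suc m)"
  define Q where "Q = (\<lambda>x. c * x powr (?a - of_nat (Suc m)))"
  have poly: "em_poly (Suc m) ?a x = em_poly m ?a x + Q x" for x
    by (simp add: em_poly_def Q_def c_def)
  have lim: "(\<lambda>n. Q (of_nat (Suc n))) \<longlonglongrightarrow> c * 0"
    unfolding Q_def by (intro tendsto_mult tendsto_const LIMSEQ_Suc_powr_0) (use s in auto)
  have tele: "(\<lambda>n. Q (of_nat (Suc n) + 1) - Q (of_nat (Suc n))) sums (0 - Q 1)"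
    using telescope_sums[OF lim] by (simp add: add.commute)
  obtain g where g: "\<And>s. Re s > 1 - real m \<Longrightarrow> (\<lambda>n. em_term m (1 - s) (of_nat (Suc n))) sums g s"
    using zeta_series_holomorphic[OF m] by metis
  have "(\<lambda>n. em_term m ?a (of_nat (Suc n)) - (Q (of_nat (Suc n) + 1) - Q (of_nat (Suc n)))) sums (g s - (0 - Q 1))"
    by (intro sums_diff g s tele)
  also have "(\<lambda>n. em_term m ?a (of_nat (Suc n)) - (Q (of_nat (Suc n) + 1) - Q (of_nat (Suc n))))
      = (\<lambda>n. em_term (Suc m) ?a (of_nat (Suc n)))"
    unfolding em_term_def poly by (simp add: algebra_simps)
  finally show ?thesis
    using sums_unique[OF g[OF s]] by (simp add: zeta_num_approx_def poly sums_iff)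
qed

lemma zeta_num_approx_eq:
  assumes "m \<ge> 1" "Re s > 1 - real m" "n \<ge> m"
  shows "zeta_num_approx n s = zeta_num_approx m s"
  using assms(3)
proof (induction n rule: dec_induct)
  case (step n)
  have "zeta_num_approx (Suc n) s = zeta_num_approx n s"
    by (rule zeta_num_approx_Suc) (use step assms in auto)
  thus ?case using step by simp
qed simp

lemma zeta_num_eq:
  assumes m: "m \<ge> 1" "Re s > 1 - real m"
  shows "zeta_num s = zeta_num_approx m s"
proof -
  let ?k = "Suc (nat \<lceil>1 - Re s\<rceil>)"
  have k: "?k \<ge> 1" "Re s > 1 - real ?k" by (simp, linarith)
  show ?thesis
  proof (cases "m \<le> ?k")
    case True
    thus ?thesis using zeta_num_approx_eq[OF m True] by (simp add: zeta_num_def)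
  next
    case False
    thus ?thesis using zeta_num_approx_eq[OF k, of m] by (simp add: zeta_num_def)
  qed
qed

text \<open>On each half-plane \<open>Re s > 1 - m\<close> the function is the single approximation
  of order \<open>m\<close>, and these half-planes cover the plane.\<close>

lemma zeta_num_holomorphic: "zeta_num holomorphic_on UNIV"
proof -
  have hol: "zeta_num holomorphic_on {s. Re s > 1 - real m}" if m: "m \<in> {1..}" for m
  proof -
    obtain g where g: "g holomorphic_on {s. Re s > 1 - real m}"
      "\<And>s. Re s > 1 - real m \<Longrightarrow> (\<lambda>n. em_term m (1 - s) (of_nat (Suc n))) sums g s"
      using zeta_series_holomorphic[of m] m by auto
    have "(\<lambda>s. g s - em_poly m (1 - s) 1) holomorphic_on {s. Re s > 1 - real m}"
      unfolding em_poly_def by (intro holomorphic_intros g(1))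
    moreover have "g s - em_poly m (1 - s) 1 = zeta_num s" if "s \<in> {s. Re s > 1 - real m}" for s
      using zeta_num_eq[of m s] g(2)[of s] m that by (auto simp: zeta_num_approx_def sums_iff)
    ultimately show ?thesis by (rule holomorphic_transform)
  qed
  have "zeta_num holomorphic_on (\<Union>m\<in>{1..}. {s. Re s > 1 - real m})"
    by (rule holomorphic_on_UN_open[OF hol]) (auto intro: open_halfspace_Re_gt)
  also have "(\<Union>m\<in>{1..}. {s. Re s > 1 - real m}) = UNIV"
  proof -
    have "\<exists>m\<ge>1. Re s > 1 - real m" for s
      by (rule exI[of _ "Suc (nat \<lceil>1 - Re s\<rceil>)"]) (simp, linarith)
    thus ?thesis by auto
  qed
  finally show ?thesis .
qed

lemma zeta_num_sums:
  assumes s: "Re s > 1"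
  shows "(\<lambda>n. (1 - s) * of_nat (Suc n) powr (- s)) sums zeta_num s"
proof -
  let ?P = "em_poly 1 (1 - s)"
  have "(\<lambda>n. ?P (of_nat (Suc n))) \<longlonglongrightarrow> (\<Sum>j\<le>1. of_rat (bernoulli j) * (1 - s gchoose j) * 0)"
    unfolding em_poly_def by (intro tendsto_sum tendsto_mult tendsto_const LIMSEQ_Suc_powr_0) (use s in auto)
  hence lim: "(\<lambda>n. ?P (of_nat (Suc n))) \<longlonglongrightarrow> 0" by simp
  have tele: "(\<lambda>n. ?P (of_nat (Suc n) + 1) - ?P (of_nat (Suc n))) sums (0 - ?P 1)"
    using telescope_sums[OF lim] by (simp add: add.commute)
  obtain g where g: "\<And>s. Re s > 1 - real 1 \<Longrightarrow> (\<lambda>n. em_term 1 (1 - s) (of_nat (Suc n))) sums g s"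
    using zeta_series_holomorphic[of 1] by auto
  have "(\<lambda>n. em_term 1 (1 - s) (of_nat (Suc n)) + (?P (of_nat (Suc n) + 1) - ?P (of_nat (Suc n))))
      sums (g s + (0 - ?P 1))"
    by (intro sums_add g tele) (use s in auto)
  also have "(\<lambda>n. em_term 1 (1 - s) (of_nat (Suc n)) + (?P (of_nat (Suc n) + 1) - ?P (of_nat (Suc n))))
     = (\<lambda>n. (1 - s) * of_nat (Suc n) powr (- s))"
    by (simp add: em_term_def algebra_simps)
  also have "g s + (0 - ?P 1) = zeta_num s"
    using zeta_num_eq[of 1 s] g[of s] s by (simp add: zeta_num_approx_def sums_iff)
  finally show ?thesis .
qed

text \<open>\<open>riemann_zeta\<close> is an arbitrary choice; the function
  \<open>zeta_num s / (1 - s)\<close> shows that there is something to choose.\<close>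

lemma riemann_zeta_properties:
  "riemann_zeta holomorphic_on - {1}"
  "Re s > 1 \<Longrightarrow> (\<lambda>n. of_nat (Suc n) powr (- s)) sums riemann_zeta s"
proof -
  let ?Q = "\<lambda>f. f holomorphic_on - {1} \<and> (\<forall>s. Re s > 1 \<longrightarrow> (\<lambda>n. of_nat (Suc n) powr (- s)) sums f s)"
  have "?Q (\<lambda>s. zeta_num s / (1 - s))"
  proof (intro conjI allI impI)
    show "(\<lambda>s. zeta_num s / (1 - s)) holomorphic_on - {1}"
      by (intro holomorphic_intros holomorphic_on_subset[OF zeta_num_holomorphic]) auto
    fix s :: complex assume s: "Re s > 1"
    have "(\<lambda>n. (1 - s) * of_nat (Suc n) powr (- s) / (1 - s)) sums (zeta_num s / (1 - s))"
      by (intro sums_divide zeta_num_sums s)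
    moreover have "1 - s \<noteq> 0" using s by auto
    ultimately show "(\<lambda>n. of_nat (Suc n) powr (- s)) sums (zeta_num s / (1 - s))" by simp
  qed
  hence "?Q riemann_zeta" unfolding riemann_zeta_def by (rule someI[of ?Q])
  thus "riemann_zeta holomorphic_on - {1}"
    "Re s > 1 \<Longrightarrow> (\<lambda>n. of_nat (Suc n) powr (- s)) sums riemann_zeta s" by blast+
qed

text \<open>The identity theorem on the connected punctured plane pins down the chosen
  function.\<close>

lemma riemann_zeta_eq:
  assumes "s \<noteq> 1"
  shows "riemann_zeta s = zeta_num s / (1 - s)"
proof (rule analytic_continuation_open[of "{s. Re s > 1}" "- {1}" riemann_zeta "\<lambda>s. zeta_num s / (1 - s)"])
  show "open {s. Re s > 1}" by (rule open_halfspace_Re_gt)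
  show "open (- {1::complex})" by auto
  show "{s. Re s > 1} \<noteq> {}" by (auto intro!: exI[of _ 2])
  show "connected (- {1::complex})" by (rule connected_punctured_universe) simp
  show "{s. Re s > 1} \<subseteq> - {1}" by auto
  show "riemann_zeta holomorphic_on - {1}" by (rule riemann_zeta_properties)
  show "(\<lambda>s. zeta_num s / (1 - s)) holomorphic_on - {1}"
    by (intro holomorphic_intros holomorphic_on_subset[OF zeta_num_holomorphic]) auto
  show "s \<in> - {1}" using assms by simp
next
  fix z :: complex assume "z \<in> {s. Re s > 1}"
  hence z: "Re z > 1" "1 - z \<noteq> 0" by auto
  have "(\<lambda>n. (1 - z) * of_nat (Suc n) powr (- z)) sums ((1 - z) * riemann_zeta z)"
    by (intro sums_mult riemann_zeta_properties z)
  with zeta_num_sums[OF z(1)] have "zeta_num z = (1 - z) * riemann_zeta z"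
    by (simp add: sums_iff)
  thus "riemann_zeta z = zeta_num z / (1 - z)" using z by simp
qed

text \<open>The order is \<open>k + 1\<close> rather than \<open>k\<close> because
  \<open>s = 1 - k\<close> must lie strictly inside the half-plane \<open>Re s > 1 - m\<close>; the
  extra term carries the vanishing coefficient \<open>k choose (k + 1)\<close>.\<close>

lemma em_poly_of_nat:
  assumes "x \<noteq> 0"
  shows "em_poly (Suc k) (of_nat k) x = bernoulli_poly k x"
proof -
  have "x powr (of_nat k - of_nat j) = x ^ (k - j)" if "j \<le> k" for j
    using that assms powr_complexpow[of x "k - j"] by (simp add: of_nat_diff)
  hence "em_poly (Suc k) (of_nat k) x = (\<Sum>j\<le>k. of_rat (bernoulli j) * (of_nat k gchoose j) * x ^ (k - j))
      + of_rat (bernoulli (Suc k)) * (of_nat k gchoose Suc k) * x powr (of_nat k - of_nat (Suc k))"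
    unfolding em_poly_def by simp
  also have "(of_nat k gchoose Suc k :: complex) = 0"
    by (simp flip: binomial_gbinomial)
  finally show ?thesis by (simp add: bernoulli_poly_def binomial_gbinomial)
qed

text \<open>All error terms vanish, since the Bernoulli polynomial solves the difference equation
  exactly. What remains is \<open>- B_k(1)\<close>, which equals \<open>- B_k\<close> for
  \<open>k \<ge> 2\<close>; at \<open>k = 1\<close> it is \<open>- 1/2\<close>, whereas
  \<open>- B_1 = 1/2\<close>.\<close>

lemma riemann_zeta_one_minus:
  assumes k: "k \<ge> 2"
  shows "riemann_zeta (1 - of_nat k) = of_rat (- bernoulli k / of_nat k)"
proof -
  have term0: "em_term (Suc k) (of_nat k) (of_nat (Suc n)) = 0" for n
  proof -
    have nz: "of_nat (Suc n) \<noteq> (0::complex)" "of_nat (Suc n) + 1 \<noteq> (0::complex)"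
      by (simp_all add: complex_eq_iff)
    have "of_nat (Suc n) powr (of_nat k - 1) = (of_nat (Suc n) ^ (k - 1) :: complex)"
      using k nz powr_complexpow[of "of_nat (Suc n)" "k - 1"] by (simp add: of_nat_diff del: of_nat_Suc One_nat_def)
    thus ?thesis unfolding em_term_def em_poly_of_nat[OF nz(1)] em_poly_of_nat[OF nz(2)]
      by (simp add: bernoulli_poly_diff del: of_nat_Suc)
  qed
  have "zeta_num (1 - of_nat k) = zeta_num_approx (Suc k) (1 - of_nat k)"
    by (rule zeta_num_eq) auto
  also have "\<dots> = - of_rat (bernoulli k)"
    using term0 em_poly_of_nat[of 1 k] k by (simp add: zeta_num_approx_def bernoulli_poly_1 del: of_nat_Suc)
  finally show ?thesis
    using k by (subst riemann_zeta_eq) (auto simp: of_rat_divide of_rat_minus)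
qed

lemma zeta_one_minus_eq:
  assumes "k \<ge> 2"
  shows "zeta_one_minus k = - bernoulli k / of_nat k"
  unfolding zeta_one_minus_def riemann_zeta_one_minus[OF assms] by (rule the_equality) simp_all


subsection \<open>Norm and topology of the \<open>p\<close>-adic numbers\<close>

lemma card_gt_1 [simp]: "Suc 0 < CARD('p::prime_card)"
  using prime_gt_1_nat[OF prime_card] by simp

lemma card_neq_1 [simp]: "CARD('p::prime_card) \<noteq> Suc 0"
  using card_gt_1[where 'p = 'p] by linarith

lemma real_card_gt_1 [simp]: "1 < real CARD('p::prime_card)"
  using card_gt_1[where 'p = 'p] by simp

lemma card_ge_3: "odd CARD('p::prime_card) \<Longrightarrow> 3 \<le> CARD('p)"
proof -
  assume "odd CARD('p)"
  moreover have "odd c \<Longrightarrow> Suc 0 < c \<Longrightarrow> 3 \<le> c" for c :: nat by presburger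
  ultimately show ?thesis by simp
qed

lemma inverse_card_pow_le_1: "1 / real CARD('p::prime_card) ^ n \<le> 1"
  by simp

lemma padic_norm_le_0_iff: "padic_norm x \<le> 0 \<longleftrightarrow> x = (0 :: 'p::prime_card padic)"
  using padic_norm_nonneg[of x] by (auto simp: order.antisym simp flip: padic_norm_eq_0_iff simp del: padic_norm_nonneg)

lemma padic_norm_triangle: "padic_norm (x + y :: 'p::prime_card padic) \<le> padic_norm x + padic_norm y"
  by (rule order_trans[OF padic_norm_add]) simp

lemma padic_norm_power: "padic_norm (x ^ n :: 'p::prime_card padic) = padic_norm x ^ n"
  by (induction n) (simp_all add: padic_norm_mult)

lemma padic_norm_inverse: "padic_norm (inverse x :: 'p::prime_card padic) = inverse (padic_norm x)"
proof (cases "x = 0")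
  case False
  hence "padic_norm x * padic_norm (inverse x) = 1"
    using padic_norm_mult[of x "inverse x"] by simp
  thus ?thesis by (simp add: inverse_unique)
qed simp

lemma padic_norm_divide: "padic_norm (x / y :: 'p::prime_card padic) = padic_norm x / padic_norm y"
  by (simp add: divide_inverse padic_norm_mult padic_norm_inverse)

lemma padic_norm_of_int_le_1: "padic_norm (of_int k :: 'p::prime_card padic) \<le> 1"
  using padic_norm_of_int_le_iff[of k 0, where 'p = 'p] by simp

lemma padic_norm_of_nat_le_1: "padic_norm (of_nat k :: 'p::prime_card padic) \<le> 1"
  using padic_norm_of_int_le_1[of "int k"] by simp

lemma padic_norm_of_nat_le_iff:
  "padic_norm (of_nat a :: 'p::prime_card padic) \<le> 1 / real CARD('p) ^ n \<longleftrightarrow> CARD('p) ^ n dvd a"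
  using padic_norm_of_nat_diff_le_iff[of a 0 n, where 'p = 'p] by (simp add: cong_0_iff)

lemma padic_norm_card: "padic_norm (of_nat CARD('p) :: 'p::prime_card padic) = 1 / real CARD('p)"
proof -
  have "padic_abs CARD('p) (of_int (int CARD('p)) / of_int 1) = real CARD('p) powi (- 1)"
    by (subst padic_abs_frac) (simp_all add: prime_card)
  thus ?thesis
    using padic_norm_of_rat[of "of_nat CARD('p)", where 'p = 'p] by (simp add: power_int_minus inverse_eq_divide)
qed

text \<open>The power of \<open>p\<close> that exactly divides \<open>n\<close> is at most
  \<open>n\<close>. This bounds the denominators of the logarithm series.\<close>

lemma padic_norm_of_nat_ge:
  assumes "n > 0"
  shows "padic_norm (of_nat n :: 'p::prime_card padic) \<ge> 1 / real n"
proof -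
  let ?m = "multiplicity (int CARD('p)) (int n)"
  have "padic_norm (of_nat n :: 'p padic) = 1 / real CARD('p) ^ ?m"
    using padic_abs_frac[of "CARD('p)" "int n" 1] assms
      padic_norm_of_rat[of "of_nat n", where 'p = 'p]
    by (simp add: prime_card power_int_minus inverse_eq_divide)
  moreover have "int (CARD('p) ^ ?m) dvd int n"
    using multiplicity_dvd[of "int CARD('p)" "int n"] by simp
  hence "CARD('p) ^ ?m \<le> n"
    using assms by (intro dvd_imp_le) (simp_all only: of_nat_dvd_iff)
  hence "real CARD('p) ^ ?m \<le> real n" by (metis of_nat_le_iff of_nat_power)
  moreover from this have "1 / real n \<le> 1 / real CARD('p) ^ ?m"
    by (intro divide_left_mono) (use assms in auto)
  ultimately show ?thesis by simp
qed

text \<open>Discreteness of the valuation: \<open>x\<close> agrees modulo \<open>p\<close> with a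
  natural number, which has norm below \<open>1\<close> only if \<open>p\<close> divides it.\<close>

lemma padic_norm_less_1:
  assumes "padic_norm (x :: 'p::prime_card padic) < 1"
  shows "padic_norm x \<le> 1 / real CARD('p)"
proof -
  obtain a where a: "padic_norm (x - of_nat a) \<le> 1 / real CARD('p)"
    using padic_nat_dense[of x 1] assms by auto
  have "padic_norm (x - (x - of_nat a)) \<le> max (padic_norm x) (padic_norm (x - of_nat a))"
    by (rule padic_norm_diff_le) auto
  also have "\<dots> < 1"
    using le_less_trans[OF a, of 1] assms by simp
  finally have "padic_norm (of_nat a :: 'p padic) < 1" by simp
  have "CARD('p) dvd a"
  proof (rule ccontr)
    assume "\<not> CARD('p) dvd a"
    hence "multiplicity (int CARD('p)) (int a) = 0"
      by (intro not_dvd_imp_multiplicity_0) simp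
    moreover have "a \<noteq> 0" using \<open>\<not> CARD('p) dvd a\<close> by (metis dvd_0_right)
    ultimately have "padic_norm (of_nat a :: 'p padic) = 1"
      using padic_abs_frac[of "CARD('p)" "int a" 1] padic_norm_of_rat[of "of_nat a", where 'p = 'p]
      by (simp add: prime_card)
    with \<open>padic_norm (of_nat a :: 'p padic) < 1\<close> show False by simp
  qed
  hence "padic_norm (of_nat a :: 'p padic) \<le> 1 / real CARD('p)"
    using padic_norm_of_nat_le_iff[of a 1, where 'p = 'p] by simp
  from padic_norm_add_le[OF a this] show ?thesis by simp
qed

lemma padic_norm_of_nat_eq_1_iff:
  "padic_norm (of_nat a :: 'p::prime_card padic) = 1 \<longleftrightarrow> coprime a CARD('p)"
proof -
  have "1 / real CARD('p) < 1" by simp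
  hence "padic_norm (of_nat a :: 'p padic) \<noteq> 1 \<longleftrightarrow> padic_norm (of_nat a :: 'p padic) \<le> 1 / real CARD('p)"
    using padic_norm_less_1[of "of_nat a :: 'p padic"] padic_norm_of_nat_le_1[of a, where 'p = 'p]
    by linarith
  also have "\<dots> \<longleftrightarrow> CARD('p) dvd a"
    using padic_norm_of_nat_le_iff[of a 1, where 'p = 'p] by simp
  also have "\<dots> \<longleftrightarrow> \<not> coprime a CARD('p)"
  proof -
    have "p dvd a \<longleftrightarrow> \<not> coprime a p" if "prime p" for p :: nat
      using that by (metis coprime_absorb_right coprime_commute not_prime_unit prime_imp_coprime)
    thus ?thesis using prime_card by blast
  qed
  finally show ?thesis by blast
qed

lemma padic_norm_add_eq:
  assumes "padic_norm x < padic_norm (y :: 'p::prime_card padic)"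
  shows "padic_norm (x + y) = padic_norm y"
proof (rule antisym)
  show "padic_norm (x + y) \<le> padic_norm y" using padic_norm_add[of x y] assms by simp
  have "padic_norm y \<le> max (padic_norm (x + y)) (padic_norm (- x))"
    using padic_norm_add[of "x + y" "- x"] by simp
  thus "padic_norm y \<le> padic_norm (x + y)" using assms by (simp split: if_splits add: max_def)
qed

lemma padic_norm_close_eq:
  assumes "padic_norm (x - y) < padic_norm (y :: 'p::prime_card padic)"
  shows "padic_norm x = padic_norm y"
  using padic_norm_add_eq[OF assms] by simp

lemma padic_tendsto_iff:
  "(f \<longlongrightarrow> (l :: 'p::prime_card padic)) F \<longleftrightarrow> ((\<lambda>x. padic_norm (f x - l)) \<longlongrightarrow> 0) F"
  by (subst tendsto_dist_iff) (simp add: dist_padic_def)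

lemma padic_tendsto_0_iff:
  "(f \<longlongrightarrow> (0 :: 'p::prime_card padic)) F \<longleftrightarrow> ((\<lambda>x. padic_norm (f x)) \<longlongrightarrow> 0) F"
  by (simp add: padic_tendsto_iff)

text \<open>The \<open>p\<close>-adic field is not a real normed space; these instances carry the
  general limit rules for sums and products over to it.\<close>

instance padic :: (prime_card) topological_ab_group_add
proof
  fix a b :: "'a padic"
  let ?F = "nhds a \<times>\<^sub>F nhds b"
  have 1: "(fst \<longlongrightarrow> a) ?F" "(snd \<longlongrightarrow> b) ?F"
    by (rule filterlim_fst, rule filterlim_snd)
  have "((\<lambda>x. padic_norm (fst x - a) + padic_norm (snd x - b)) \<longlongrightarrow> 0 + 0) ?F"
    using 1 by (intro tendsto_add) (simp_all flip: padic_tendsto_iff)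
  hence lim: "((\<lambda>x. padic_norm (fst x - a) + padic_norm (snd x - b)) \<longlongrightarrow> 0) ?F" by simp
  show "LIM x ?F. fst x + snd x :> nhds (a + b)"
    unfolding padic_tendsto_iff
    by (rule tendsto_0_le[OF lim, where K = 1])
       (auto intro!: always_eventually padic_norm_triangle[THEN order_trans[rotated]] simp: add_diff_add)
  show "(uminus \<longlongrightarrow> - a) (nhds a)"
    unfolding padic_tendsto_iff using filterlim_ident[of "nhds a"]
    by (simp add: padic_tendsto_iff padic_norm_minus_commute)
qed

instance padic :: (prime_card) topological_semigroup_mult
proof
  fix a b :: "'a padic"
  let ?F = "nhds a \<times>\<^sub>F nhds b"
  have 1: "(fst \<longlongrightarrow> a) ?F" "(snd \<longlongrightarrow> b) ?F"
    by (rule filterlim_fst, rule filterlim_snd)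
  let ?u = "\<lambda>x. padic_norm (fst x - a)" and ?v = "\<lambda>x. padic_norm (snd x - b)"
  have "((\<lambda>x. ?u x * (padic_norm b + ?v x) + padic_norm a * ?v x) \<longlongrightarrow> 0 * (padic_norm b + 0) + padic_norm a * 0) ?F"
    using 1 by (intro tendsto_intros) (simp_all flip: padic_tendsto_iff)
  hence lim: "((\<lambda>x. ?u x * (padic_norm b + ?v x) + padic_norm a * ?v x) \<longlongrightarrow> 0) ?F" by simp
  have le: "padic_norm (fst x * snd x - a * b) \<le> ?u x * (padic_norm b + ?v x) + padic_norm a * ?v x" for x
  proof -
    have "padic_norm (fst x * snd x - a * b) = padic_norm ((fst x - a) * (b + (snd x - b)) + a * (snd x - b))"
      by (simp add: algebra_simps)
    also have "\<dots> \<le> ?u x * padic_norm (b + (snd x - b)) + padic_norm a * ?v x"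
      by (rule order_trans[OF padic_norm_triangle]) (simp only: padic_norm_mult order_refl)
    also have "\<dots> \<le> ?u x * (padic_norm b + ?v x) + padic_norm a * ?v x"
      by (intro add_mono mult_left_mono padic_norm_triangle) auto
    finally show ?thesis .
  qed
  show "LIM x ?F. fst x * snd x :> nhds (a * b)"
    unfolding padic_tendsto_iff
    by (rule tendsto_0_le[OF lim, where K = 1]) (auto intro!: always_eventually le[THEN order_trans])
qed

instance padic :: (prime_card) topological_monoid_mult ..

text \<open>The norm of a class is the limit of the norms along a representative, so a bound valid
  from index \<open>k\<close> on passes to the limit.\<close>

lemma padic_abs_seq_approx:
  fixes q :: "nat \<Rightarrow> rat"
  assumes q: "padic_cauchy CARD('p::prime_card) q"
    and k: "\<And>m. m \<ge> k \<Longrightarrow> padic_abs CARD('p) (q m - q k) \<le> e"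
  shows "padic_norm (abs_padic (Abs_padic_seq q) - of_rat (q k) :: 'p padic) \<le> e"
proof -
  have rep: "Rep_padic_seq (Abs_padic_seq q :: 'p padic_seq) = q"
    using q by (simp add: Abs_padic_seq_inverse)
  have "padic_seq_norm (Abs_padic_seq q - padic_seq_const (q k) :: 'p padic_seq) \<le> e"
    by (rule LIMSEQ_le_const2[OF padic_seq_norm_LIMSEQ])
       (use k in \<open>auto simp: minus_padic_seq.rep_eq padic_seq_const.rep_eq rep intro!: exI[of _ k]\<close>)
  thus ?thesis
    by (simp add: padic_norm.abs_eq minus_padic.abs_eq padic_of_rat.abs_eq flip: padic_of_rat_eq_of_rat)
qed

instance padic :: (prime_card) complete_space
proof
  fix X :: "nat \<Rightarrow> 'a padic" assume X: "Cauchy X"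
  have "\<exists>q. padic_norm (X n - of_rat q) \<le> 1 / real (Suc n)" for n
    using padic_rat_dense[of "1 / real (Suc n)" "X n"] by auto
  \<comment> \<open>With a rational \<open>q n\<close> within \<open>1 / (n + 1)\<close> of
    \<open>X n\<close>, the sequence \<open>q\<close> is Cauchy for the absolute value on the
    rationals, and its class is the limit of \<open>X\<close>.\<close>
  then obtain q where q: "\<And>n. padic_norm (X n - of_rat (q n)) \<le> 1 / real (Suc n)" by metis
  have appr: "\<exists>k. \<forall>m\<ge>k. \<forall>n\<ge>k. padic_abs CARD('a) (q m - q n) \<le> e \<and> padic_norm (X n - of_rat (q n)) \<le> e" if e: "e > 0" for e
  proof -
    obtain k where k: "\<And>m n. m \<ge> k \<Longrightarrow> n \<ge> k \<Longrightarrow> dist (X m) (X n) < e"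
      using metric_CauchyD[OF X e] by blast
    obtain l where l: "1 / real (Suc l) < e" using nat_approx_posE[OF e] .
    have qe: "padic_norm (X n - of_rat (q n)) \<le> e" if "n \<ge> l" for n
    proof -
      have "1 / real (Suc n) \<le> 1 / real (Suc l)" using that by (intro divide_left_mono) auto
      thus ?thesis using q[of n] l by linarith
    qed
    have "padic_abs CARD('a) (q m - q n) \<le> e" if "m \<ge> max k l" "n \<ge> max k l" for m n
    proof -
      have "padic_norm ((X m - X n) - (X m - of_rat (q m)) + (X n - of_rat (q n))) \<le> e"
        using k[of m n] qe[of m] qe[of n] that
        by (intro padic_norm_add_le padic_norm_diff_le[of "X m - X n"]) (auto simp: dist_padic_def)
      also have "(X m - X n) - (X m - of_rat (q m)) + (X n - of_rat (q n)) = of_rat (q m - q n)"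
        by (simp add: of_rat_diff)
      finally show ?thesis by (simp add: padic_norm_of_rat)
    qed
    with qe show ?thesis by (intro exI[of _ "max k l"]) auto
  qed
  have cau: "padic_cauchy CARD('a) q"
    unfolding padic_cauchy_def
  proof (intro allI impI)
    fix e :: real assume "e > 0"
    hence "e / 2 > 0" "e / 2 < e" by simp_all
    thus "\<exists>k. \<forall>m\<ge>k. \<forall>n\<ge>k. padic_abs CARD('a) (q m - q n) < e"
      using appr[of "e / 2"] by (meson le_less_trans)
  qed
  define L where "L = (abs_padic (Abs_padic_seq q) :: 'a padic)"
  have "X \<longlonglongrightarrow> L"
  proof (rule metric_LIMSEQ_I)
    fix r :: real assume r: "r > 0"
    have "r / 2 > 0" using r by simp
    from appr[OF this] obtain k where
      k: "\<forall>m\<ge>k. \<forall>n\<ge>k. padic_abs CARD('a) (q m - q n) \<le> r / 2 \<and> padic_norm (X n - of_rat (q n)) \<le> r / 2" ..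
    have "padic_norm (X n - L) \<le> r / 2" if "n \<ge> k" for n
    proof -
      have "padic_norm (L - of_rat (q n)) \<le> r / 2"
        unfolding L_def by (rule padic_abs_seq_approx[OF cau]) (use k that in auto)
      moreover have "padic_norm (X n - of_rat (q n)) \<le> r / 2" using k that by blast
      ultimately show ?thesis using padic_norm_diff_le[of "X n - of_rat (q n)" "r / 2" "L - of_rat (q n)"] by simp
    qed
    note le = this
    have "dist (X n) L < r" if "n \<ge> k" for n
      using le[OF that] r by (simp add: dist_padic_def)
    thus "\<exists>no. \<forall>n\<ge>no. dist (X n) L < r" by blast
  qed
  thus "convergent X" by (rule convergentI)
qed

section \<open>Limits and series under the ultrametric inequality\<close>

lemma padic_norm_tendsto:
  assumes "(f \<longlongrightarrow> (l :: 'p::prime_card padic)) F"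
  shows "((\<lambda>x. padic_norm (f x)) \<longlongrightarrow> padic_norm l) F"
proof -
  have "((\<lambda>x. dist (f x) 0) \<longlongrightarrow> dist l 0) F" by (intro tendsto_dist assms tendsto_const)
  thus ?thesis by (simp add: dist_padic_def)
qed

lemma padic_norm_limit_le:
  fixes l :: "'p::prime_card padic"
  assumes "X \<longlonglongrightarrow> l" "\<And>n. n \<ge> N \<Longrightarrow> padic_norm (X n) \<le> r"
  shows "padic_norm l \<le> r"
  using assms(2) by (intro LIMSEQ_le_const2[OF padic_norm_tendsto[OF assms(1)]]) auto

text \<open>By the ultrametric inequality a block of the series is no larger than its largest term,
  so a null sequence of terms already makes the partial sums Cauchy.\<close>

lemma padic_summable:
  fixes f :: "nat \<Rightarrow> 'p::prime_card padic"
  assumes "f \<longlonglongrightarrow> 0"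
  shows "summable f"
proof -
  have "Cauchy (\<lambda>n. sum f {..<n})"
  proof (rule metric_CauchyI)
    fix e :: real assume e: "e > 0"
    then obtain N where N: "\<And>n. n \<ge> N \<Longrightarrow> padic_norm (f n) < e / 2"
      using metric_LIMSEQ_D[OF assms, of "e / 2"] by (auto simp: dist_padic_def)
    have *: "padic_norm (sum f {..<n} - sum f {..<m}) < e" if "m \<ge> N" "n \<ge> m" for m n
    proof -
      have "sum f {..<n} - sum f {..<m} = sum f {m..<n}"
        using that sum_diff_nat_ivl[of 0 m n f] by (simp add: lessThan_atLeast0)
      moreover have "padic_norm (sum f {m..<n}) \<le> e / 2"
        using N that e by (intro padic_norm_sum_le less_imp_le) auto
      ultimately show ?thesis using e by simp
    qed
    show "\<exists>M. \<forall>m\<ge>M. \<forall>n\<ge>M. dist (sum f {..<m}) (sum f {..<n}) < e"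
    proof (intro exI[of _ N] allI impI)
      fix m n assume "m \<ge> N" "n \<ge> N"
      thus "dist (sum f {..<m}) (sum f {..<n}) < e"
        using *[of m n] *[of n m] by (cases "m \<le> n") (auto simp: dist_padic_def padic_norm_minus_commute)
    qed
  qed
  thus ?thesis by (simp add: Cauchy_convergent_iff summable_iff_convergent)
qed

lemma padic_suminf_norm_le:
  fixes f :: "nat \<Rightarrow> 'p::prime_card padic"
  assumes "f sums l" "\<And>n. padic_norm (f n) \<le> r"
  shows "padic_norm l \<le> r"
proof (rule padic_norm_limit_le)
  show "(\<lambda>n. sum f {..<n}) \<longlonglongrightarrow> l" using assms(1) by (simp add: sums_def)
  have "r \<ge> 0" using assms(2)[of 0] padic_norm_nonneg[of "f 0"] by linarith
  thus "padic_norm (sum f {..<n}) \<le> r" for n by (intro padic_norm_sum_le assms)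
qed

lemma padic_suminf_tail_le:
  fixes f :: "nat \<Rightarrow> 'p::prime_card padic"
  assumes "f sums l" "\<And>n. n \<ge> N \<Longrightarrow> padic_norm (f n) \<le> r" and r: "r \<ge> 0"
  shows "padic_norm (l - sum f {..<N}) \<le> r"
proof (rule padic_norm_limit_le[of _ _ N])
  show "(\<lambda>n. sum f {..<n} - sum f {..<N}) \<longlonglongrightarrow> l - sum f {..<N}"
    using assms(1) unfolding sums_def diff_conv_add_uminus by (intro tendsto_add tendsto_const)
  fix n assume "n \<ge> N"
  hence "sum f {..<n} - sum f {..<N} = sum f {N..<n}"
    using sum_diff_nat_ivl[of 0 N n f] by (simp add: lessThan_atLeast0)
  thus "padic_norm (sum f {..<n} - sum f {..<N}) \<le> r"
    using assms(2) r by (auto intro!: padic_norm_sum_le)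
qed

lemma padic_tendsto_le:
  fixes X :: "nat \<Rightarrow> 'p::prime_card padic"
  assumes "\<And>n. n \<ge> N \<Longrightarrow> padic_norm (X n - l) \<le> e n" "e \<longlonglongrightarrow> 0"
  shows "X \<longlonglongrightarrow> l"
  unfolding padic_tendsto_iff
  by (rule tendsto_0_le[OF assms(2), where K = 1])
     (auto simp: eventually_sequentially intro!: exI[of _ N] order_trans[OF assms(1)])

lemma inverse_card_pow_tendsto_0: "(\<lambda>n. C / real CARD('p::prime_card) ^ n) \<longlonglongrightarrow> 0"
  by (rule LIMSEQ_divide_realpow_zero) simp

lemma card_pow_tendsto_0: "(\<lambda>n. of_nat (CARD('p) ^ n) :: 'p::prime_card padic) \<longlonglongrightarrow> 0"
  by (rule padic_tendsto_le[OF _ inverse_card_pow_tendsto_0[of 1, where 'p = 'p]])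
     (simp add: padic_norm_power padic_norm_card power_one_over)

lemma sums_mult_padic:
  fixes f :: "nat \<Rightarrow> 'p::prime_card padic"
  assumes "f sums l"
  shows "(\<lambda>n. c * f n) sums (c * l)"
  using assms unfolding sums_def by (simp add: tendsto_mult_left flip: sum_distrib_left)


subsection \<open>Exponential and logarithm\<close>

lemma inverse_card_le_1: "1 / real CARD('p::prime_card) \<le> 1" "1 / real CARD('p) < 1"
  by simp_all

text \<open>Only the multiples of \<open>p\<close> contribute to the valuation of \<open>n!\<close>;
  they are \<open>p\<close> times \<open>1, ..., n div p\<close>. Iteration gives Legendre's
  formula.\<close>

lemma padic_norm_fact:
  "padic_norm (fact n :: 'p::prime_card padic)
     = padic_norm (fact (n div CARD('p)) :: 'p padic) / real CARD('p) ^ (n div CARD('p))"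
proof (induction n)
  case (Suc n)
  let ?p = "CARD('p)" and ?q = "n div CARD('p)"
  have f: "padic_norm (fact (Suc n) :: 'p padic) = padic_norm (of_nat (Suc n) :: 'p padic) * padic_norm (fact n :: 'p padic)"
    by (simp only: fact_Suc padic_norm_mult of_nat_id)
  show ?case
  proof (cases "Suc n mod ?p = 0")
    case True
    hence d: "Suc n div ?p = Suc ?q" by (simp add: div_Suc)
    have "Suc n = ?p * Suc ?q" using True d by (metis mult_div_mod_eq add_0_right)
    hence "padic_norm (of_nat (Suc n) :: 'p padic) = padic_norm (of_nat (Suc ?q) :: 'p padic) / real ?p"
      by (simp only: of_nat_mult padic_norm_mult padic_norm_card) simp
    thus ?thesis unfolding f d
      by (simp only: Suc fact_Suc of_nat_id padic_norm_mult power_Suc) simp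
  next
    case False
    hence d: "Suc n div ?p = ?q" by (simp add: div_Suc)
    have "\<not> ?p dvd Suc n" using False by (simp add: dvd_eq_mod_eq_0)
    hence "coprime (Suc n) ?p" using prime_imp_coprime[OF prime_card, of "Suc n"] by (simp add: coprime_commute)
    hence "padic_norm (of_nat (Suc n) :: 'p padic) = 1" by (simp only: padic_norm_of_nat_eq_1_iff)
    thus ?thesis unfolding f d by (simp add: Suc)
  qed
qed simp

text \<open>With \<open>q = n div p\<close> and \<open>v\<close> the valuation, induction gives
  \<open>2 v(n!) = 2 q + 2 v(q!) \<le> 3 q \<le> p q \<le> n\<close>, which is where
  \<open>p \<ge> 3\<close> enters. The squared form avoids square roots.\<close>

lemma padic_norm_fact_ge:
  assumes odd: "odd CARD('p::prime_card)"
  shows "1 / real CARD('p) ^ n \<le> padic_norm (fact n :: 'p padic) ^ 2"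
proof (induction n rule: less_induct)
  case (less n)
  let ?p = "CARD('p)" and ?q = "n div CARD('p)"
  show ?case
  proof (cases "n = 0")
    case False
    hence "?q < n" by (intro div_less_dividend) auto
    have "3 * ?q \<le> ?p * ?q" using card_ge_3[OF odd] by (rule mult_le_mono1)
    also have "\<dots> \<le> n" by simp
    finally have "real ?p ^ (3 * ?q) \<le> real ?p ^ n" by (intro power_increasing) auto
    hence "1 / real ?p ^ n \<le> 1 / real ?p ^ (3 * ?q)" by (intro divide_left_mono) auto
    also have "\<dots> = (1 / real ?p ^ ?q) * (1 / real ?p ^ ?q) ^ 2"
      by (simp add: power_mult power2_eq_square power3_eq_cube mult.commute[of 3])
    also have "\<dots> \<le> padic_norm (fact ?q :: 'p padic) ^ 2 * (1 / real ?p ^ ?q) ^ 2"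
      using less[OF \<open>?q < n\<close>] by (intro mult_right_mono) auto
    also have "\<dots> = padic_norm (fact n :: 'p padic) ^ 2"
      by (subst padic_norm_fact[of n]) (simp add: power_divide)
    finally show ?thesis .
  qed simp
qed

text \<open>The exponents of \<open>x\<close> and of the factorial are independent because both
  \<open>x^n / n!\<close> and \<open>x^n / (n + 1)!\<close> occur.\<close>

lemma padic_norm_divide_fact_le:
  assumes odd: "odd CARD('p::prime_card)" and x: "padic_norm (x :: 'p padic) \<le> 1 / real CARD('p)"
  shows "padic_norm (x ^ m / fact n) ^ 2 \<le> real CARD('p) ^ n / real CARD('p) ^ (2 * m)"
proof -
  let ?p = "real CARD('p)"
  have f: "0 < padic_norm (fact n :: 'p padic)" by (simp add: less_le)
  have "padic_norm (x ^ m / fact n) ^ 2 = (padic_norm x) ^ (2 * m) * (1 / padic_norm (fact n :: 'p padic) ^ 2)"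
    by (simp add: padic_norm_divide padic_norm_power power_divide flip: power_mult) (simp add: mult.commute)
  also have "\<dots> \<le> (1 / ?p) ^ (2 * m) * (1 / (1 / ?p ^ n))"
    using padic_norm_fact_ge[OF odd, of n] x f
    by (intro mult_mono power_mono divide_left_mono) auto
  also have "\<dots> = ?p ^ n / ?p ^ (2 * m)" by (simp add: power_divide)
  finally show ?thesis .
qed

text \<open>
  The terms of the exponential series on \<open>p Z\<^sub>p\<close> decay at this geometric rate, because \<open>2 v(n!) \<le> n\<close> for
  odd \<open>p\<close>.
\<close>

definition exp_rate :: "'p::prime_card itself \<Rightarrow> real" where
  "exp_rate _ = 1 / sqrt (real CARD('p))"

lemma exp_rate: "0 < exp_rate TYPE('p::prime_card)" "exp_rate TYPE('p) < 1"
  by (simp_all add: exp_rate_def)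

lemma padic_exp_term_le:
  assumes odd: "odd CARD('p::prime_card)" and x: "padic_norm (x :: 'p padic) \<le> 1 / real CARD('p)"
  shows "padic_norm (x ^ n / fact n) \<le> exp_rate TYPE('p) ^ n"
proof (rule power2_le_imp_le)
  have "padic_norm (x ^ n / fact n) ^ 2 \<le> real CARD('p) ^ n / real CARD('p) ^ (2 * n)"
    by (rule padic_norm_divide_fact_le[OF assms])
  also have "\<dots> = (exp_rate TYPE('p) ^ n) ^ 2"
    by (simp add: exp_rate_def power_divide mult_2 power_add real_sqrt_pow2 flip: power_mult) (simp add: power_mult mult.commute[of n])
  finally show "padic_norm (x ^ n / fact n) ^ 2 \<le> (exp_rate TYPE('p) ^ n) ^ 2" .
qed (use exp_rate(1)[where 'p = 'p] in simp)

text \<open>For \<open>n \<ge> 1\<close> the squared bound is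
  \<open>p^(n + 1 - 2 n) \<le> 1\<close>. It gives \<open>exp x - 1\<close> the factor
  \<open>x\<close> and makes the coefficients of \<open>(exp (u L) - 1) / (u L)\<close>
  integral.\<close>

lemma padic_exp_shifted_term_le:
  assumes odd: "odd CARD('p::prime_card)" and x: "padic_norm (x :: 'p padic) \<le> 1 / real CARD('p)"
  shows "padic_norm (x ^ n / fact (Suc n)) \<le> 1"
proof (cases n)
  case (Suc k)
  have "padic_norm (x ^ n / fact (Suc n)) ^ 2 \<le> real CARD('p) ^ (Suc n) / real CARD('p) ^ (2 * n)"
    by (rule padic_norm_divide_fact_le[OF assms])
  also have "\<dots> \<le> 1 ^ 2" using Suc by (simp add: power_increasing)
  finally show ?thesis by (rule power2_le_imp_le) simp
qed simp

lemma geometric_le_sums_summable: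
  fixes f :: "nat \<Rightarrow> 'p::prime_card padic"
  assumes "\<And>n. padic_norm (f n) \<le> r ^ n" "0 \<le> r" "r < 1"
  shows "summable f"
  by (rule padic_summable, rule padic_tendsto_le[of 0 _ _ "\<lambda>n. r ^ n"])
     (use assms in \<open>auto intro: LIMSEQ_realpow_zero\<close>)

lemma padic_exp_sums:
  assumes odd: "odd CARD('p::prime_card)" and x: "padic_norm (x :: 'p padic) \<le> 1 / real CARD('p)"
  shows "(\<lambda>n. x ^ n / fact n) sums padic_exp x"
  unfolding padic_exp_def
  by (rule summable_sums, rule geometric_le_sums_summable[OF padic_exp_term_le[OF assms]])
     (use exp_rate[where 'p = 'p] in auto)

text \<open>The triangle and the square of index pairs differ by pairs with
  \<open>i + j \<ge> n\<close>, whose terms, and hence their sum, have norm at most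
  \<open>r^n\<close>.\<close>

lemma padic_Cauchy_product:
  fixes a b :: "nat \<Rightarrow> 'p::prime_card padic"
  assumes a: "a sums A" "\<And>n. padic_norm (a n) \<le> r ^ n" and b: "b sums B" "\<And>n. padic_norm (b n) \<le> r ^ n"
    and r: "0 \<le> r" "r < 1"
  shows "(\<lambda>k. \<Sum>i\<le>k. a i * b (k - i)) sums (A * B)"
proof -
  have "(\<lambda>n. (\<Sum>k<n. \<Sum>i\<le>k. a i * b (k - i)) - sum a {..<n} * sum b {..<n}) \<longlonglongrightarrow> 0"
  proof (rule padic_tendsto_le[of 0 _ _ "\<lambda>n. r ^ n"])
    fix n :: nat
    let ?T = "{(i, j). i + j < n}" and ?S = "{..<n} \<times> {..<n}"
    have fin: "finite ?S" and sub: "?T \<subseteq> ?S" by auto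
    have "(\<Sum>k<n. \<Sum>i\<le>k. a i * b (k - i)) = (\<Sum>(i,j)\<in>?T. a i * b j)"
      by (rule sum.triangle_reindex[symmetric])
    moreover have "sum a {..<n} * sum b {..<n} = (\<Sum>(i,j)\<in>?S. a i * b j)"
      by (simp add: sum_product sum.cartesian_product)
    ultimately have "(\<Sum>k<n. \<Sum>i\<le>k. a i * b (k - i)) - sum a {..<n} * sum b {..<n}
        = - (\<Sum>(i,j)\<in>?S - ?T. a i * b j)"
      using sum.subset_diff[OF sub fin, of "\<lambda>(i,j). a i * b j"] by simp
    also have "padic_norm \<dots> \<le> r ^ n"
    proof -
      have "padic_norm (a i * b j) \<le> r ^ n" if "n \<le> i + j" for i j
      proof -
        have "padic_norm (a i * b j) \<le> r ^ i * r ^ j"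
          unfolding padic_norm_mult using r by (intro mult_mono a b) auto
        also have "\<dots> \<le> r ^ n" using that r by (simp add: power_decreasing flip: power_add)
        finally show ?thesis .
      qed
      thus ?thesis unfolding padic_norm_minus using r by (intro padic_norm_sum_le) auto
    qed
    finally show "padic_norm ((\<Sum>k<n. \<Sum>i\<le>k. a i * b (k - i)) - sum a {..<n} * sum b {..<n} - 0) \<le> r ^ n"
      by simp
  qed (use r in \<open>auto intro: LIMSEQ_realpow_zero\<close>)
  moreover have "(\<lambda>n. sum a {..<n} * sum b {..<n}) \<longlonglongrightarrow> A * B"
    using a(1) b(1) unfolding sums_def by (rule tendsto_mult)
  ultimately show ?thesis unfolding sums_def using tendsto_add by fastforce
qed

lemma padic_exp_add:
  assumes odd: "odd CARD('p::prime_card)"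
    and x: "padic_norm (x :: 'p padic) \<le> 1 / real CARD('p)" and y: "padic_norm y \<le> 1 / real CARD('p)"
  shows "padic_exp (x + y) = padic_exp x * padic_exp y"
proof -
  have "(\<Sum>i\<le>k. x ^ i / fact i * (y ^ (k - i) / fact (k - i))) = (x + y) ^ k / fact k" for k
  proof -
    have "(x + y) ^ k / fact k = (\<Sum>i\<le>k. of_nat (k choose i) * x ^ i * y ^ (k - i) / fact k)"
      by (simp add: binomial_ring sum_divide_distrib)
    also have "\<dots> = (\<Sum>i\<le>k. x ^ i / fact i * (y ^ (k - i) / fact (k - i)))"
      by (intro sum.cong refl) (simp add: binomial_fact)
    finally show ?thesis ..
  qed
  moreover have "(\<lambda>k. \<Sum>i\<le>k. x ^ i / fact i * (y ^ (k - i) / fact (k - i))) sums (padic_exp x * padic_exp y)"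
    by (rule padic_Cauchy_product[where r = "exp_rate TYPE('p)"])
       (use exp_rate[where 'p = 'p] odd x y in \<open>auto intro: padic_exp_sums padic_exp_term_le\<close>)
  moreover have "(\<lambda>n. (x + y) ^ n / fact n) sums padic_exp (x + y)"
    by (intro padic_exp_sums odd padic_norm_add_le x y)
  ultimately show ?thesis by (simp add: sums_unique2)
qed

lemma padic_exp_0 [simp]: "padic_exp (0 :: 'p::prime_card padic) = 1"
proof -
  have "(\<lambda>n. (0 :: 'p padic) ^ n / fact n) sums (\<Sum>n\<in>{0}. 0 ^ n / fact n)"
    by (rule sums_finite) auto
  thus ?thesis by (simp add: padic_exp_def sums_iff)
qed

lemma padic_exp_minus_1_le:
  assumes odd: "odd CARD('p::prime_card)" and x: "padic_norm (x :: 'p padic) \<le> 1 / real CARD('p)"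
  shows "padic_norm (padic_exp x - 1) \<le> padic_norm x"
proof -
  have "padic_norm (padic_exp x - (\<Sum>n<1. x ^ n / fact n)) \<le> padic_norm x"
  proof (rule padic_suminf_tail_le[OF padic_exp_sums[OF assms]])
    fix n :: nat assume "n \<ge> 1"
    then obtain k where n: "n = Suc k" by (cases n) auto
    have "padic_norm (x ^ n / fact n) = padic_norm x * padic_norm (x ^ k / fact (Suc k))"
      unfolding n by (simp add: padic_norm_divide padic_norm_mult)
    also have "\<dots> \<le> padic_norm x * 1"
      by (intro mult_left_mono padic_exp_shifted_term_le assms) auto
    finally show "padic_norm (x ^ n / fact n) \<le> padic_norm x" by simp
  qed auto
  thus ?thesis by simp
qed

lemma padic_norm_exp:
  assumes odd: "odd CARD('p::prime_card)" and x: "padic_norm (x :: 'p padic) \<le> 1 / real CARD('p)"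
  shows "padic_norm (padic_exp x) = 1"
proof -
  have "padic_norm (padic_exp x - 1) < padic_norm (1 :: 'p padic)"
    unfolding padic_norm_1 using padic_exp_minus_1_le[OF assms] x inverse_card_le_1(2)[where 'p = 'p] by linarith
  from padic_norm_close_eq[OF this] show ?thesis by simp
qed

lemma padic_exp_diff_le:
  assumes odd: "odd CARD('p::prime_card)"
    and x: "padic_norm (x :: 'p padic) \<le> 1 / real CARD('p)" and y: "padic_norm y \<le> 1 / real CARD('p)"
  shows "padic_norm (padic_exp x - padic_exp y) \<le> padic_norm (x - y)"
proof -
  have xy: "padic_norm (x - y) \<le> 1 / real CARD('p)" by (rule padic_norm_diff_le[OF x y])
  have "padic_exp x = padic_exp (x - y) * padic_exp y"
    using padic_exp_add[OF odd xy y] by simp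
  hence "padic_exp x - padic_exp y = (padic_exp (x - y) - 1) * padic_exp y"
    by (simp add: algebra_simps)
  thus ?thesis
    using padic_exp_minus_1_le[OF odd xy] by (simp add: padic_norm_mult padic_norm_exp[OF odd y])
qed

lemma Suc_mult_Suc_le_power: "n * Suc n \<le> 3 ^ Suc n"
proof (induction n)
  case (Suc n)
  have "Suc n * Suc (Suc n) \<le> 3 * 3 ^ Suc n"
  proof (cases n)
    case (Suc m)
    hence "Suc n * Suc (Suc n) \<le> 3 * (n * Suc n)" by simp
    with Suc.IH show ?thesis by linarith
  qed simp
  thus ?case by simp
qed simp

text \<open>The extra factor \<open>n\<close> is matched to the error \<open>n |M|\<close> in
  \<open>padic_binomial_minus_sign_le\<close>; it also forces the terms of the series to tend to
  \<open>0\<close>.\<close>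

lemma padic_log_term_le:
  assumes odd: "odd CARD('p::prime_card)" and y: "padic_norm (y :: 'p padic) \<le> 1 / real CARD('p)"
  shows "real n * padic_norm (y ^ Suc n / of_nat (Suc n)) \<le> 1"
proof -
  let ?p = "real CARD('p)"
  have p3: "3 \<le> ?p" using card_ge_3[OF odd] by simp
  have "padic_norm (y ^ Suc n / of_nat (Suc n)) \<le> (1 / ?p) ^ Suc n / (1 / real (Suc n))"
    unfolding padic_norm_divide padic_norm_power
    by (intro frac_le power_mono y padic_norm_of_nat_ge) auto
  also have "\<dots> = real (Suc n) / ?p ^ Suc n" by (simp add: power_one_over field_simps)
  also have "\<dots> \<le> real (Suc n) / 3 ^ Suc n"
    using p3 by (intro divide_left_mono power_mono) auto
  finally have "real n * padic_norm (y ^ Suc n / of_nat (Suc n)) \<le> real n * (real (Suc n) / 3 ^ Suc n)"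
    by (rule mult_left_mono) simp
  also have "\<dots> = real (n * Suc n) / 3 ^ Suc n" by (simp only: of_nat_mult times_divide_eq_right)
  also have "\<dots> \<le> 1"
  proof -
    have "real (n * Suc n) \<le> real (3 ^ Suc n)" using Suc_mult_Suc_le_power[of n] by (simp only: of_nat_le_iff)
    also have "real (3 ^ Suc n) = 3 ^ Suc n" by simp
    finally show ?thesis by (simp only: divide_le_eq_1_pos zero_less_power zero_less_numeral)
  qed
  finally show ?thesis .
qed

lemma padic_log_term_0:
  assumes odd: "odd CARD('p::prime_card)" and y: "padic_norm (y :: 'p padic) \<le> 1 / real CARD('p)"
  shows "(\<lambda>n. y ^ Suc n / of_nat (Suc n)) \<longlonglongrightarrow> 0"
proof (rule padic_tendsto_le[of 1 _ _ "\<lambda>n. 1 / real n"])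
  fix n :: nat assume "n \<ge> 1"
  thus "padic_norm (y ^ Suc n / of_nat (Suc n) - 0) \<le> 1 / real n"
    using padic_log_term_le[OF assms, of n] by (simp add: pos_le_divide_eq mult.commute del: power_Suc of_nat_Suc)
qed (rule lim_1_over_n)

lemma padic_log_sums:
  assumes odd: "odd CARD('p::prime_card)" and x: "padic_norm (x - 1 :: 'p padic) \<le> 1 / real CARD('p)"
  shows "(\<lambda>n. (- 1) ^ n * (x - 1) ^ Suc n / of_nat (Suc n)) sums padic_log x"
  unfolding padic_log_def
proof (rule summable_sums, rule padic_summable)
  have "(\<lambda>n. padic_norm ((x - 1) ^ Suc n / of_nat (Suc n))) \<longlonglongrightarrow> 0"
    using padic_log_term_0[OF assms] by (simp only: padic_tendsto_0_iff)
  thus "(\<lambda>n. (- 1) ^ n * (x - 1) ^ Suc n / of_nat (Suc n)) \<longlonglongrightarrow> 0"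
    by (simp add: padic_tendsto_0_iff padic_norm_mult padic_norm_divide padic_norm_power del: of_nat_Suc power_Suc)
qed

lemma add_3_le_3_power: "Suc (Suc (Suc n)) \<le> 3 ^ Suc n"
  by (induction n) auto

text \<open>With \<open>y = x - 1\<close>, the terms beyond the linear one are, up to sign,
  \<open>y^2\<close> times \<open>y^(n - 1) / (n + 1)\<close>, so it suffices that
  \<open>y^(n - 1)\<close> is no larger than \<open>n + 1\<close> in norm. For \<open>n = 1\<close>
  this says that \<open>2\<close> is a unit; for \<open>n \<ge> 2\<close> it follows from
  \<open>n + 1 \<le> 3^(n - 1)\<close>.\<close>

lemma padic_log_minus_le:
  assumes odd: "odd CARD('p::prime_card)" and x: "padic_norm (x - 1 :: 'p padic) \<le> 1 / real CARD('p)"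
  shows "padic_norm (padic_log x - (x - 1)) \<le> padic_norm (x - 1) ^ 2"
proof -
  let ?y = "x - 1" and ?p = "real CARD('p)"
  have p3: "3 \<le> ?p" using card_ge_3[OF odd] by simp
  have "padic_norm (padic_log x - (\<Sum>n<1. (- 1) ^ n * ?y ^ Suc n / of_nat (Suc n))) \<le> padic_norm ?y ^ 2"
  proof (rule padic_suminf_tail_le[OF padic_log_sums[OF assms]])
    fix n :: nat assume n: "n \<ge> 1"
    have *: "padic_norm (?y ^ (n - 1)) \<le> padic_norm (of_nat (Suc n) :: 'p padic)"
    proof (cases "n = 1")
      case True
      have "coprime 2 CARD('p)" using odd by simp
      hence "padic_norm (of_nat 2 :: 'p padic) = 1" by (simp only: padic_norm_of_nat_eq_1_iff)
      thus ?thesis using True by simp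
    next
      case False
      then obtain m where m: "n = Suc (Suc m)" using n by (cases n; cases "n - 1") auto
      have "real (Suc n) \<le> real (3 ^ (n - 1))" unfolding m using add_3_le_3_power[of m] by (simp only: of_nat_le_iff) simp
      also have "\<dots> \<le> ?p ^ (n - 1)" using p3 by (simp add: power_mono)
      finally have "1 / ?p ^ (n - 1) \<le> 1 / real (Suc n)" by (intro divide_left_mono) auto
      moreover have "padic_norm (?y ^ (n - 1)) \<le> (1 / ?p) ^ (n - 1)"
        unfolding padic_norm_power by (intro power_mono x) auto
      moreover have "1 / real (Suc n) \<le> padic_norm (of_nat (Suc n) :: 'p padic)"
        by (rule padic_norm_of_nat_ge) simp
      ultimately show ?thesis by (simp add: power_one_over)
    qed
    have pos: "0 < padic_norm (of_nat (Suc n) :: 'p padic)"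
      by (simp add: less_le del: of_nat_Suc)
    have "Suc n = 2 + (n - 1)" using n by simp
    hence "?y ^ Suc n = ?y ^ 2 * ?y ^ (n - 1)" by (metis power_add)
    hence "padic_norm ((- 1) ^ n * ?y ^ Suc n / of_nat (Suc n))
        = padic_norm ?y ^ 2 * (padic_norm (?y ^ (n - 1)) / padic_norm (of_nat (Suc n) :: 'p padic))"
      by (simp add: padic_norm_mult padic_norm_divide padic_norm_power del: of_nat_Suc power_Suc)
    also have "\<dots> \<le> padic_norm ?y ^ 2 * 1"
      using * pos by (intro mult_left_mono) (auto simp: divide_le_eq_1)
    finally show "padic_norm ((- 1) ^ n * ?y ^ Suc n / of_nat (Suc n)) \<le> padic_norm ?y ^ 2" by simp
  qed auto
  thus ?thesis by simp
qed

lemma padic_log_le: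
  assumes odd: "odd CARD('p::prime_card)" and x: "padic_norm (x - 1 :: 'p padic) \<le> 1 / real CARD('p)"
  shows "padic_norm (padic_log x) \<le> padic_norm (x - 1)"
proof -
  have "padic_norm (x - 1) \<le> 1" using x inverse_card_le_1(1)[where 'p = 'p] by linarith
  hence "padic_norm (x - 1) ^ 2 \<le> padic_norm (x - 1)"
    by (simp add: power2_eq_square mult_left_le)
  from order_trans[OF padic_log_minus_le[OF assms] this]
  have "padic_norm ((padic_log x - (x - 1)) + (x - 1)) \<le> padic_norm (x - 1)"
    by (rule padic_norm_add_le) simp
  thus ?thesis by simp
qed

text \<open>Induction over Pascal's rule, since \<open>M choose (n + 1)\<close> is divisible by \<open>M / (n + 1)\<close>.\<close>

lemma padic_binomial_minus_sign_le:
  assumes M: "M > 0"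
  shows "padic_norm (of_nat (M - 1 choose n) - (- 1) ^ n :: 'p::prime_card padic)
           \<le> real n * padic_norm (of_nat M :: 'p padic)"
proof (induction n)
  case (Suc n)
  let ?c = "\<lambda>m n. of_nat (m choose n) :: 'p padic"
  have pascal: "?c (M - 1) (Suc n) = ?c M (Suc n) - ?c (M - 1) n"
    using M binomial_Suc_Suc[of "M - 1" n] by simp
  have abs: "of_nat (Suc n) * ?c M (Suc n) = of_nat M * ?c (M - 1) n"
    using M binomial_absorption[of n M] by (simp flip: of_nat_mult del: mult_Suc of_nat_Suc)
  have nz: "0 < padic_norm (of_nat (Suc n) :: 'p padic)" by (simp add: less_le del: of_nat_Suc)
  have "padic_norm (of_nat (Suc n) :: 'p padic) * padic_norm (?c M (Suc n))
      \<le> padic_norm (of_nat M :: 'p padic) * 1"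
    unfolding padic_norm_mult[symmetric] abs
    by (simp add: padic_norm_mult mult_left_le padic_norm_of_nat_le_1)
  hence "1 / real (Suc n) * padic_norm (?c M (Suc n)) \<le> padic_norm (of_nat M :: 'p padic)"
    using mult_right_mono[OF padic_norm_of_nat_ge[of "Suc n", where 'p = 'p], of "padic_norm (?c M (Suc n))"]
    by (simp del: of_nat_Suc)
  hence 1: "padic_norm (?c M (Suc n)) \<le> real (Suc n) * padic_norm (of_nat M :: 'p padic)"
    by (simp add: field_simps)
  have 2: "padic_norm (?c (M - 1) n - (- 1) ^ n) \<le> real (Suc n) * padic_norm (of_nat M :: 'p padic)"
    by (rule order_trans[OF Suc.IH]) (intro mult_right_mono, auto)
  have "?c (M - 1) (Suc n) - (- 1) ^ Suc n = ?c M (Suc n) - (?c (M - 1) n - (- 1) ^ n)"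
    unfolding pascal by simp
  thus ?case using padic_norm_diff_le[OF 1 2] by (simp only:)
qed simp

text \<open>Since \<open>(M choose (n + 1)) / M = ((M - 1) choose n) / (n + 1)\<close>, the quotient
  is the logarithm series with \<open>(-1)^n\<close> replaced by \<open>(M - 1) choose n\<close>,
  and these coefficients are close when \<open>M\<close> is highly divisible by
  \<open>p\<close>.\<close>

lemma padic_log_limit:
  assumes odd: "odd CARD('p::prime_card)" and x: "padic_norm (x - 1 :: 'p padic) \<le> 1 / real CARD('p)"
    and M: "M > 0"
  shows "padic_norm ((x ^ M - 1) / of_nat M - padic_log x) \<le> padic_norm (of_nat M :: 'p padic)"
proof -
  let ?y = "x - 1" and ?t = "\<lambda>n. (x - 1) ^ Suc n / of_nat (Suc n)"
  let ?c = "\<lambda>m n. of_nat (m choose n) :: 'p padic"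
  have "x ^ M - 1 = (\<Sum>k\<le>M. ?c M k * ?y ^ k) - 1"
    using binomial_ring[of ?y 1 M] by simp
  also have "\<dots> = (\<Sum>n<M. ?c M (Suc n) * ?y ^ Suc n)"
    by (subst lessThan_Suc_atMost[symmetric], subst sum.lessThan_Suc_shift) simp
  also have "\<dots> = of_nat M * (\<Sum>n<M. ?c (M - 1) n * ?t n)"
    unfolding sum_distrib_left
  proof (intro sum.cong refl)
    fix n
    have "of_nat (Suc n) * ?c M (Suc n) = of_nat M * ?c (M - 1) n"
      using M binomial_absorption[of n M] by (simp flip: of_nat_mult del: mult_Suc of_nat_Suc)
    hence "?c M (Suc n) = of_nat M * ?c (M - 1) n / of_nat (Suc n)"
      by (simp add: nonzero_eq_divide_eq mult.commute del: of_nat_Suc)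
    thus "?c M (Suc n) * ?y ^ Suc n = of_nat M * (?c (M - 1) n * ?t n)" by (simp del: of_nat_Suc power_Suc)
  qed
  finally have "(x ^ M - 1) / of_nat M = (\<Sum>n<M. ?c (M - 1) n * ?t n)" using M by simp
  moreover have "(\<lambda>n. ?c (M - 1) n * ?t n) sums (\<Sum>n<M. ?c (M - 1) n * ?t n)"
    by (rule sums_finite) (use M in \<open>auto simp: binomial_eq_0\<close>)
  ultimately have "(\<lambda>n. ?c (M - 1) n * ?t n - (- 1) ^ n * ?y ^ Suc n / of_nat (Suc n)) sums ((x ^ M - 1) / of_nat M - padic_log x)"
    using padic_log_sums[OF odd x] unfolding sums_def sum_subtractf
    by (simp add: tendsto_add[OF _ tendsto_minus, folded diff_conv_add_uminus] del: power_Suc of_nat_Suc)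
  thus ?thesis
  proof (rule padic_suminf_norm_le)
    fix n
    have "padic_norm (?c (M - 1) n * ?t n - (- 1) ^ n * ?y ^ Suc n / of_nat (Suc n))
        = padic_norm (?c (M - 1) n - (- 1) ^ n) * padic_norm (?t n)"
      unfolding padic_norm_mult[symmetric] by (simp add: algebra_simps del: of_nat_Suc power_Suc)
    also have "\<dots> \<le> (real n * padic_norm (of_nat M :: 'p padic)) * padic_norm (?t n)"
      by (intro mult_right_mono padic_binomial_minus_sign_le M) auto
    also have "\<dots> = (real n * padic_norm (?t n)) * padic_norm (of_nat M :: 'p padic)" by (simp only: mult_ac)
    also have "\<dots> \<le> 1 * padic_norm (of_nat M :: 'p padic)"
      by (intro mult_right_mono padic_log_term_le odd x) auto
    finally show "padic_norm (?c (M - 1) n * ?t n - (- 1) ^ n * ?y ^ Suc n / of_nat (Suc n)) \<le> padic_norm (of_nat M :: 'p padic)"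
      by simp
  qed
qed

lemma padic_eq_0I:
  assumes "\<And>n. padic_norm (x :: 'p::prime_card padic) \<le> C / real CARD('p) ^ n"
  shows "x = 0"
proof -
  have "padic_norm x \<le> 0"
    by (rule LIMSEQ_le_const[OF inverse_card_pow_tendsto_0[of C, where 'p = 'p]]) (use assms in auto)
  thus ?thesis using padic_norm_nonneg[of x] by (simp add: antisym del: padic_norm_nonneg)
qed

lemma padic_norm_one_plus_mult:
  assumes "padic_norm (x - 1 :: 'p::prime_card padic) \<le> r" "padic_norm (y - 1) \<le> r" "r \<le> 1"
  shows "padic_norm (x * y - 1) \<le> r"
proof -
  have "padic_norm ((x - 1) * (y - 1)) \<le> r * 1"
    unfolding padic_norm_mult using assms by (intro mult_mono) (auto intro: order_trans[OF padic_norm_nonneg])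
  hence "padic_norm ((x - 1) * (y - 1) + ((x - 1) + (y - 1))) \<le> r"
    using assms by (intro padic_norm_add_le) auto
  thus ?thesis by (simp add: algebra_simps)
qed

text \<open>The approximants \<open>L z = (z^M - 1) / M\<close> with \<open>M = p^n\<close> satisfy
  \<open>L (x y) = L x + L y + M L x L y\<close> exactly, and the last term disappears in the
  limit.\<close>

lemma padic_log_mult:
  assumes odd: "odd CARD('p::prime_card)"
    and x: "padic_norm (x - 1 :: 'p padic) \<le> 1 / real CARD('p)" and y: "padic_norm (y - 1) \<le> 1 / real CARD('p)"
  shows "padic_log (x * y) = padic_log x + padic_log y"
proof -
  have xy: "padic_norm (x * y - 1) \<le> 1 / real CARD('p)"
    by (rule padic_norm_one_plus_mult[OF x y]) simp
  have "padic_norm (padic_log (x * y) - padic_log x - padic_log y) \<le> 1 / real CARD('p) ^ n" for n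
  proof -
    define M where "M = CARD('p) ^ n"
    have M: "M > 0" by (simp add: M_def)
    have nM: "padic_norm (of_nat M :: 'p padic) = 1 / real CARD('p) ^ n"
      by (simp add: M_def padic_norm_power padic_norm_card power_one_over)
    define L where "L = (\<lambda>z :: 'p padic. (z ^ M - 1) / of_nat M)"
    have lim: "padic_norm (L z - padic_log z) \<le> 1 / real CARD('p) ^ n" if "padic_norm (z - 1) \<le> 1 / real CARD('p)" for z
      using padic_log_limit[OF odd that M] unfolding L_def nM .
    have L1: "padic_norm (L z) \<le> 1" if z: "padic_norm (z - 1) \<le> 1 / real CARD('p)" for z
    proof -
      have "padic_norm (padic_log z) \<le> 1"
        using padic_log_le[OF odd z] z inverse_card_le_1(1)[where 'p = 'p] by linarith
      moreover have "padic_norm (L z - padic_log z) \<le> 1"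
        using lim[OF z] inverse_card_pow_le_1[of n, where 'p = 'p] by linarith
      ultimately have "padic_norm ((L z - padic_log z) + padic_log z) \<le> 1" by (rule padic_norm_add_le[rotated])
      thus ?thesis by simp
    qed
    have Lxy: "L (x * y) - L x - L y = of_nat M * (L x * L y)"
      using M by (simp add: L_def power_mult_distrib field_simps)
    have "padic_norm (of_nat M * (L x * L y)) \<le> 1 / real CARD('p) ^ n * (1 * 1)"
      unfolding padic_norm_mult nM by (intro mult_left_mono mult_mono L1 x y) auto
    hence "padic_norm (L (x * y) - L x - L y) \<le> 1 / real CARD('p) ^ n" unfolding Lxy by simp
    hence "padic_norm ((L (x * y) - L x - L y) - (L (x * y) - padic_log (x * y)) + (L x - padic_log x) + (L y - padic_log y)) \<le> 1 / real CARD('p) ^ n"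
      by (intro padic_norm_add_le padic_norm_diff_le[of "L (x * y) - L x - L y"] lim x y xy)
    thus ?thesis by (simp add: algebra_simps)
  qed
  hence "padic_log (x * y) - padic_log x - padic_log y = 0" by (rule padic_eq_0I)
  thus ?thesis by (simp add: algebra_simps)
qed


subsection \<open>The Teichmueller character\<close>

lemma padic_norm_power_diff_le:
  assumes "padic_norm (a :: 'p::prime_card padic) \<le> 1" "padic_norm b \<le> 1"
  shows "padic_norm (a ^ n - b ^ n) \<le> padic_norm (a - b)"
proof (induction n)
  case (Suc n)
  have "padic_norm (a * (a ^ n - b ^ n)) \<le> 1 * padic_norm (a - b)"
    unfolding padic_norm_mult by (intro mult_mono assms Suc) auto
  moreover have "padic_norm ((a - b) * b ^ n) \<le> padic_norm (a - b) * 1"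
    unfolding padic_norm_mult padic_norm_power using assms by (intro mult_left_mono power_le_one) auto
  moreover have "a ^ Suc n - b ^ Suc n = a * (a ^ n - b ^ n) + (a - b) * b ^ n"
    by (simp add: algebra_simps)
  ultimately show ?case by (simp only:) (intro padic_norm_add_le, simp_all)
qed simp

text \<open>In \<open>a^p - b^p = (a - b) \<Sum> a^i b^(p - 1 - i)\<close> the sum is congruent to
  \<open>p a^(p - 1)\<close> modulo \<open>p\<close>, so taking \<open>p\<close>-th powers contracts
  by a factor \<open>p\<close>.\<close>

lemma padic_norm_card_power_diff_le:
  assumes a: "padic_norm (a :: 'p::prime_card padic) \<le> 1" and b: "padic_norm b \<le> 1"
    and ab: "padic_norm (a - b) \<le> 1 / real CARD('p)"
  shows "padic_norm (a ^ CARD('p) - b ^ CARD('p)) \<le> padic_norm (a - b) / real CARD('p)"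
proof -
  obtain k where k: "CARD('p) = Suc k" by (metis Suc_lessE card_gt_1)
  have "(\<Sum>i<Suc k. a ^ i * b ^ (k - i)) = (\<Sum>i<Suc k. a ^ i * (b ^ (k - i) - a ^ (k - i))) + of_nat (Suc k) * a ^ k"
    by (simp add: algebra_simps sum_subtractf flip: power_add)
  also have "padic_norm \<dots> \<le> 1 / real CARD('p)"
  proof (intro padic_norm_add_le padic_norm_sum_le)
    fix i
    have "padic_norm (a ^ i * (b ^ (k - i) - a ^ (k - i))) \<le> 1 * padic_norm (b - a)"
      unfolding padic_norm_mult by (intro mult_mono padic_norm_power_diff_le a b) (auto simp: padic_norm_power power_le_one a)
    also have "\<dots> \<le> 1 / real CARD('p)" using ab by (simp add: padic_norm_minus_commute)
    finally show "padic_norm (a ^ i * (b ^ (k - i) - a ^ (k - i))) \<le> 1 / real CARD('p)" .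
    have "padic_norm (of_nat (Suc k) * a ^ k) \<le> 1 / real CARD('p) * 1"
      unfolding padic_norm_mult k[symmetric] padic_norm_card
      by (intro mult_left_mono) (auto simp: padic_norm_power power_le_one a)
    thus "padic_norm (of_nat (Suc k) * a ^ k) \<le> 1 / real CARD('p)" by simp
  qed simp
  finally have *: "padic_norm (\<Sum>i<Suc k. a ^ i * b ^ (k - i)) \<le> 1 / real CARD('p)" .
  have "padic_norm (a ^ Suc k - b ^ Suc k) = padic_norm (a - b) * padic_norm (\<Sum>i<Suc k. a ^ i * b ^ (k - i))"
    unfolding diff_power_eq_sum padic_norm_mult ..
  also have "\<dots> \<le> padic_norm (a - b) * (1 / real CARD('p))" by (intro mult_left_mono *) auto
  finally show ?thesis using k by simp
qed

lemma padic_Fermat: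
  assumes x: "padic_norm (x :: 'p::prime_card padic) \<le> 1"
  shows "padic_norm (x ^ CARD('p) - x) \<le> 1 / real CARD('p)"
proof -
  obtain a where a: "padic_norm (x - of_nat a) \<le> 1 / real CARD('p)"
    using padic_nat_dense[OF x, of 1] by auto
  have "[a ^ CARD('p) = a] (mod CARD('p))"
  proof (cases "CARD('p) dvd a")
    case True
    hence "CARD('p) dvd a ^ CARD('p)" by (rule dvd_trans) (simp add: dvd_power)
    with True show ?thesis by (metis cong_0_iff cong_sym cong_trans)
  next
    case False
    have "[a * a ^ (CARD('p) - 1) = a * 1] (mod CARD('p))"
      by (intro cong_mult cong_refl fermat_theorem prime_card False)
    thus ?thesis by (simp flip: power_Suc)
  qed
  hence 1: "padic_norm (of_nat a ^ CARD('p) - of_nat a :: 'p padic) \<le> 1 / real CARD('p)"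
    using padic_norm_of_nat_diff_le_iff[of "a ^ CARD('p)" a 1, where 'p = 'p] by simp
  have 2: "padic_norm (x ^ CARD('p) - of_nat a ^ CARD('p)) \<le> 1 / real CARD('p)"
    by (rule order_trans[OF padic_norm_power_diff_le a]) (auto simp: x padic_norm_of_nat_le_1)
  have "padic_norm ((x ^ CARD('p) - of_nat a ^ CARD('p)) + (of_nat a ^ CARD('p) - of_nat a) - (x - of_nat a)) \<le> 1 / real CARD('p)"
    by (rule padic_norm_diff_le[OF padic_norm_add_le[OF 2 1] a])
  thus ?thesis by simp
qed

text \<open>Both roots are fixed by the \<open>p\<close>-th power map, which contracts distances
  below \<open>1\<close> by the factor \<open>1 / p\<close>.\<close>

lemma root_of_unity_unique:
  assumes "(z :: 'p::prime_card padic) ^ (CARD('p) - 1) = 1" "w ^ (CARD('p) - 1) = 1" "padic_norm (z - w) < 1"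
  shows "z = w"
proof (rule ccontr)
  assume "z \<noteq> w"
  have root: "padic_norm u = 1 \<and> u ^ CARD('p) = u" if u: "u ^ (CARD('p) - 1) = 1" for u :: "'p padic"
  proof
    have "padic_norm u ^ (CARD('p) - 1) = 1" using u by (simp flip: padic_norm_power)
    hence "padic_norm u ^ (CARD('p) - 1) = 1 ^ (CARD('p) - 1)" by simp
    thus "padic_norm u = 1" by (rule power_eq_imp_eq_base) auto
    show "u ^ CARD('p) = u" using u power_Suc[of u "CARD('p) - 1"] by simp
  qed
  have "padic_norm (z ^ CARD('p) - w ^ CARD('p)) \<le> padic_norm (z - w) / real CARD('p)"
    using root assms by (intro padic_norm_card_power_diff_le padic_norm_less_1) auto
  hence "padic_norm (z - w) \<le> padic_norm (z - w) / real CARD('p)" using root assms by simp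
  also have "\<dots> < padic_norm (z - w) / 1"
    using \<open>z \<noteq> w\<close> by (intro divide_strict_left_mono) (auto simp: less_le)
  finally show False by simp
qed

lemma tendsto_power_padic:
  "(f \<longlongrightarrow> (l :: 'p::prime_card padic)) F \<Longrightarrow> ((\<lambda>x. f x ^ n) \<longlongrightarrow> l ^ n) F"
  by (induction n) (auto intro: tendsto_mult)

text \<open>The root is the limit of \<open>x^(p^n)\<close>: starting from Fermat's congruence,
  consecutive terms differ by at most \<open>p^(- n - 1)\<close> in norm, and the limit is fixed by
  the \<open>p\<close>-th power map.\<close>

lemma root_of_unity_exists:
  assumes x: "padic_norm (x :: 'p::prime_card padic) = 1"
  shows "\<exists>z. z ^ (CARD('p) - 1) = 1 \<and> padic_norm (z - x) < 1"
proof -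
  let ?p = "CARD('p)"
  define X where "X = (\<lambda>n. x ^ (?p ^ n))"
  have X1: "padic_norm (X n) = 1" for n by (simp add: X_def padic_norm_power x)
  have XS: "X (Suc n) = X n ^ ?p" for n by (simp add: X_def mult.commute flip: power_mult)
  have d: "padic_norm (X (Suc n) - X n) \<le> 1 / real ?p ^ Suc n" for n
  proof (induction n)
    case 0
    show ?case using padic_Fermat[of x] x by (simp add: X_def)
  next
    case (Suc n)
    have "1 / real ?p ^ Suc n \<le> 1 / real ?p" by (simp add: field_simps)
    hence "padic_norm (X (Suc n) ^ ?p - X n ^ ?p) \<le> padic_norm (X (Suc n) - X n) / real ?p"
      using Suc X1 by (intro padic_norm_card_power_diff_le) auto
    also have "\<dots> \<le> (1 / real ?p ^ Suc n) / real ?p" by (intro divide_right_mono Suc) simp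
    finally show ?case by (simp add: XS mult.commute)
  qed
  have "summable (\<lambda>n. X (Suc n) - X n)"
    by (rule padic_summable, rule padic_tendsto_le[of 0 _ _ "\<lambda>n. 1 / real ?p ^ n"])
       (auto intro!: order_trans[OF d] inverse_card_pow_tendsto_0 divide_left_mono)
  then obtain l where l: "(\<lambda>n. X (Suc n) - X n) sums l" by (auto simp: summable_def)
  have l1: "padic_norm l \<le> 1 / real ?p"
  proof (rule padic_suminf_norm_le[OF l])
    fix n
    have "1 / real ?p ^ Suc n \<le> 1 / real ?p" by (simp add: field_simps)
    thus "padic_norm (X (Suc n) - X n) \<le> 1 / real ?p" using d[of n] by linarith
  qed
  have "(\<lambda>n. X 0 + (\<Sum>k<n. X (Suc k) - X k)) \<longlonglongrightarrow> X 0 + l"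
    using l unfolding sums_def by (intro tendsto_intros)
  moreover have "X 0 + (\<Sum>k<n. X (Suc k) - X k) = X n" for n
    by (simp add: sum_lessThan_telescope)
  ultimately have lim: "X \<longlonglongrightarrow> x + l" by (simp add: X_def)
  have "(\<lambda>n. X n ^ ?p) \<longlonglongrightarrow> (x + l) ^ ?p" by (rule tendsto_power_padic[OF lim])
  moreover have "(\<lambda>n. X n ^ ?p) \<longlonglongrightarrow> x + l" using LIMSEQ_Suc[OF lim] by (simp add: XS)
  ultimately have "(x + l) ^ ?p = x + l" by (rule LIMSEQ_unique)
  moreover have l': "padic_norm l < 1" using l1 inverse_card_le_1(2)[where 'p = 'p] by linarith
  hence "padic_norm (x + l) = 1" using padic_norm_add_eq[of l x] x by (simp add: add.commute)
  hence "x + l \<noteq> 0" by auto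
  moreover have "(x + l) ^ ?p = (x + l) * (x + l) ^ (?p - 1)"
    by (subst power_Suc[symmetric]) simp
  ultimately have "(x + l) ^ (?p - 1) = 1" by simp
  thus ?thesis using l' by (intro exI[of _ "x + l"]) simp
qed

context
  fixes x :: "'p::prime_card padic"
  assumes x: "padic_norm x = 1"
begin

lemma teichmuller_root: "teichmuller x ^ (CARD('p) - 1) = 1"
  and teichmuller_close: "padic_norm (teichmuller x - x) < 1"
proof -
  have "\<exists>!z. z ^ (CARD('p) - 1) = 1 \<and> padic_norm (z - x) < 1"
  proof (rule ex_ex1I[OF root_of_unity_exists[OF x]])
    fix z w assume z: "z ^ (CARD('p) - 1) = 1 \<and> padic_norm (z - x) < 1"
      and w: "w ^ (CARD('p) - 1) = 1 \<and> padic_norm (w - x) < 1"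
    have "padic_norm (z - w) \<le> max (padic_norm (z - x)) (padic_norm (w - x))"
      using padic_norm_add[of "z - x" "x - w"] by (simp add: padic_norm_minus_commute)
    also have "\<dots> < 1" using z w by simp
    finally show "z = w" by (rule root_of_unity_unique[OF conjunct1[OF z] conjunct1[OF w]])
  qed
  from theI'[OF this] show "teichmuller x ^ (CARD('p) - 1) = 1" "padic_norm (teichmuller x - x) < 1"
    unfolding teichmuller_def by blast+
qed

lemma teichmuller_eqI:
  assumes "z ^ (CARD('p) - 1) = 1" "padic_norm (z - x) < 1"
  shows "teichmuller x = z"
proof (rule root_of_unity_unique[OF teichmuller_root assms(1)])
  have "padic_norm (teichmuller x - z) \<le> max (padic_norm (teichmuller x - x)) (padic_norm (z - x))"
    using padic_norm_add[of "teichmuller x - x" "x - z"] by (simp add: padic_norm_minus_commute)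
  also have "\<dots> < 1" using assms teichmuller_close by simp
  finally show "padic_norm (teichmuller x - z) < 1" .
qed

lemma padic_norm_teichmuller [simp]: "padic_norm (teichmuller x) = 1"
  using padic_norm_close_eq[of "teichmuller x" x] teichmuller_close x by simp

lemma principal_unit_close: "padic_norm (principal_unit x - 1) \<le> 1 / real CARD('p)"
proof -
  have "teichmuller x \<noteq> 0" using padic_norm_teichmuller by (metis padic_norm_0 zero_neq_one)
  hence "principal_unit x - 1 = inverse (teichmuller x) * (x - teichmuller x)"
    by (simp add: principal_unit_def algebra_simps)
  hence "padic_norm (principal_unit x - 1) = padic_norm (teichmuller x - x)"
    by (simp add: padic_norm_mult padic_norm_inverse padic_norm_minus_commute)
  thus ?thesis using teichmuller_close by (intro padic_norm_less_1) simp
qed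

end

lemma teichmuller_mult:
  assumes x: "padic_norm (x :: 'p::prime_card padic) = 1" and y: "padic_norm y = 1"
  shows "teichmuller (x * y) = teichmuller x * teichmuller y"
proof (rule teichmuller_eqI)
  show "padic_norm (x * y) = 1" using x y by (simp add: padic_norm_mult)
  show "(teichmuller x * teichmuller y) ^ (CARD('p) - 1) = 1"
    by (simp add: power_mult_distrib teichmuller_root x y del: One_nat_def)
  have "teichmuller x * teichmuller y - x * y = teichmuller x * (teichmuller y - y) + (teichmuller x - x) * y"
    by (simp add: algebra_simps)
  also have "padic_norm \<dots> \<le> max (padic_norm (teichmuller x * (teichmuller y - y))) (padic_norm ((teichmuller x - x) * y))"
    by (rule padic_norm_add)
  also have "\<dots> < 1" using teichmuller_close[OF x] teichmuller_close[OF y]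
    by (simp add: padic_norm_mult x y)
  finally show "padic_norm (teichmuller x * teichmuller y - x * y) < 1" .
qed

lemma teichmuller_cong:
  assumes x: "padic_norm (x :: 'p::prime_card padic) = 1" and xy: "padic_norm (x - y) < 1"
  shows "teichmuller y = teichmuller x"
proof (rule teichmuller_eqI)
  show "padic_norm y = 1" using padic_norm_close_eq[of y x] xy x by (simp add: padic_norm_minus_commute)
  show "teichmuller x ^ (CARD('p) - 1) = 1" by (rule teichmuller_root[OF x])
  have "padic_norm (teichmuller x - y) \<le> max (padic_norm (teichmuller x - x)) (padic_norm (x - y))"
    using padic_norm_add[of "teichmuller x - x" "x - y"] by simp
  also have "\<dots> < 1" using teichmuller_close[OF x] xy by simp
  finally show "padic_norm (teichmuller x - y) < 1" .
qed

lemma principal_unit_mult: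
  assumes x: "padic_norm (x :: 'p::prime_card padic) = 1" and y: "padic_norm y = 1"
  shows "principal_unit (x * y) = principal_unit x * principal_unit y"
  by (simp add: principal_unit_def teichmuller_mult[OF assms])

lemma teichmuller_1: "teichmuller (1 :: 'p::prime_card padic) = 1"
  by (rule teichmuller_eqI) auto

text \<open>The Iwasawa logarithm on units. Unlike \<open>padic_log\<close> it is meaningful in
  every residue class, and for odd \<open>p\<close> it is a homomorphism on the whole unit
  group.\<close>

definition log_unit :: "'p::prime_card padic \<Rightarrow> 'p padic" where
  "log_unit x = padic_log (principal_unit x)"

context
  fixes ty :: "'p::prime_card itself"
  assumes odd: "odd CARD('p)"
begin

lemma log_unit_le: "padic_norm (x :: 'p padic) = 1 \<Longrightarrow> padic_norm (log_unit x) \<le> 1 / real CARD('p)"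
  unfolding log_unit_def
  by (rule order_trans[OF padic_log_le[OF odd]]) (rule principal_unit_close, assumption)+

lemma log_unit_mult:
  "padic_norm (x :: 'p padic) = 1 \<Longrightarrow> padic_norm y = 1 \<Longrightarrow> log_unit (x * y) = log_unit x + log_unit y"
  unfolding log_unit_def by (simp add: principal_unit_mult padic_log_mult[OF odd] principal_unit_close)

lemma log_unit_eq_padic_log:
  assumes "padic_norm (x - 1 :: 'p padic) < 1"
  shows "log_unit x = padic_log x"
proof -
  have "teichmuller x = teichmuller 1"
    using assms by (intro teichmuller_cong) (simp_all add: padic_norm_minus_commute)
  thus ?thesis by (simp add: log_unit_def principal_unit_def teichmuller_1)
qed

lemma log_unit_close_1: "padic_norm (x - 1 :: 'p padic) < 1 \<Longrightarrow> padic_norm (log_unit x) \<le> padic_norm (x - 1)"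
  using padic_log_le[OF odd, of x] padic_norm_less_1[of "x - 1"] by (simp add: log_unit_eq_padic_log)

text \<open>For close points the difference is \<open>log_unit (x / y)\<close> with
  \<open>x / y\<close> near \<open>1\<close>; otherwise the distance is at least \<open>1\<close>,
  and all logarithms of units lie in \<open>p Z_p\<close>.\<close>

lemma log_unit_diff_le:
  assumes x: "padic_norm (x :: 'p padic) = 1" and y: "padic_norm y = 1"
  shows "padic_norm (log_unit x - log_unit y) \<le> padic_norm (x - y)"
proof (cases "padic_norm (x - y) < 1")
  case True
  have y0: "y \<noteq> 0" using y by auto
  have xy: "padic_norm (x / y) = 1" "padic_norm (x / y - 1) = padic_norm (x - y)"
    using padic_norm_divide[of "x - y" y] y y0 by (simp_all add: padic_norm_divide x y diff_divide_distrib)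
  have "log_unit x = log_unit (x / y) + log_unit y"
    using log_unit_mult[OF xy(1) y] y0 by simp
  thus ?thesis using log_unit_close_1[of "x / y"] xy True by simp
next
  case False
  have "1 / real CARD('p) \<le> padic_norm (x - y)" using False inverse_card_le_1(1)[where 'p = 'p] by linarith
  thus ?thesis using log_unit_le[OF x] log_unit_le[OF y] by (intro padic_norm_diff_le) auto
qed

end


subsection \<open>Residues of units\<close>

lemma padic_norm_unit_residue:
  assumes "a \<in> unit_residues CARD('p::prime_card) n" "n > 0"
  shows "padic_norm (of_nat a :: 'p padic) = 1"
  using assms by (simp add: padic_norm_of_nat_eq_1_iff unit_residues_def)

lemma unit_residue_ex1:
  assumes y: "padic_norm (y :: 'p::prime_card padic) = 1"
  shows "\<exists>!a. a \<in> unit_residues CARD('p) n \<and> padic_norm (y - of_nat a) \<le> 1 / real CARD('p) ^ n"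
proof -
  obtain a where a: "a < CARD('p) ^ n" "padic_norm (y - of_nat a) \<le> 1 / real CARD('p) ^ n"
    using padic_nat_dense[of y n] y by auto
  have "coprime a (CARD('p) ^ n)"
  proof (cases "n = 0")
    case False
    hence "1 / real CARD('p) ^ n < 1" by simp
    from le_less_trans[OF a(2) this] have "padic_norm (of_nat a - y) < padic_norm y"
      using y by (simp add: padic_norm_minus_commute)
    hence "padic_norm (of_nat a :: 'p padic) = 1" using padic_norm_close_eq y by metis
    thus ?thesis by (simp add: padic_norm_of_nat_eq_1_iff)
  qed simp
  hence "a \<in> unit_residues CARD('p) n" using a by (simp add: unit_residues_def)
  moreover have "b = a" if b: "b \<in> unit_residues CARD('p) n" "padic_norm (y - of_nat b) \<le> 1 / real CARD('p) ^ n" for b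
  proof -
    have "padic_norm (of_nat b - of_nat a :: 'p padic) \<le> 1 / real CARD('p) ^ n"
      using padic_norm_diff_le[OF a(2) b(2)] by simp
    thus ?thesis using a(1) b(1) by (simp add: padic_norm_of_nat_diff_le_iff cong_def unit_residues_def)
  qed
  ultimately show ?thesis using a by blast
qed

definition unit_residue :: "nat \<Rightarrow> 'p::prime_card padic \<Rightarrow> nat" where
  "unit_residue n y = (THE a. a \<in> unit_residues CARD('p) n \<and> padic_norm (y - of_nat a) \<le> 1 / real CARD('p) ^ n)"

lemma unit_residue:
  assumes "padic_norm (y :: 'p::prime_card padic) = 1"
  shows "unit_residue n y \<in> unit_residues CARD('p) n"
    and "padic_norm (y - of_nat (unit_residue n y)) \<le> 1 / real CARD('p) ^ n"
  using theI'[OF unit_residue_ex1[OF assms]] unfolding unit_residue_def by blast+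

lemma unit_residue_eqI:
  assumes "padic_norm (y :: 'p::prime_card padic) = 1"
    and "a \<in> unit_residues CARD('p) n" "padic_norm (y - of_nat a) \<le> 1 / real CARD('p) ^ n"
  shows "unit_residue n y = a"
  unfolding unit_residue_def using the1_equality[OF unit_residue_ex1[OF assms(1)]] assms(2,3) by blast

lemma padic_norm_mod_card_pow:
  "padic_norm (of_nat b - of_nat (b mod CARD('p) ^ n) :: 'p::prime_card padic) \<le> 1 / real CARD('p) ^ n"
  by (simp add: padic_norm_of_nat_diff_le_iff cong_def)

lemma sum_fibres:
  fixes g :: "nat \<Rightarrow> 'a::comm_semiring_0"
  assumes p: "prime p" and "n \<le> m"
  shows "(\<Sum>a\<in>unit_residues p n. h a * (\<Sum>b\<in>{b \<in> unit_residues p m. b mod p ^ n = a}. g b))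
       = (\<Sum>b\<in>unit_residues p m. h (b mod p ^ n) * g b)"
proof -
  have "(\<Sum>a\<in>unit_residues p n. h a * (\<Sum>b\<in>{b \<in> unit_residues p m. b mod p ^ n = a}. g b))
      = (\<Sum>a\<in>unit_residues p n. \<Sum>b\<in>{b \<in> unit_residues p m. b mod p ^ n = a}. h (b mod p ^ n) * g b)"
    unfolding sum_distrib_left by (intro sum.cong refl) auto
  also have "\<dots> = (\<Sum>b\<in>unit_residues p m. h (b mod p ^ n) * g b)"
    by (rule sum.group) (use unit_residues_mod[OF p] assms in auto)
  finally show ?thesis .
qed


subsection \<open>Lipschitz functions on the units\<close>

text \<open>Powers, the characters of the branches, logarithms and indicators of discs are all
  Lipschitz on units, and for such integrands the error of a Riemann sum at level \<open>n\<close>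
  is a constant times \<open>p^-n\<close>.\<close>

definition unit_lipschitz :: "('p::prime_card padic \<Rightarrow> 'p padic) \<Rightarrow> bool" where
  "unit_lipschitz f \<longleftrightarrow> (\<exists>C. \<forall>x y. padic_norm x = 1 \<longrightarrow> padic_norm y = 1 \<longrightarrow>
      padic_norm (f x - f y) \<le> C * padic_norm (x - y))"

lemma unit_lipschitzI:
  assumes "\<And>x y. padic_norm x = 1 \<Longrightarrow> padic_norm y = 1 \<Longrightarrow> padic_norm (f x - f y) \<le> C * padic_norm (x - y)"
  shows "unit_lipschitz f"
  unfolding unit_lipschitz_def using assms by blast

lemma unit_lipschitzE:
  assumes "unit_lipschitz (f :: 'p::prime_card padic \<Rightarrow> 'p padic)"
  obtains C where "C \<ge> 0"
    "\<And>x y. padic_norm x = 1 \<Longrightarrow> padic_norm y = 1 \<Longrightarrow> padic_norm (f x - f y) \<le> C * padic_norm (x - y)"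
    "\<And>x. padic_norm x = 1 \<Longrightarrow> padic_norm (f x) \<le> C"
proof -
  obtain C where C: "\<And>x y. padic_norm x = 1 \<Longrightarrow> padic_norm y = 1 \<Longrightarrow> padic_norm (f x - f y) \<le> C * padic_norm (x - y)"
    using assms unfolding unit_lipschitz_def by blast
  define D where "D = max \<bar>C\<bar> (padic_norm (f 1))"
  have D: "padic_norm (f x - f y) \<le> D * padic_norm (x - y)" if "padic_norm x = 1" "padic_norm y = 1" for x y
  proof -
    have "C * padic_norm (x - y) \<le> D * padic_norm (x - y)"
      by (intro mult_right_mono) (auto simp: D_def)
    thus ?thesis using C[OF that] by linarith
  qed
  have D0: "D \<ge> 0" by (simp add: D_def)
  have "padic_norm (f x) \<le> D" if x: "padic_norm x = 1" for x
  proof -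
    have "padic_norm (x - 1) \<le> 1" using x by (intro padic_norm_diff_le) auto
    hence "D * padic_norm (x - 1) \<le> D * 1" using D0 by (rule mult_left_mono)
    hence "padic_norm (f x - f 1) \<le> D" using D[OF x, of 1] by simp
    hence "padic_norm ((f x - f 1) + f 1) \<le> D" by (rule padic_norm_add_le) (simp add: D_def)
    thus ?thesis by simp
  qed
  thus ?thesis using that D D0 by blast
qed

named_theorems lipschitz_intros

lemma unit_lipschitz_const [lipschitz_intros]: "unit_lipschitz (\<lambda>_. c)"
  by (rule unit_lipschitzI[of _ 0]) simp

lemma unit_lipschitz_ident [lipschitz_intros]: "unit_lipschitz (\<lambda>x. x)"
  by (rule unit_lipschitzI[of _ 1]) simp

lemma unit_lipschitz_add [lipschitz_intros]:
  assumes "unit_lipschitz f" "unit_lipschitz g"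
  shows "unit_lipschitz (\<lambda>x. f x + g x)"
proof -
  from assms(1) obtain C where C: "C \<ge> 0" "\<And>x y. padic_norm x = 1 \<Longrightarrow> padic_norm y = 1 \<Longrightarrow> padic_norm (f x - f y) \<le> C * padic_norm (x - y)"
    by (rule unit_lipschitzE) blast
  from assms(2) obtain D where D: "D \<ge> 0" "\<And>x y. padic_norm x = 1 \<Longrightarrow> padic_norm y = 1 \<Longrightarrow> padic_norm (g x - g y) \<le> D * padic_norm (x - y)"
    by (rule unit_lipschitzE) blast
  show ?thesis
  proof (rule unit_lipschitzI[of _ "C + D"])
    fix x y :: "'a padic" assume "padic_norm x = 1" "padic_norm y = 1"
    note le = C(2)[OF this] D(2)[OF this]
    have "padic_norm ((f x - f y) + (g x - g y)) \<le> C * padic_norm (x - y) + D * padic_norm (x - y)"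
      using padic_norm_triangle[of "f x - f y" "g x - g y"] le by linarith
    thus "padic_norm (f x + g x - (f y + g y)) \<le> (C + D) * padic_norm (x - y)"
      by (simp add: algebra_simps)
  qed
qed

lemma unit_lipschitz_mult [lipschitz_intros]:
  assumes "unit_lipschitz f" "unit_lipschitz g"
  shows "unit_lipschitz (\<lambda>x. f x * g x)"
proof -
  from assms(1) obtain C where C: "C \<ge> 0" "\<And>x y. padic_norm x = 1 \<Longrightarrow> padic_norm y = 1 \<Longrightarrow> padic_norm (f x - f y) \<le> C * padic_norm (x - y)"
    "\<And>x. padic_norm x = 1 \<Longrightarrow> padic_norm (f x) \<le> C"
    by (rule unit_lipschitzE) blast
  from assms(2) obtain D where D: "D \<ge> 0" "\<And>x y. padic_norm x = 1 \<Longrightarrow> padic_norm y = 1 \<Longrightarrow> padic_norm (g x - g y) \<le> D * padic_norm (x - y)"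
    "\<And>x. padic_norm x = 1 \<Longrightarrow> padic_norm (g x) \<le> D"
    by (rule unit_lipschitzE) blast
  show ?thesis
  proof (rule unit_lipschitzI[of _ "C * D"])
    fix x y :: "'a padic" assume x: "padic_norm x = 1" and y: "padic_norm y = 1"
    have "padic_norm (f x * (g x - g y)) \<le> C * (D * padic_norm (x - y))"
      unfolding padic_norm_mult by (intro mult_mono C D x y) auto
    moreover have "padic_norm ((f x - f y) * g y) \<le> (C * padic_norm (x - y)) * D"
      unfolding padic_norm_mult using C(1) by (intro mult_mono C D x y) auto
    ultimately have "padic_norm (f x * (g x - g y) + (f x - f y) * g y) \<le> C * D * padic_norm (x - y)"
      by (intro padic_norm_add_le) (simp_all add: mult_ac)
    thus "padic_norm (f x * g x - f y * g y) \<le> C * D * padic_norm (x - y)"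
      by (simp add: algebra_simps)
  qed
qed

lemma unit_lipschitz_power [lipschitz_intros]: "unit_lipschitz f \<Longrightarrow> unit_lipschitz (\<lambda>x. f x ^ n)"
  by (induction n) (auto intro: lipschitz_intros)

lemma unit_lipschitz_sum [lipschitz_intros]:
  "(\<And>i. i \<in> A \<Longrightarrow> unit_lipschitz (f i)) \<Longrightarrow> unit_lipschitz (\<lambda>x. \<Sum>i\<in>A. f i x)"
  by (induction A rule: infinite_finite_induct) (auto intro: lipschitz_intros)

lemma unit_lipschitz_minus [lipschitz_intros]: "unit_lipschitz f \<Longrightarrow> unit_lipschitz (\<lambda>x. - f x)"
  using unit_lipschitz_mult[OF unit_lipschitz_const[of "-1"], of f] by simp

lemma unit_lipschitz_diff [lipschitz_intros]:
  "unit_lipschitz f \<Longrightarrow> unit_lipschitz g \<Longrightarrow> unit_lipschitz (\<lambda>x. f x - g x)"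
  using unit_lipschitz_add[of f "\<lambda>x. - g x"] unit_lipschitz_minus[of g] by simp

lemma unit_lipschitz_inverse [lipschitz_intros]: "unit_lipschitz inverse"
proof (rule unit_lipschitzI[of _ 1])
  fix x y :: "'a padic" assume xy: "padic_norm x = 1" "padic_norm y = 1"
  hence "x \<noteq> 0" "y \<noteq> 0" by auto
  hence "inverse x - inverse y = inverse x * (y - x) * inverse y" by (simp add: field_simps)
  thus "padic_norm (inverse x - inverse y) \<le> 1 * padic_norm (x - y)"
    by (simp add: padic_norm_mult padic_norm_inverse xy padic_norm_minus_commute)
qed

definition disc_ind :: "nat \<Rightarrow> 'p::prime_card padic \<Rightarrow> 'p padic \<Rightarrow> 'p padic" where
  "disc_ind n b x = (if padic_norm (x - b) \<le> 1 / real CARD('p) ^ n then 1 else 0)"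

lemma unit_lipschitz_disc_ind [lipschitz_intros]: "unit_lipschitz (disc_ind n b)"
\<comment> \<open>Points separated by the indicator are more than \<open>p^-n\<close> apart, so the
  constant \<open>p^n\<close> suffices.\<close>
proof (rule unit_lipschitzI[of _ "real CARD('a) ^ n"])
  fix x y :: "'a padic"
  show "padic_norm (disc_ind n b x - disc_ind n b y) \<le> real CARD('a) ^ n * padic_norm (x - y)"
  proof (cases "padic_norm (x - y) \<le> 1 / real CARD('a) ^ n")
    case True
    have "padic_norm (x - b) \<le> 1 / real CARD('a) ^ n \<longleftrightarrow> padic_norm (y - b) \<le> 1 / real CARD('a) ^ n"
      using padic_norm_add_le[OF True, of "y - b"] padic_norm_diff_le[OF _ True, of "x - b"] by auto
    thus ?thesis by (simp add: disc_ind_def)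
  next
    case False
    hence "1 \<le> real CARD('a) ^ n * padic_norm (x - y)" by (simp add: field_simps)
    thus ?thesis by (auto simp: disc_ind_def)
  qed
qed

lemma disc_ind_of_nat:
  assumes "b \<in> unit_residues CARD('p::prime_card) n"
  shows "disc_ind n (of_nat b) (of_nat a :: 'p padic) = (if a mod CARD('p) ^ n = b then 1 else 0)"
  using assms by (auto simp: disc_ind_def padic_norm_of_nat_diff_le_iff cong_def unit_residues_def)


subsection \<open>Approximate measures\<close>

text \<open>
  Families that are compatible only up to \<open>p\<^sup>n\<close> still have convergent Riemann sums and define a measure;
  hence a distribution can be multiplied by a function simply at each level. Level \<open>0\<close> carries no
  information: its only residue is \<open>0\<close>, which is not a unit.
\<close>

definition approx_family :: "(nat \<Rightarrow> nat \<Rightarrow> 'p::prime_card padic) \<Rightarrow> bool" where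
  "approx_family T \<longleftrightarrow> (\<forall>n a. padic_norm (T n a) \<le> 1) \<and>
     (\<forall>n. \<forall>a\<in>unit_residues CARD('p) n.
        padic_norm ((\<Sum>b\<in>{b \<in> unit_residues CARD('p) (Suc n). b mod CARD('p) ^ n = a}. T (Suc n) b) - T n a)
          \<le> 1 / real CARD('p) ^ n)"

lemma compatible_imp_approx_family: "compatible_family \<mu> \<Longrightarrow> approx_family \<mu>"
  unfolding approx_family_def by (simp add: compatible_familyD(1) flip: compatible_familyD(3))

definition riemann_sum ::
  "(nat \<Rightarrow> nat \<Rightarrow> 'p::prime_card padic) \<Rightarrow> ('p padic \<Rightarrow> 'p padic) \<Rightarrow> nat \<Rightarrow> 'p padic" where
  "riemann_sum T f n = (\<Sum>a\<in>unit_residues CARD('p) n. f (of_nat a) * T n a)"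

text \<open>Two errors occur: the variation of \<open>f\<close> inside a residue class modulo
  \<open>p^n\<close>, and the defect of compatibility of \<open>T\<close>. The Lipschitz bound is
  required only at the scale \<open>p^-n\<close>, so the lemma also applies with
  \<open>C = 1\<close> to the indicator of a coarser disc.\<close>

lemma riemann_sum_step:
  fixes T :: "nat \<Rightarrow> nat \<Rightarrow> 'p::prime_card padic"
  assumes T: "approx_family T" and n: "n > 0" and C: "C \<ge> 0"
    and lip: "\<And>x y. padic_norm x = 1 \<Longrightarrow> padic_norm y = 1 \<Longrightarrow> padic_norm (x - y) \<le> 1 / real CARD('p) ^ n \<Longrightarrow>
       padic_norm (f x - f y) \<le> C / real CARD('p) ^ n"
    and bd: "\<And>x. padic_norm x = 1 \<Longrightarrow> padic_norm (f x) \<le> C"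
  shows "padic_norm (riemann_sum T f (Suc n) - riemann_sum T f n) \<le> C / real CARD('p) ^ n"
proof -
  let ?U = "unit_residues CARD('p)" and ?q = "CARD('p) ^ n"
  let ?F = "\<lambda>a. \<Sum>b\<in>{b \<in> ?U (Suc n). b mod ?q = a}. T (Suc n) b"
  have "riemann_sum T f (Suc n) - riemann_sum T f n
      = (\<Sum>b\<in>?U (Suc n). (f (of_nat b) - f (of_nat (b mod ?q))) * T (Suc n) b)
        + ((\<Sum>b\<in>?U (Suc n). f (of_nat (b mod ?q)) * T (Suc n) b) - riemann_sum T f n)"
    by (simp add: riemann_sum_def algebra_simps sum_subtractf)
  also have "(\<Sum>b\<in>?U (Suc n). f (of_nat (b mod ?q)) * T (Suc n) b) = (\<Sum>a\<in>?U n. f (of_nat a) * ?F a)"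
    by (rule sum_fibres[OF prime_card, symmetric]) simp
  also have "\<dots> - riemann_sum T f n = (\<Sum>a\<in>?U n. f (of_nat a) * (?F a - T n a))"
    by (simp add: riemann_sum_def algebra_simps sum_subtractf)
  also have "padic_norm ((\<Sum>b\<in>?U (Suc n). (f (of_nat b) - f (of_nat (b mod ?q))) * T (Suc n) b) + \<dots>) \<le> C / real ?q"
  proof (intro padic_norm_add_le padic_norm_sum_le)
    show "0 \<le> C / real ?q" "0 \<le> C / real ?q" using C by simp_all
    fix b assume b: "b \<in> ?U (Suc n)"
    have "b mod ?q \<in> ?U n" using b by (rule unit_residues_mod[OF prime_card]) simp
    hence "padic_norm (f (of_nat b) - f (of_nat (b mod ?q))) \<le> C / real CARD('p) ^ n"
      by (intro lip padic_norm_unit_residue[OF b] padic_norm_unit_residue[OF _ n] padic_norm_mod_card_pow) auto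
    hence "padic_norm ((f (of_nat b) - f (of_nat (b mod ?q))) * T (Suc n) b) \<le> C / real CARD('p) ^ n * 1"
      unfolding padic_norm_mult using T C by (intro mult_mono) (auto simp: approx_family_def)
    thus "padic_norm ((f (of_nat b) - f (of_nat (b mod ?q))) * T (Suc n) b) \<le> C / real ?q" by simp
  next
    fix a assume a: "a \<in> ?U n"
    have "padic_norm (f (of_nat a) * (?F a - T n a)) \<le> C * (1 / real CARD('p) ^ n)"
      unfolding padic_norm_mult using T a C
      by (intro mult_mono bd padic_norm_unit_residue[OF a n]) (auto simp: approx_family_def)
    thus "padic_norm (f (of_nat a) * (?F a - T n a)) \<le> C / real ?q" by simp
  qed
  finally show ?thesis by simp
qed

lemma convergent_of_steps:
  fixes X :: "nat \<Rightarrow> 'p::prime_card padic"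
  assumes "\<And>n. n \<ge> N \<Longrightarrow> padic_norm (X (Suc n) - X n) \<le> C / real CARD('p) ^ n"
  shows "convergent X"
proof -
  have "(\<lambda>n. X (Suc n) - X n) \<longlonglongrightarrow> 0"
    by (rule padic_tendsto_le[OF _ inverse_card_pow_tendsto_0[of C, where 'p = 'p]]) (use assms in auto)
  then obtain l where l: "(\<lambda>n. X (Suc n) - X n) sums l" using padic_summable by (auto simp: summable_def)
  hence "(\<lambda>n. X 0 + (\<Sum>k<n. X (Suc k) - X k)) \<longlonglongrightarrow> X 0 + l"
    unfolding sums_def by (intro tendsto_intros)
  thus ?thesis by (simp add: sum_lessThan_telescope convergentI)
qed

lemma riemann_sum_convergent:
  assumes T: "approx_family (T :: nat \<Rightarrow> nat \<Rightarrow> 'p::prime_card padic)" and f: "unit_lipschitz f"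
  shows "convergent (riemann_sum T f)"
proof -
  from f obtain C where C: "C \<ge> 0" "\<And>x y. padic_norm x = 1 \<Longrightarrow> padic_norm y = 1 \<Longrightarrow> padic_norm (f x - f y) \<le> C * padic_norm (x - y)"
    "\<And>x. padic_norm x = 1 \<Longrightarrow> padic_norm (f x) \<le> C"
    by (rule unit_lipschitzE) blast
  show ?thesis
  proof (rule convergent_of_steps[of 1 _ C])
    fix n :: nat assume n: "n \<ge> 1"
    show "padic_norm (riemann_sum T f (Suc n) - riemann_sum T f n) \<le> C / real CARD('p) ^ n"
    proof (rule riemann_sum_step[OF T _ C(1)])
      fix x y :: "'p padic"
      assume xy: "padic_norm x = 1" "padic_norm y = 1" "padic_norm (x - y) \<le> 1 / real CARD('p) ^ n"
      have "C * padic_norm (x - y) \<le> C * (1 / real CARD('p) ^ n)" by (intro mult_left_mono xy C)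
      thus "padic_norm (f x - f y) \<le> C / real CARD('p) ^ n" using C(2)[OF xy(1,2)] by simp
    qed (use C n in auto)
  qed
qed

lemma iwasawa_coeff_compatible: "compatible_family (iwasawa_coeff \<mu>)"
  using iwasawa_coeff[of \<mu>] by simp

lemma iwasawa_integral_LIMSEQ:
  assumes "unit_lipschitz f"
  shows "riemann_sum (iwasawa_coeff \<mu>) f \<longlonglongrightarrow> iwasawa_integral \<mu> f"
  using riemann_sum_convergent[OF compatible_imp_approx_family[OF iwasawa_coeff_compatible] assms, of \<mu>]
  unfolding iwasawa_integral_def riemann_sum_def by (simp add: convergent_LIMSEQ_iff)

text \<open>The measure of a disc is the limit of the masses that finer and finer levels give to it.
  Compatibility becomes exact in the limit, and at positive level the limit differs from
  \<open>T n\<close> by at most \<open>p^-n\<close> at every residue, too little to change limits of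
  Riemann sums.\<close>

lemma measure_of_approx_family:
  fixes T :: "nat \<Rightarrow> nat \<Rightarrow> 'p::prime_card padic"
  assumes T: "approx_family T"
  obtains \<mu> where "\<And>f. unit_lipschitz f \<Longrightarrow> riemann_sum T f \<longlonglongrightarrow> iwasawa_integral \<mu> f"
proof -
  let ?U = "unit_residues CARD('p)" and ?q = "\<lambda>n. CARD('p) ^ n"
  define G where "G = (\<lambda>n b N. \<Sum>a\<in>{a \<in> ?U N. a mod ?q n = b}. T N a)"
  define m where "m = (\<lambda>n b. if b \<in> ?U n then lim (G n b) else 0)"
  have G_riemann: "G n b = riemann_sum T (disc_ind n (of_nat b))" if "b \<in> ?U n" for n b
  proof
    fix N
    have "riemann_sum T (disc_ind n (of_nat b)) N = (\<Sum>a\<in>?U N. if a mod ?q n = b then T N a else 0)"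
      unfolding riemann_sum_def by (intro sum.cong refl) (simp add: disc_ind_of_nat[OF that])
    thus "G n b N = riemann_sum T (disc_ind n (of_nat b)) N"
      by (simp add: G_def sum.inter_filter)
  qed
  have G_lim: "G n b \<longlonglongrightarrow> m n b" if b: "b \<in> ?U n" for n b
  proof -
    have "convergent (G n b)"
      unfolding G_riemann[OF b] by (rule riemann_sum_convergent[OF T]) (rule lipschitz_intros)
    thus ?thesis using b by (simp add: m_def convergent_LIMSEQ_iff)
  qed
  have T1: "padic_norm (T n a) \<le> 1" for n a using T by (simp add: approx_family_def)
  have m_T: "padic_norm (m n b - T n b) \<le> 1 / real CARD('p) ^ n" if b: "b \<in> ?U n" and n: "n > 0" for n b
  proof -
    \<comment> \<open>Passing from level \<open>N\<close> to the next changes the mass of the disc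
      by at most \<open>p^-N \<le> p^-n\<close>, and ultrametrically these changes do not add
      up.\<close>
    have GN: "padic_norm (G n b N - T n b) \<le> 1 / real CARD('p) ^ n" if "N \<ge> n" for N
      using that
    proof (induction N rule: dec_induct)
      case base
      have "{a \<in> ?U n. a mod ?q n = b} = {b}" using b by (auto simp: unit_residues_def)
      thus ?case by (simp add: G_def)
    next
      case (step N)
      have "padic_norm (G n b (Suc N) - G n b N) \<le> 1 / real CARD('p) ^ N"
        unfolding G_riemann[OF b]
      proof (rule riemann_sum_step[OF T])
        fix x y :: "'p padic" assume xy: "padic_norm (x - y) \<le> 1 / real CARD('p) ^ N"
        have "1 / real CARD('p) ^ N \<le> 1 / real CARD('p) ^ n"
          using step(1) by (intro divide_left_mono power_increasing) auto
        hence xy: "padic_norm (x - y) \<le> 1 / real CARD('p) ^ n" using xy by linarith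
        have "padic_norm (x - of_nat b) \<le> 1 / real CARD('p) ^ n \<longleftrightarrow> padic_norm (y - of_nat b) \<le> 1 / real CARD('p) ^ n"
          using padic_norm_add_le[OF xy, of "y - of_nat b"] padic_norm_diff_le[OF _ xy, of "x - of_nat b"] by auto
        thus "padic_norm (disc_ind n (of_nat b) x - disc_ind n (of_nat b) y) \<le> 1 / real CARD('p) ^ N"
          by (simp add: disc_ind_def)
      qed (use n step(1) in \<open>auto simp: disc_ind_def\<close>)
      also have "1 / real CARD('p) ^ N \<le> 1 / real CARD('p) ^ n"
        using step(1) by (intro divide_left_mono power_increasing) auto
      finally have "padic_norm ((G n b (Suc N) - G n b N) + (G n b N - T n b)) \<le> 1 / real CARD('p) ^ n"
        by (rule padic_norm_add_le[OF _ step.IH])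
      thus ?case by simp
    qed
    have "(\<lambda>N. G n b N - T n b) \<longlonglongrightarrow> m n b - T n b"
      unfolding diff_conv_add_uminus by (intro tendsto_add tendsto_const G_lim b)
    thus ?thesis by (rule padic_norm_limit_le) (rule GN)
  qed
  have m1: "padic_norm (m n b) \<le> 1" for n b
  proof (cases "b \<in> ?U n")
    case True
    show ?thesis
      by (rule padic_norm_limit_le[OF G_lim[OF True], of 0]) (auto simp: G_def T1 intro!: padic_norm_sum_le)
  qed (simp add: m_def)
  have compat: "compatible_family m"
  proof (rule compatible_familyI)
    show "m n a = 0" if "a \<notin> ?U n" for n a using that by (simp add: m_def)
    fix n a assume a: "a \<in> ?U n"
    let ?B = "{b \<in> ?U (Suc n). b mod ?q n = a}"
    have "(\<lambda>N. \<Sum>b\<in>?B. G (Suc n) b N) \<longlonglongrightarrow> (\<Sum>b\<in>?B. m (Suc n) b)"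
      by (intro tendsto_sum G_lim) auto
    moreover have "(\<Sum>b\<in>?B. G (Suc n) b N) = G n a N" if N: "N \<ge> Suc n" for N
    proof -
      have mm: "c mod ?q (Suc n) mod ?q n = c mod ?q n" for c
        by (rule mod_mod_cancel) (simp add: le_imp_power_dvd)
      have "(\<Sum>b\<in>?B. G (Suc n) b N) = (\<Sum>b\<in>?B. \<Sum>c\<in>{c \<in> {c \<in> ?U N. c mod ?q n = a}. c mod ?q (Suc n) = b}. T N c)"
        unfolding G_def by (intro sum.cong refl) (auto simp: mm simp del: power_Suc)
      also have "\<dots> = (\<Sum>c\<in>{c \<in> ?U N. c mod ?q n = a}. T N c)"
        by (rule sum.group) (use unit_residues_mod[OF prime_card _ N] in \<open>auto simp: mm simp del: power_Suc\<close>)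
      finally show ?thesis by (simp add: G_def)
    qed
    hence "\<forall>\<^sub>F N in sequentially. (\<Sum>b\<in>?B. G (Suc n) b N) = G n a N"
      unfolding eventually_sequentially by blast
    ultimately have "G n a \<longlonglongrightarrow> (\<Sum>b\<in>?B. m (Suc n) b)" by (rule Lim_transform_eventually)
    thus "m n a = (\<Sum>b\<in>?B. m (Suc n) b)" using G_lim[OF a] LIMSEQ_unique by blast
  qed (rule m1)
  define \<mu> where "\<mu> = Abs_iwasawa m"
  have co: "iwasawa_coeff \<mu> = m" unfolding \<mu>_def using compat by (simp add: Abs_iwasawa_inverse)
  have "riemann_sum T f \<longlonglongrightarrow> iwasawa_integral \<mu> f" if f: "unit_lipschitz f" for f
  proof -
    from f obtain C where C: "C \<ge> 0" "\<And>x. padic_norm x = 1 \<Longrightarrow> padic_norm (f x) \<le> C"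
      by (rule unit_lipschitzE) blast
    have "(\<lambda>n. riemann_sum T f n - riemann_sum m f n) \<longlonglongrightarrow> 0"
    proof (rule padic_tendsto_le[OF _ inverse_card_pow_tendsto_0[of C, where 'p = 'p]])
      fix n :: nat assume n: "n \<ge> 1"
      have "riemann_sum T f n - riemann_sum m f n = - (\<Sum>a\<in>?U n. f (of_nat a) * (m n a - T n a))"
        by (simp add: riemann_sum_def algebra_simps sum_subtractf)
      also have "padic_norm \<dots> \<le> C * (1 / real CARD('p) ^ n)"
        unfolding padic_norm_minus
      proof (rule padic_norm_sum_le)
        fix a assume a: "a \<in> ?U n"
        show "padic_norm (f (of_nat a) * (m n a - T n a)) \<le> C * (1 / real CARD('p) ^ n)"
          unfolding padic_norm_mult using n a
          by (intro mult_mono C m_T padic_norm_unit_residue[OF a]) auto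
      qed (use C in simp)
      finally show "padic_norm (riemann_sum T f n - riemann_sum m f n - 0) \<le> C / real CARD('p) ^ n" by simp
    qed
    from tendsto_add[OF this iwasawa_integral_LIMSEQ[OF f, of \<mu>]] show ?thesis by (simp add: co)
  qed
  thus ?thesis by (rule that)
qed


subsection \<open>Properties of the integral\<close>

lemma iwasawa_integral_eqI:
  "unit_lipschitz f \<Longrightarrow> riemann_sum (iwasawa_coeff \<mu>) f \<longlonglongrightarrow> l \<Longrightarrow> iwasawa_integral \<mu> f = l"
  using iwasawa_integral_LIMSEQ LIMSEQ_unique by blast

lemma iwasawa_integral_add:
  assumes "unit_lipschitz f" "unit_lipschitz g"
  shows "iwasawa_integral \<mu> (\<lambda>x. f x + g x) = iwasawa_integral \<mu> f + iwasawa_integral \<mu> g"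
proof (rule iwasawa_integral_eqI)
  show "unit_lipschitz (\<lambda>x. f x + g x)" by (intro lipschitz_intros assms)
  have "riemann_sum (iwasawa_coeff \<mu>) (\<lambda>x. f x + g x)
      = (\<lambda>n. riemann_sum (iwasawa_coeff \<mu>) f n + riemann_sum (iwasawa_coeff \<mu>) g n)"
    by (simp add: riemann_sum_def fun_eq_iff distrib_right sum.distrib)
  thus "riemann_sum (iwasawa_coeff \<mu>) (\<lambda>x. f x + g x) \<longlonglongrightarrow> iwasawa_integral \<mu> f + iwasawa_integral \<mu> g"
    using assms by (auto intro!: tendsto_add iwasawa_integral_LIMSEQ)
qed

lemma iwasawa_integral_cmult:
  assumes "unit_lipschitz f"
  shows "iwasawa_integral \<mu> (\<lambda>x. c * f x) = c * iwasawa_integral \<mu> f"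
proof (rule iwasawa_integral_eqI)
  show "unit_lipschitz (\<lambda>x. c * f x)" by (intro lipschitz_intros assms)
  have "riemann_sum (iwasawa_coeff \<mu>) (\<lambda>x. c * f x) = (\<lambda>n. c * riemann_sum (iwasawa_coeff \<mu>) f n)"
    by (simp add: riemann_sum_def fun_eq_iff sum_distrib_left mult.assoc)
  thus "riemann_sum (iwasawa_coeff \<mu>) (\<lambda>x. c * f x) \<longlonglongrightarrow> c * iwasawa_integral \<mu> f"
    using assms by (auto intro!: tendsto_mult_left iwasawa_integral_LIMSEQ)
qed

lemma iwasawa_integral_diff:
  assumes "unit_lipschitz f" "unit_lipschitz g"
  shows "iwasawa_integral \<mu> (\<lambda>x. f x - g x) = iwasawa_integral \<mu> f - iwasawa_integral \<mu> g"
  using iwasawa_integral_add[OF assms(1) unit_lipschitz_minus[OF assms(2)], of \<mu>]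
    iwasawa_integral_cmult[OF assms(2), of \<mu> "-1"] by simp

lemma iwasawa_integral_0: "iwasawa_integral \<mu> (\<lambda>_. 0) = 0"
  using iwasawa_integral_cmult[OF unit_lipschitz_const[of 0], of \<mu> 0] by simp

lemma iwasawa_integral_sum:
  assumes "\<And>i. i \<in> A \<Longrightarrow> unit_lipschitz (f i)"
  shows "iwasawa_integral \<mu> (\<lambda>x. \<Sum>i\<in>A. f i x) = (\<Sum>i\<in>A. iwasawa_integral \<mu> (f i))"
  using assms
  by (induction A rule: infinite_finite_induct)
     (simp_all add: iwasawa_integral_0 iwasawa_integral_add unit_lipschitz_sum)

lemma iwasawa_integral_norm_le:
  fixes f :: "'p::prime_card padic \<Rightarrow> 'p padic"
  assumes f: "unit_lipschitz f" and r: "r \<ge> 0" and le: "\<And>x. padic_norm x = 1 \<Longrightarrow> padic_norm (f x) \<le> r"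
  shows "padic_norm (iwasawa_integral \<mu> f) \<le> r"
proof (rule padic_norm_limit_le[OF iwasawa_integral_LIMSEQ[OF f]])
  fix n :: nat assume n: "n \<ge> 1"
  have "padic_norm (f (of_nat a) * iwasawa_coeff \<mu> n a) \<le> r * 1" if "a \<in> unit_residues CARD('p) n" for a
    unfolding padic_norm_mult
    using compatible_familyD(1)[OF iwasawa_coeff_compatible] n r
    by (intro mult_mono le padic_norm_unit_residue[OF that]) auto
  thus "padic_norm (riemann_sum (iwasawa_coeff \<mu>) f n) \<le> r"
    unfolding riemann_sum_def using r by (intro padic_norm_sum_le) auto
qed

lemma iwasawa_integral_diff_le:
  assumes "unit_lipschitz f" "unit_lipschitz g" "r \<ge> 0"
    "\<And>x. padic_norm x = 1 \<Longrightarrow> padic_norm (f x - g x) \<le> r"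
  shows "padic_norm (iwasawa_integral \<mu> f - iwasawa_integral \<mu> g) \<le> r"
  using iwasawa_integral_norm_le[of "\<lambda>x. f x - g x" r \<mu>] assms
  by (simp add: iwasawa_integral_diff unit_lipschitz_diff)

lemma iwasawa_integral_cong:
  assumes "unit_lipschitz f" "unit_lipschitz g" "\<And>x. padic_norm x = 1 \<Longrightarrow> f x = g x"
  shows "iwasawa_integral \<mu> f = iwasawa_integral \<mu> g"
proof -
  have "padic_norm (iwasawa_integral \<mu> f - iwasawa_integral \<mu> g) \<le> 0"
    by (rule iwasawa_integral_diff_le) (use assms in auto)
  hence "padic_norm (iwasawa_integral \<mu> f - iwasawa_integral \<mu> g) = 0"
    using padic_norm_nonneg by (rule antisym)
  thus ?thesis by simp
qed

lemma iwasawa_integral_minus_measure: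
  assumes "unit_lipschitz f"
  shows "iwasawa_integral (\<mu> - \<nu>) f = iwasawa_integral \<mu> f - iwasawa_integral \<nu> f"
proof (rule iwasawa_integral_eqI[OF assms])
  have "riemann_sum (iwasawa_coeff (\<mu> - \<nu>)) f
      = (\<lambda>n. riemann_sum (iwasawa_coeff \<mu>) f n + - riemann_sum (iwasawa_coeff \<nu>) f n)"
    by (simp add: riemann_sum_def fun_eq_iff minus_iwasawa.rep_eq right_diff_distrib sum_subtractf)
  thus "riemann_sum (iwasawa_coeff (\<mu> - \<nu>)) f \<longlonglongrightarrow> iwasawa_integral \<mu> f - iwasawa_integral \<nu> f"
    unfolding diff_conv_add_uminus[of "iwasawa_integral \<mu> f"]
    by (simp only:) (intro tendsto_add tendsto_minus iwasawa_integral_LIMSEQ assms)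
qed

section \<open>Characters, Dirac measures and convolution\<close>

definition unit_character :: "('p::prime_card padic \<Rightarrow> 'p padic) \<Rightarrow> bool" where
  "unit_character \<kappa> \<longleftrightarrow> unit_lipschitz \<kappa> \<and> \<kappa> 1 = 1 \<and>
     (\<forall>x y. padic_norm x = 1 \<longrightarrow> padic_norm y = 1 \<longrightarrow> \<kappa> (x * y) = \<kappa> x * \<kappa> y)"

lemma unit_characterD:
  assumes "unit_character \<kappa>"
  shows "unit_lipschitz \<kappa>" "\<kappa> 1 = 1"
    "padic_norm x = 1 \<Longrightarrow> padic_norm y = 1 \<Longrightarrow> \<kappa> (x * y) = \<kappa> x * \<kappa> y"
  using assms unfolding unit_character_def by blast+

lemma unit_character_power: "unit_character (\<lambda>x. x ^ k)"
  by (simp add: unit_character_def power_mult_distrib lipschitz_intros)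

lemma iwasawa_integral_one:
  fixes \<kappa> :: "'p::prime_card padic \<Rightarrow> 'p padic"
  assumes "unit_character \<kappa>"
  shows "iwasawa_integral 1 \<kappa> = 1"
proof (rule iwasawa_integral_eqI[OF unit_characterD(1)[OF assms]])
  have "riemann_sum (iwasawa_coeff 1) \<kappa> n = 1" if n: "n \<ge> 1" for n
  proof -
    have "1 < CARD('p) ^ n" using n by (intro one_less_power) (auto simp: card_gt_1[unfolded One_nat_def[symmetric]])
    hence m: "1 mod CARD('p) ^ n = 1" using n by simp
    have "riemann_sum (iwasawa_coeff 1) \<kappa> n = (\<Sum>a\<in>unit_residues CARD('p) n. if a = 1 then \<kappa> 1 else 0)"
      unfolding riemann_sum_def one_iwasawa.rep_eq m by (intro sum.cong refl) auto
    also have "\<dots> = 1" using unit_residues_one_mod[OF prime_card[where 'a = 'p], of n]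
      by (simp add: m unit_characterD(2)[OF assms] del: One_nat_def)
    finally show ?thesis .
  qed
  thus "riemann_sum (iwasawa_coeff 1) \<kappa> \<longlonglongrightarrow> 1"
    by (intro tendsto_eventually) (auto simp: eventually_sequentially)
qed

lemma iwasawa_integral_dirac:
  fixes f :: "'p::prime_card padic \<Rightarrow> 'p padic"
  assumes f: "unit_lipschitz f" and g: "padic_norm g = 1"
  shows "iwasawa_integral (dirac g) f = f g"
proof (rule iwasawa_integral_eqI[OF f])
  from f obtain C where C: "C \<ge> 0" "\<And>x y. padic_norm x = 1 \<Longrightarrow> padic_norm y = 1 \<Longrightarrow> padic_norm (f x - f y) \<le> C * padic_norm (x - y)"
    by (rule unit_lipschitzE) blast
  show "riemann_sum (iwasawa_coeff (dirac g)) f \<longlonglongrightarrow> f g"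
  proof (rule padic_tendsto_le[OF _ inverse_card_pow_tendsto_0[of C, where 'p = 'p]])
    fix n :: nat assume n: "n \<ge> 1"
    let ?a = "unit_residue n g"
    note a = unit_residue[OF g, of n]
    have co: "iwasawa_coeff (dirac g) n c = (if c = ?a then 1 else 0)" if "c \<in> unit_residues CARD('p) n" for c
    proof -
      have "padic_norm (g - of_nat c) \<le> 1 / real CARD('p) ^ n \<longleftrightarrow> c = ?a"
        using a(2) unit_residue_eqI[OF g that] by blast
      thus ?thesis using that g by (simp only: dirac.rep_eq padic_units_norm) simp
    qed
    have "riemann_sum (iwasawa_coeff (dirac g)) f n
        = (\<Sum>c\<in>unit_residues CARD('p) n. if c = ?a then f (of_nat ?a) else 0)"
      unfolding riemann_sum_def by (intro sum.cong refl) (simp add: co)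
    also have "\<dots> = f (of_nat ?a)" using a by simp
    finally have "padic_norm (riemann_sum (iwasawa_coeff (dirac g)) f n - f g) = padic_norm (f g - f (of_nat ?a))"
      by (simp add: padic_norm_minus_commute)
    also have "\<dots> \<le> C * padic_norm (g - of_nat ?a)"
      using n by (intro C g padic_norm_unit_residue[OF a(1)]) auto
    also have "\<dots> \<le> C * (1 / real CARD('p) ^ n)" by (intro mult_left_mono a C)
    finally show "padic_norm (riemann_sum (iwasawa_coeff (dirac g)) f n - f g) \<le> C / real CARD('p) ^ n" by simp
  qed
qed

text \<open>At level \<open>n\<close> the convolution pairs with
  \<open>\<kappa>(a b mod p^n)\<close>, which differs from \<open>\<kappa>(a) \<kappa>(b)\<close> by
  at most a constant times \<open>p^-n\<close>.\<close>

lemma iwasawa_integral_mult: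
  fixes \<kappa> :: "'p::prime_card padic \<Rightarrow> 'p padic"
  assumes \<kappa>: "unit_character \<kappa>"
  shows "iwasawa_integral (\<mu> * \<nu>) \<kappa> = iwasawa_integral \<mu> \<kappa> * iwasawa_integral \<nu> \<kappa>"
proof (rule iwasawa_integral_eqI[OF unit_characterD(1)[OF \<kappa>]])
  let ?U = "unit_residues CARD('p)" and ?R = "\<lambda>\<mu>. riemann_sum (iwasawa_coeff \<mu>) \<kappa>"
  from unit_characterD(1)[OF \<kappa>] obtain C where C: "C \<ge> 0" "\<And>x y. padic_norm x = 1 \<Longrightarrow> padic_norm y = 1 \<Longrightarrow> padic_norm (\<kappa> x - \<kappa> y) \<le> C * padic_norm (x - y)"
    by (rule unit_lipschitzE) blast
  have "(\<lambda>n. ?R (\<mu> * \<nu>) n - ?R \<mu> n * ?R \<nu> n) \<longlonglongrightarrow> 0"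
  proof (rule padic_tendsto_le[OF _ inverse_card_pow_tendsto_0[of C, where 'p = 'p]])
    fix n :: nat assume n: "n \<ge> 1"
    let ?q = "CARD('p) ^ n" and ?m = "iwasawa_coeff \<mu> n" and ?n = "iwasawa_coeff \<nu> n"
    have "?R (\<mu> * \<nu>) n = (\<Sum>c\<in>?U n. unit_conv CARD('p) (iwasawa_coeff \<mu>) (iwasawa_coeff \<nu>) n c * \<kappa> (of_nat c))"
      by (simp add: riemann_sum_def times_iwasawa.rep_eq mult.commute)
    also have "\<dots> = (\<Sum>a\<in>?U n. \<Sum>b\<in>?U n. ?m a * ?n b * \<kappa> (of_nat (a * b mod ?q)))"
      by (rule unit_conv_pairing[OF prime_card])
    finally have 1: "?R (\<mu> * \<nu>) n = (\<Sum>a\<in>?U n. \<Sum>b\<in>?U n. ?m a * ?n b * \<kappa> (of_nat (a * b mod ?q)))" .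
    have 2: "?R \<mu> n * ?R \<nu> n = (\<Sum>a\<in>?U n. \<Sum>b\<in>?U n. ?m a * ?n b * (\<kappa> (of_nat a) * \<kappa> (of_nat b)))"
      unfolding riemann_sum_def sum_product by (intro sum.cong refl) (simp add: mult_ac)
    have "?R (\<mu> * \<nu>) n - ?R \<mu> n * ?R \<nu> n
        = (\<Sum>a\<in>?U n. \<Sum>b\<in>?U n. ?m a * ?n b * (\<kappa> (of_nat (a * b mod ?q)) - \<kappa> (of_nat a) * \<kappa> (of_nat b)))"
      unfolding 1 2 by (simp add: right_diff_distrib flip: sum_subtractf)
    also have "padic_norm \<dots> \<le> C / real CARD('p) ^ n"
    proof (intro padic_norm_sum_le)
      fix a b assume a: "a \<in> ?U n" and b: "b \<in> ?U n"
      note ab = padic_norm_unit_residue[OF a] padic_norm_unit_residue[OF b]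
        padic_norm_unit_residue[OF unit_residues_mult_mod[OF prime_card a b]]
      have "\<kappa> (of_nat a) * \<kappa> (of_nat b) = \<kappa> (of_nat (a * b))"
        using unit_characterD(3)[OF \<kappa> ab(1,2)] n by simp
      hence "padic_norm (\<kappa> (of_nat (a * b mod ?q)) - \<kappa> (of_nat a) * \<kappa> (of_nat b))
          = padic_norm (\<kappa> (of_nat (a * b)) - \<kappa> (of_nat (a * b mod ?q)))"
        by (simp add: padic_norm_minus_commute)
      also have "\<dots> \<le> C * padic_norm (of_nat (a * b) - of_nat (a * b mod ?q) :: 'p padic)"
        using n ab by (intro C) (auto simp: padic_norm_mult)
      also have "\<dots> \<le> C * (1 / real CARD('p) ^ n)" by (intro mult_left_mono padic_norm_mod_card_pow C)
      finally have "padic_norm (?m a * ?n b * (\<kappa> (of_nat (a * b mod ?q)) - \<kappa> (of_nat a) * \<kappa> (of_nat b)))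
          \<le> 1 * 1 * (C * (1 / real CARD('p) ^ n))"
        unfolding padic_norm_mult using C(1)
        by (intro mult_mono compatible_familyD(1)[OF iwasawa_coeff_compatible]) auto
      thus "padic_norm (?m a * ?n b * (\<kappa> (of_nat (a * b mod ?q)) - \<kappa> (of_nat a) * \<kappa> (of_nat b)))
          \<le> C / real CARD('p) ^ n" by simp
    qed (use C in auto)
    finally show "padic_norm (?R (\<mu> * \<nu>) n - ?R \<mu> n * ?R \<nu> n - 0) \<le> C / real CARD('p) ^ n" by simp
  qed
  moreover have "(\<lambda>n. ?R \<mu> n * ?R \<nu> n) \<longlonglongrightarrow> iwasawa_integral \<mu> \<kappa> * iwasawa_integral \<nu> \<kappa>"
    by (intro tendsto_mult iwasawa_integral_LIMSEQ unit_characterD(1)[OF \<kappa>])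
  ultimately have "(\<lambda>n. (?R (\<mu> * \<nu>) n - ?R \<mu> n * ?R \<nu> n) + ?R \<mu> n * ?R \<nu> n)
      \<longlonglongrightarrow> 0 + iwasawa_integral \<mu> \<kappa> * iwasawa_integral \<nu> \<kappa>"
    by (rule tendsto_add)
  thus "?R (\<mu> * \<nu>) \<longlonglongrightarrow> iwasawa_integral \<mu> \<kappa> * iwasawa_integral \<nu> \<kappa>" by simp
qed

lemma iwasawa_integral_dirac_minus_1_mult:
  assumes "unit_character \<kappa>" "padic_norm g = 1"
  shows "iwasawa_integral ((dirac g - 1) * \<mu>) \<kappa> = (\<kappa> g - 1) * iwasawa_integral \<mu> \<kappa>"
  using assms by (simp add: iwasawa_integral_mult iwasawa_integral_minus_measure unit_characterD
      iwasawa_integral_dirac iwasawa_integral_one)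


subsection \<open>A measure is determined by its moments\<close>

lemma principal_unit_power_close:
  assumes "padic_norm (u - 1 :: 'p::prime_card padic) \<le> 1 / real CARD('p)"
  shows "padic_norm (u ^ (CARD('p) ^ m) - 1) \<le> 1 / real CARD('p) ^ Suc m"
proof (induction m)
  case (Suc m)
  let ?v = "u ^ (CARD('p) ^ m)"
  have "1 / real CARD('p) ^ Suc m \<le> 1 / real CARD('p)" by (simp add: field_simps)
  hence v: "padic_norm (?v - 1) \<le> 1 / real CARD('p)" using Suc by linarith
  have "padic_norm (?v - 1) \<le> 1" using v inverse_card_le_1(1)[where 'p = 'p] by linarith
  hence "padic_norm ((?v - 1) + 1) \<le> 1" by (rule padic_norm_add_le) simp
  hence "padic_norm (?v ^ CARD('p) - 1 ^ CARD('p)) \<le> padic_norm (?v - 1) / real CARD('p)"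
    by (intro padic_norm_card_power_diff_le v) auto
  also have "\<dots> \<le> (1 / real CARD('p) ^ Suc m) / real CARD('p)" by (intro divide_right_mono Suc) simp
  finally show ?case by (simp add: mult.commute flip: power_mult)
qed (use assms in simp)

lemma padic_norm_power_card_minus_1:
  assumes "padic_norm (x :: 'p::prime_card padic) = 1"
  shows "padic_norm (x ^ (CARD('p) - 1) - 1) \<le> 1 / real CARD('p)"
proof -
  have "x ^ CARD('p) - x = x * (x ^ (CARD('p) - 1) - 1)"
    using power_Suc[of x "CARD('p) - 1"] by (simp add: algebra_simps)
  thus ?thesis using padic_Fermat[of x] assms by (simp add: padic_norm_mult)
qed

lemma unit_lipschitz_poly [lipschitz_intros]: "unit_lipschitz (poly q)"
proof -
  have "unit_lipschitz (\<lambda>x. \<Sum>i\<le>degree q. Polynomial.coeff q i * x ^ i)" by (intro lipschitz_intros)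
  thus ?thesis by (simp add: poly_altdef[abs_def])
qed

text \<open>
  With \<open>t = (x - b) / p\<^sup>n\<close>, the polynomials \<open>(1 - t\<^sup>p\<^sup>-\<^sup>1) ^ p\<^sup>m\<close> converge uniformly on the disc of radius
  \<open>p\<^sup>-\<^sup>n\<close> around \<open>b\<close> to the indicator function of the disc of radius \<open>p\<^sup>-\<^sup>n\<^sup>-\<^sup>1\<close>.
\<close>

lemma iwasawa_integral_disc_poly_eq_0:
  fixes \<nu> :: "'p::prime_card iwasawa"
  assumes mom: "\<And>k. k > 0 \<Longrightarrow> iwasawa_integral \<nu> (\<lambda>x. x ^ k) = 0" and b: "padic_norm b \<le> 1"
  shows "iwasawa_integral \<nu> (\<lambda>x. disc_ind n b x * poly q x) = 0"
proof (induction n arbitrary: q)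
  case 0
  \<comment> \<open>The zeroth moment is not among the hypotheses. It is recovered from the
    exponents \<open>(p - 1) p^m\<close>, whose powers tend to \<open>1\<close> uniformly on the
    units.\<close>
  have "padic_norm (iwasawa_integral \<nu> (\<lambda>x. x ^ 0)) \<le> 1 / real CARD('p) ^ m" for m
  proof -
    let ?k = "(CARD('p) - 1) * CARD('p) ^ m"
    have "padic_norm (iwasawa_integral \<nu> (\<lambda>x. x ^ 0) - iwasawa_integral \<nu> (\<lambda>x. x ^ ?k)) \<le> 1 / real CARD('p) ^ m"
    proof (rule iwasawa_integral_diff_le)
      fix x :: "'p padic" assume "padic_norm x = 1"
      from principal_unit_power_close[OF padic_norm_power_card_minus_1[OF this], of m]
      have "padic_norm (x ^ 0 - x ^ ?k) \<le> 1 / real CARD('p) ^ Suc m"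
        unfolding power_mult by (simp add: padic_norm_minus_commute)
      also have "\<dots> \<le> 1 / real CARD('p) ^ m" by (intro divide_left_mono) auto
      finally show "padic_norm (x ^ 0 - x ^ ?k) \<le> 1 / real CARD('p) ^ m" .
    qed (intro lipschitz_intros | simp)+
    moreover have "iwasawa_integral \<nu> (\<lambda>x. x ^ ?k) = 0" by (rule mom) simp
    ultimately show ?thesis by simp
  qed
  hence "iwasawa_integral \<nu> (\<lambda>x. x ^ 0) = 0" by (rule padic_eq_0I)
  hence mom': "iwasawa_integral \<nu> (\<lambda>x. x ^ k) = 0" for k using mom[of k] by (cases "k = 0") auto
  have "iwasawa_integral \<nu> (\<lambda>x. disc_ind 0 b x * poly q x) = iwasawa_integral \<nu> (\<lambda>x. \<Sum>i\<le>degree q. Polynomial.coeff q i * x ^ i)"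
  proof (rule iwasawa_integral_cong)
    fix x :: "'p padic" assume "padic_norm x = 1"
    hence "padic_norm (x - b) \<le> 1" using b by (intro padic_norm_diff_le) auto
    thus "disc_ind 0 b x * poly q x = (\<Sum>i\<le>degree q. Polynomial.coeff q i * x ^ i)" by (simp add: disc_ind_def poly_altdef)
  qed (intro lipschitz_intros)+
  also have "\<dots> = 0" by (simp add: iwasawa_integral_sum iwasawa_integral_cmult lipschitz_intros mom')
  finally show ?case .
next
  case (Suc n)
  let ?p = "CARD('p)"
  from unit_lipschitz_poly[of q] obtain C where C: "C \<ge> 0" "\<And>x. padic_norm x = 1 \<Longrightarrow> padic_norm (poly q x) \<le> C"
    by (rule unit_lipschitzE) blast
  define c :: "'p padic" where "c = inverse (of_nat (?p ^ n))"
  have c: "padic_norm c = real ?p ^ n"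
    by (simp add: c_def padic_norm_inverse padic_norm_power padic_norm_card power_one_over)
  define r where "r = Polynomial.smult c [:- b, 1:]"
  have r: "poly r x = c * (x - b)" for x by (simp add: r_def algebra_simps)
  have "padic_norm (iwasawa_integral \<nu> (\<lambda>x. disc_ind (Suc n) b x * poly q x)) \<le> C / real ?p ^ m" for m
  proof -
    \<comment> \<open>The product of \<open>q\<close> with the approximating polynomial is again a
      polynomial, so the induction hypothesis, stated for all \<open>q\<close>, applies to
      it.\<close>
    let ?Q = "q * (1 - r ^ (?p - 1)) ^ (?p ^ m)"
    have "padic_norm (iwasawa_integral \<nu> (\<lambda>x. disc_ind (Suc n) b x * poly q x)
        - iwasawa_integral \<nu> (\<lambda>x. disc_ind n b x * poly ?Q x)) \<le> C / real ?p ^ m"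
    proof (rule iwasawa_integral_diff_le)
      fix x :: "'p padic" assume x: "padic_norm x = 1"
      define t where "t = c * (x - b)"
      have t: "padic_norm t = real ?p ^ n * padic_norm (x - b)" by (simp add: t_def padic_norm_mult c)
      have "padic_norm (disc_ind (Suc n) b x - disc_ind n b x * (1 - t ^ (?p - 1)) ^ (?p ^ m)) \<le> 1 / real ?p ^ m"
      proof (cases "padic_norm (x - b) \<le> 1 / real ?p ^ n")
        case False
        have "1 / real ?p ^ Suc n \<le> 1 / real ?p ^ n" by (intro divide_left_mono) auto
        hence "\<not> padic_norm (x - b) \<le> 1 / real ?p ^ Suc n" using False by linarith
        thus ?thesis using False by (simp add: disc_ind_def del: power_Suc)
      next
        case True
        hence t1: "padic_norm t \<le> 1" unfolding t by (simp add: field_simps)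
        show ?thesis
        proof (cases "padic_norm t = 1")
          case unit: True
          hence "padic_norm (x - b) = 1 / real ?p ^ n" unfolding t by (simp add: field_simps)
          hence "\<not> padic_norm (x - b) \<le> 1 / real ?p ^ Suc n"
            by (simp add: field_simps not_le)
          hence "padic_norm (disc_ind (Suc n) b x - disc_ind n b x * (1 - t ^ (?p - 1)) ^ (?p ^ m))
              = padic_norm (1 - t ^ (?p - 1)) ^ (?p ^ m)"
            using True by (simp add: disc_ind_def padic_norm_power del: power_Suc)
          also have "\<dots> \<le> (1 / real ?p) ^ (?p ^ m)"
            using padic_norm_power_card_minus_1[OF unit] by (intro power_mono) (auto simp: padic_norm_minus_commute)
          also have "\<dots> \<le> (1 / real ?p) ^ m"
            by (intro power_decreasing less_imp_le[OF power_gt_expt]) auto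
          finally show ?thesis by (simp add: power_one_over)
        next
          case False
          hence "padic_norm t < 1" using t1 by simp
          hence tp: "padic_norm t \<le> 1 / real ?p" by (rule padic_norm_less_1)
          hence "padic_norm (x - b) \<le> 1 / real ?p ^ Suc n" unfolding t by (simp add: field_simps)
          hence "padic_norm (disc_ind (Suc n) b x - disc_ind n b x * (1 - t ^ (?p - 1)) ^ (?p ^ m))
              = padic_norm ((1 - t ^ (?p - 1)) ^ (?p ^ m) - 1)"
            using True by (simp add: disc_ind_def padic_norm_minus_commute del: power_Suc)
          also have "\<dots> \<le> 1 / real ?p ^ Suc m"
          proof (rule principal_unit_power_close)
            have "1 \<le> ?p - 1" using card_gt_1[where 'p = 'p] by linarith
            hence "padic_norm t ^ (?p - 1) \<le> padic_norm t ^ 1"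
              using t1 by (intro power_decreasing) simp_all
            thus "padic_norm (1 - t ^ (?p - 1) - 1) \<le> 1 / real ?p" using tp by (simp add: padic_norm_power)
          qed
          also have "\<dots> \<le> 1 / real ?p ^ m" by (intro divide_left_mono) auto
          finally show ?thesis .
        qed
      qed
      hence "padic_norm (poly q x * (disc_ind (Suc n) b x - disc_ind n b x * (1 - t ^ (?p - 1)) ^ (?p ^ m))) \<le> C * (1 / real ?p ^ m)"
        unfolding padic_norm_mult[of "poly q x"] using x C by (intro mult_mono) auto
      thus "padic_norm (disc_ind (Suc n) b x * poly q x - disc_ind n b x * poly ?Q x) \<le> C / real ?p ^ m"
        by (simp add: algebra_simps r t_def)
    qed (use C in \<open>(intro lipschitz_intros | simp)+\<close>)
    thus ?thesis using Suc.IH[of ?Q] by simp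
  qed
  thus ?case by (rule padic_eq_0I)
qed

lemma riemann_sum_disc_ind:
  fixes \<nu> :: "'p::prime_card iwasawa"
  assumes b: "b \<in> unit_residues CARD('p) n" and "N \<ge> n"
  shows "riemann_sum (iwasawa_coeff \<nu>) (disc_ind n (of_nat b)) N = iwasawa_coeff \<nu> n b"
  using assms(2)
proof (induction N rule: dec_induct)
  case base
  have "riemann_sum (iwasawa_coeff \<nu>) (disc_ind n (of_nat b)) n
      = (\<Sum>a\<in>unit_residues CARD('p) n. if a = b then iwasawa_coeff \<nu> n b else 0)"
    unfolding riemann_sum_def by (intro sum.cong refl) (auto simp: disc_ind_of_nat[OF b] unit_residues_def)
  thus ?case using b by simp
next
  case (step N)
  let ?U = "unit_residues CARD('p)" and ?q = "\<lambda>n. CARD('p) ^ n" and ?d = "\<lambda>a. disc_ind n (of_nat b) (of_nat a) :: 'p padic"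
  have "a mod ?q N mod ?q n = a mod ?q n" for a
    using step(1) by (intro mod_mod_cancel le_imp_power_dvd)
  hence d: "?d (a mod ?q N) = ?d a" for a by (simp add: disc_ind_of_nat[OF b])
  have "riemann_sum (iwasawa_coeff \<nu>) (disc_ind n (of_nat b)) (Suc N) = (\<Sum>a\<in>?U (Suc N). ?d (a mod ?q N) * iwasawa_coeff \<nu> (Suc N) a)"
    by (simp add: riemann_sum_def d)
  also have "\<dots> = (\<Sum>a\<in>?U N. ?d a * (\<Sum>c\<in>{c \<in> ?U (Suc N). c mod ?q N = a}. iwasawa_coeff \<nu> (Suc N) c))"
    by (rule sum_fibres[OF prime_card, symmetric]) simp
  also have "\<dots> = riemann_sum (iwasawa_coeff \<nu>) (disc_ind n (of_nat b)) N"
    unfolding riemann_sum_def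
    by (intro sum.cong refl) (simp flip: compatible_familyD(3)[OF iwasawa_coeff_compatible])
  finally show ?case using step.IH by simp
qed

text \<open>The coefficients of a measure are its integrals over indicators of discs, and these
  vanish for the difference by the polynomial approximation with \<open>q = 1\<close>.\<close>

lemma iwasawa_eqI_moments:
  fixes \<mu> \<nu> :: "'p::prime_card iwasawa"
  assumes "\<And>k. k > 0 \<Longrightarrow> iwasawa_integral \<mu> (\<lambda>x. x ^ k) = iwasawa_integral \<nu> (\<lambda>x. x ^ k)"
  shows "\<mu> = \<nu>"
proof -
  have mom: "iwasawa_integral (\<mu> - \<nu>) (\<lambda>x. x ^ k) = 0" if "k > 0" for k
    using assms[OF that] by (simp add: iwasawa_integral_minus_measure lipschitz_intros)
  have "iwasawa_coeff (\<mu> - \<nu>) n b = 0" for n b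
  proof (cases "b \<in> unit_residues CARD('p) n")
    case True
    have "riemann_sum (iwasawa_coeff (\<mu> - \<nu>)) (disc_ind n (of_nat b)) \<longlonglongrightarrow> iwasawa_coeff (\<mu> - \<nu>) n b"
      using riemann_sum_disc_ind[OF True, of _ "\<mu> - \<nu>"]
      by (intro tendsto_eventually) (auto simp: eventually_sequentially)
    hence "iwasawa_integral (\<mu> - \<nu>) (disc_ind n (of_nat b)) = iwasawa_coeff (\<mu> - \<nu>) n b"
      by (intro iwasawa_integral_eqI lipschitz_intros)
    thus ?thesis
      using iwasawa_integral_disc_poly_eq_0[OF mom padic_norm_of_nat_le_1, of n b 1] by simp
  next
    case False
    thus ?thesis by (rule compatible_familyD(2)[OF iwasawa_coeff_compatible])
  qed
  hence "iwasawa_coeff \<mu> = iwasawa_coeff \<nu>" by (simp add: minus_iwasawa.rep_eq fun_eq_iff)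
  thus ?thesis by (simp only: iwasawa_coeff_inject)
qed


subsection \<open>Pseudo-measures\<close>

lemma to_total_fract_eq_iff: "to_total_fract a = to_total_fract b \<longleftrightarrow> a = (b :: 'a::comm_ring_1)"
  by transfer (simp add: total_fract_rel_def)

lemma to_total_fract_mult: "to_total_fract (a * b :: 'a::comm_ring_1) = to_total_fract a * to_total_fract b"
  by transfer (simp add: total_fract_rel_def)

lemma to_total_fract_diff: "to_total_fract (a - b :: 'a::comm_ring_1) = to_total_fract a - to_total_fract b"
  by transfer (simp add: total_fract_rel_def)

lemma to_total_fract_1: "to_total_fract (1 :: 'a::comm_ring_1) = 1"
  by transfer (simp add: total_fract_rel_def)

lemma to_total_fract_invertible:
  assumes "regular_elem (d :: 'a::comm_ring_1)"
  shows "\<exists>e. e * to_total_fract d = 1"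
  using assms
proof (transfer, goal_cases)
  case (1 d)
  thus ?case by (intro bexI[of _ "(1, d)"]) (simp_all add: total_fract_rel_def Respects_def)
qed

text \<open>Names the measure \<open>([g] - 1) lam\<close> that is described implicitly inside
  \<open>pseudo_integral\<close>.\<close>

definition pseudo_measure_coeff ::
  "'p::prime_card iwasawa total_fract \<Rightarrow> 'p padic \<Rightarrow> 'p iwasawa" where
  "pseudo_measure_coeff lam g = (THE \<mu>. to_total_fract \<mu> = (to_total_fract (dirac g) - 1) * lam)"

lemma pseudo_measure_coeff_eqI:
  "to_total_fract \<mu> = (to_total_fract (dirac g) - 1) * lam \<Longrightarrow> pseudo_measure_coeff lam g = \<mu>"
  unfolding pseudo_measure_coeff_def by (rule the_equality) (assumption, metis to_total_fract_eq_iff)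

lemma to_total_fract_pseudo_measure_coeff:
  assumes "pseudo_measure lam" "padic_norm g = 1"
  shows "to_total_fract (pseudo_measure_coeff lam g) = (to_total_fract (dirac g) - 1) * lam"
proof -
  obtain \<mu> where \<mu>: "to_total_fract \<mu> = (to_total_fract (dirac g) - 1) * lam"
    using assms unfolding pseudo_measure_def by (force simp: padic_units_norm)
  thus ?thesis by (simp add: pseudo_measure_coeff_eqI)
qed

lemma pseudo_measure_coeff_swap:
  assumes "pseudo_measure lam" "padic_norm g = 1" "padic_norm h = 1"
  shows "(dirac h - 1) * pseudo_measure_coeff lam g = (dirac g - 1) * pseudo_measure_coeff lam h"
proof -
  have "to_total_fract ((dirac h - 1) * pseudo_measure_coeff lam g)
      = to_total_fract ((dirac g - 1) * pseudo_measure_coeff lam h)"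
    using assms
    by (simp add: to_total_fract_mult to_total_fract_diff to_total_fract_1 mult.left_commute
        to_total_fract_pseudo_measure_coeff)
  thus ?thesis by (simp only: to_total_fract_eq_iff)
qed

text \<open>Integrating \<open>pseudo_measure_coeff_swap\<close> against \<open>\<kappa>\<close>
  turns the Dirac factors into \<open>\<kappa> h - 1\<close> and \<open>\<kappa> g - 1\<close>; this
  is the independence of the auxiliary unit that the definite description demands.\<close>

lemma pseudo_integral_eq:
  fixes \<kappa> :: "'p::prime_card padic \<Rightarrow> 'p padic"
  assumes lam: "pseudo_measure lam" and \<kappa>: "unit_character \<kappa>" and g: "padic_norm g = 1" "\<kappa> g \<noteq> 1"
  shows "pseudo_integral lam \<kappa> = inverse (\<kappa> g - 1) * iwasawa_integral (pseudo_measure_coeff lam g) \<kappa>"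
  unfolding pseudo_integral_def pseudo_measure_coeff_def[symmetric]
proof (rule the_equality)
  show "\<forall>h\<in>padic_units. \<kappa> h \<noteq> 1 \<longrightarrow>
      inverse (\<kappa> g - 1) * iwasawa_integral (pseudo_measure_coeff lam g) \<kappa>
    = inverse (\<kappa> h - 1) * iwasawa_integral (pseudo_measure_coeff lam h) \<kappa>"
  proof (intro ballI impI)
    fix h :: "'p padic" assume "h \<in> padic_units" and h1: "\<kappa> h \<noteq> 1"
    hence h: "padic_norm h = 1" by (simp add: padic_units_norm)
    have "(\<kappa> h - 1) * iwasawa_integral (pseudo_measure_coeff lam g) \<kappa>
        = (\<kappa> g - 1) * iwasawa_integral (pseudo_measure_coeff lam h) \<kappa>"
      unfolding iwasawa_integral_dirac_minus_1_mult[OF \<kappa> g(1), symmetric]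
        iwasawa_integral_dirac_minus_1_mult[OF \<kappa> h, symmetric]
      by (simp only: pseudo_measure_coeff_swap[OF lam g(1) h])
    moreover have "\<kappa> h - 1 \<noteq> 0" "\<kappa> g - 1 \<noteq> 0" using g h1 by simp_all
    ultimately show "inverse (\<kappa> g - 1) * iwasawa_integral (pseudo_measure_coeff lam g) \<kappa>
      = inverse (\<kappa> h - 1) * iwasawa_integral (pseudo_measure_coeff lam h) \<kappa>"
      by (simp add: field_simps)
  qed
qed (use g in \<open>auto simp: padic_units_norm\<close>)

lemma padic_norm_1_plus_card:
  "padic_norm (1 + of_nat CARD('p) :: 'p::prime_card padic) = 1"
  using padic_norm_add_eq[of "of_nat CARD('p) :: 'p padic" 1] inverse_card_le_1(2)[where 'p = 'p]
  by (simp add: padic_norm_card add.commute)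

lemma one_plus_card_power_neq_1:
  assumes "k > 0"
  shows "(1 + of_nat CARD('p) :: 'p::prime_card padic) ^ k \<noteq> 1"
proof
  assume "(1 + of_nat CARD('p) :: 'p padic) ^ k = 1"
  hence "of_nat ((1 + CARD('p)) ^ k) = (of_nat 1 :: 'p padic)" by simp
  hence "(1 + CARD('p)) ^ k = 1" by (simp only: of_nat_eq_iff)
  moreover have "1 < (1 + CARD('p)) ^ k" using assms by (intro one_less_power) auto
  ultimately show False by simp
qed

text \<open>The unit \<open>1 + p\<close> has infinite order, so a measure annihilated by this
  element has vanishing moments of all positive orders.\<close>

lemma regular_elem_dirac_minus_1:
  "regular_elem (dirac (1 + of_nat CARD('p)) - 1 :: 'p::prime_card iwasawa)"
  unfolding regular_elem_def
proof (intro allI impI)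
  fix x :: "'p iwasawa"
  let ?g = "1 + of_nat CARD('p) :: 'p padic"
  assume 0: "(dirac ?g - 1) * x = 0"
  show "x = 0"
  proof (rule iwasawa_eqI_moments)
    fix k :: nat assume k: "k > 0"
    have z: "iwasawa_integral (0 :: 'p iwasawa) f = 0" if "unit_lipschitz f" for f
      using iwasawa_integral_minus_measure[OF that, of 0 0] by simp
    have "(?g ^ k - 1) * iwasawa_integral x (\<lambda>x. x ^ k) = 0"
      using iwasawa_integral_dirac_minus_1_mult[OF unit_character_power padic_norm_1_plus_card, of x k]
      by (simp add: 0 z lipschitz_intros)
    thus "iwasawa_integral x (\<lambda>x. x ^ k) = iwasawa_integral 0 (\<lambda>x. x ^ k)"
      using one_plus_card_power_neq_1[OF k, where 'p = 'p] by (simp add: z lipschitz_intros)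
  qed
qed

text \<open>Comparing moments shows \<open>([g] - 1) M(1 + p) = ([1 + p] - 1) M(g)\<close>, so the
  quotient of \<open>M(1 + p)\<close> by the regular element \<open>[1 + p] - 1\<close> is a
  pseudo-measure with all the \<open>M(g)\<close> as coefficients. Uniqueness compares moments at
  \<open>1 + p\<close> alone.\<close>

lemma padic_zeta_eq:
  fixes M :: "'p::prime_card padic \<Rightarrow> 'p iwasawa"
  assumes M: "\<And>g k. padic_norm g = 1 \<Longrightarrow> k > 0 \<Longrightarrow> iwasawa_integral (M g) (\<lambda>x. x ^ k)
      = (g ^ k - 1) * ((1 - of_nat CARD('p) ^ (k - 1)) * of_rat (zeta_one_minus k))"
  shows "pseudo_measure (padic_zeta :: 'p iwasawa total_fract)"
    and "padic_norm g = 1 \<Longrightarrow> pseudo_measure_coeff padic_zeta g = M g"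
proof -
  let ?a = "1 + of_nat CARD('p) :: 'p padic"
  let ?z = "\<lambda>k. (1 - of_nat CARD('p) ^ (k - 1)) * of_rat (zeta_one_minus k) :: 'p padic"
  let ?t = "to_total_fract :: 'p iwasawa \<Rightarrow> _" and ?d = "dirac ?a - 1 :: 'p iwasawa"
  let ?P = "\<lambda>lam. pseudo_measure lam \<and> (\<forall>k>0. pseudo_integral lam (\<lambda>x. x ^ k) = ?z k)"
  note a = padic_norm_1_plus_card[where 'p = 'p]
  have swap: "(dirac g - 1) * M ?a = ?d * M g" if g: "padic_norm g = 1" for g
    by (rule iwasawa_eqI_moments)
       (simp add: iwasawa_integral_dirac_minus_1_mult unit_character_power g a M)
  obtain e where e: "e * ?t ?d = 1"
    using to_total_fract_invertible[OF regular_elem_dirac_minus_1] by blast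
  define lam0 where "lam0 = e * ?t (M ?a)"
  have lam0: "?t (M g) = (?t (dirac g) - 1) * lam0" if g: "padic_norm g = 1" for g
  proof -
    have "(?t (dirac g) - 1) * lam0 = e * ?t ((dirac g - 1) * M ?a)"
      by (simp add: lam0_def to_total_fract_mult to_total_fract_diff to_total_fract_1)
    also have "\<dots> = (e * ?t ?d) * ?t (M g)" by (simp add: swap[OF g] to_total_fract_mult)
    finally show ?thesis by (simp add: e)
  qed
  have pm0: "pseudo_measure lam0"
    unfolding pseudo_measure_def by (metis lam0 padic_units_norm rangeI)
  have coeff0: "pseudo_measure_coeff lam0 g = M g" if "padic_norm g = 1" for g
    by (rule pseudo_measure_coeff_eqI[OF lam0[OF that]])
  have P0: "?P lam0"
  proof (intro conjI allI impI pm0)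
    fix k :: nat assume k: "k > 0"
    have "pseudo_integral lam0 (\<lambda>x. x ^ k) = inverse (?a ^ k - 1) * iwasawa_integral (M ?a) (\<lambda>x. x ^ k)"
      using pseudo_integral_eq[OF pm0 unit_character_power a one_plus_card_power_neq_1[OF k]]
      by (simp add: coeff0[OF a])
    thus "pseudo_integral lam0 (\<lambda>x. x ^ k) = ?z k"
      using one_plus_card_power_neq_1[OF k, where 'p = 'p] by (simp add: M[OF a k])
  qed
  have uniq: "lam = lam0" if lam: "?P lam" for lam
  proof -
    have "pseudo_measure_coeff lam ?a = M ?a"
    proof (rule iwasawa_eqI_moments)
      fix k :: nat assume k: "k > 0"
      have "?z k = inverse (?a ^ k - 1) * iwasawa_integral (pseudo_measure_coeff lam ?a) (\<lambda>x. x ^ k)"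
        using pseudo_integral_eq[OF conjunct1[OF lam] unit_character_power a one_plus_card_power_neq_1[OF k]] lam k
        by simp
      thus "iwasawa_integral (pseudo_measure_coeff lam ?a) (\<lambda>x. x ^ k) = iwasawa_integral (M ?a) (\<lambda>x. x ^ k)"
        using one_plus_card_power_neq_1[OF k, where 'p = 'p] by (simp add: M[OF a k])
    qed
    hence "?t (M ?a) = ?t ?d * lam"
      using to_total_fract_pseudo_measure_coeff[OF conjunct1[OF lam] a]
      by (simp add: to_total_fract_diff to_total_fract_1)
    hence "lam0 = (e * ?t ?d) * lam" by (simp add: lam0_def)
    thus ?thesis by (simp add: e)
  qed
  have zeta: "padic_zeta = lam0"
    unfolding padic_zeta_def by (rule the_equality[of ?P, OF P0 uniq])
  show "pseudo_measure (padic_zeta :: 'p iwasawa total_fract)" unfolding zeta by (rule pm0)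
  show "padic_norm g = 1 \<Longrightarrow> pseudo_measure_coeff padic_zeta g = M g" unfolding zeta by (rule coeff0)
qed


subsection \<open>Power sums over units\<close>

lemma sum_lessThan_card_pow:
  fixes f :: "nat \<Rightarrow> 'a::comm_ring_1"
  assumes p: "prime p"
  shows "(\<Sum>b<p ^ Suc n. f b) = (\<Sum>a\<in>unit_residues p (Suc n). f a) + (\<Sum>b<p ^ n. f (p * b))"
proof -
  have "{..<p ^ Suc n} = unit_residues p (Suc n) \<union> (\<lambda>b. p * b) ` {..<p ^ n}"
  proof (intro equalityI subsetI)
    fix b assume b: "b \<in> {..<p ^ Suc n}"
    show "b \<in> unit_residues p (Suc n) \<union> (\<lambda>b. p * b) ` {..<p ^ n}"
    proof (cases "p dvd b")
      case True
      then obtain d where d: "b = p * d" ..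
      hence "d < p ^ n" using b prime_gt_0_nat[OF p] by simp
      thus ?thesis using d by blast
    next
      case False
      hence "coprime b (p ^ Suc n)" using prime_imp_coprime[OF p False] by (simp add: coprime_commute)
      thus ?thesis using b by (simp add: unit_residues_def)
    qed
  qed (use prime_gt_0_nat[OF p] in \<open>auto simp: unit_residues_def\<close>)
  moreover have "unit_residues p (Suc n) \<inter> (\<lambda>b. p * b) ` {..<p ^ n} = {}"
    using not_prime_unit[of p] p by (auto simp: unit_residues_def)
  ultimately have "(\<Sum>b<p ^ Suc n. f b) = (\<Sum>a\<in>unit_residues p (Suc n). f a) + sum f ((\<lambda>b. p * b) ` {..<p ^ n})"
    by (simp add: sum.union_disjoint)
  also have "sum f ((\<lambda>b. p * b) ` {..<p ^ n}) = (\<Sum>b<p ^ n. f (p * b))"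
    using prime_gt_0_nat[OF p] by (subst sum.reindex) (auto simp: inj_on_def)
  finally show ?thesis .
qed

text \<open>Dividing the Bernoulli polynomial formula by \<open>M = p^n\<close> leaves a polynomial
  in \<open>M\<close> with constant term \<open>B_k\<close>, and \<open>M\<close> tends to
  \<open>0\<close>. In other words, \<open>B_k\<close> is the Volkenborn integral of
  \<open>x^k\<close>.\<close>

lemma LIMSEQ_power_sum:
  "(\<lambda>n. (\<Sum>b<CARD('p) ^ n. of_nat b ^ k) / of_nat (CARD('p) ^ n) :: 'p::prime_card padic)
     \<longlonglongrightarrow> of_rat (bernoulli k)"
proof -
  let ?M = "\<lambda>n. of_nat (CARD('p) ^ n) :: 'p padic" and ?k = "of_nat (Suc k) :: 'p padic"
  let ?c = "\<lambda>j. of_rat (bernoulli j) * of_nat (Suc k choose j) :: 'p padic"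
  have eq: "(\<Sum>b<CARD('p) ^ n. of_nat b ^ k) / ?M n = inverse ?k * (\<Sum>j\<le>k. ?c j * ?M n ^ (k - j))" for n
  proof -
    have M: "?M n \<noteq> 0" by simp
    have "?k * (\<Sum>b<CARD('p) ^ n. of_nat b ^ k) = bernoulli_poly (Suc k) (?M n) - bernoulli_poly (Suc k) 0"
      by (rule sum_powers_bernoulli)
    also have "\<dots> = (\<Sum>j\<le>k. ?c j * ?M n ^ (Suc k - j)) - (\<Sum>j\<le>k. ?c j * 0 ^ (Suc k - j))"
      unfolding bernoulli_poly_def by simp
    also have "(\<Sum>j\<le>k. ?c j * 0 ^ (Suc k - j)) = 0"
      by (intro sum.neutral) (simp add: power_0_left)
    also have "(\<Sum>j\<le>k. ?c j * ?M n ^ (Suc k - j)) = ?M n * (\<Sum>j\<le>k. ?c j * ?M n ^ (k - j))"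
      unfolding sum_distrib_left by (intro sum.cong refl) (simp add: Suc_diff_le)
    finally have "?k * (\<Sum>b<CARD('p) ^ n. of_nat b ^ k) = ?M n * (\<Sum>j\<le>k. ?c j * ?M n ^ (k - j))" by simp
    thus ?thesis using M by (simp add: nonzero_divide_eq_eq field_simps del: of_nat_Suc of_nat_power)
  qed
  have "(\<lambda>n. inverse ?k * (\<Sum>j\<le>k. ?c j * ?M n ^ (k - j))) \<longlonglongrightarrow> inverse ?k * (\<Sum>j\<le>k. ?c j * 0 ^ (k - j))"
    by (intro tendsto_mult_left tendsto_sum tendsto_power_padic card_pow_tendsto_0)
  also have "(\<Sum>j\<le>k. ?c j * 0 ^ (k - j)) = (\<Sum>j\<le>k. if j = k then ?c k else 0)"
    by (intro sum.cong refl) (auto simp: power_0_left)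
  also have "inverse ?k * \<dots> = of_rat (bernoulli k)" by (simp del: of_nat_Suc)
  finally show ?thesis unfolding eq .
qed

lemma sum_unit_residues_power:
  "(\<Sum>a\<in>unit_residues CARD('p::prime_card) (Suc n). of_nat a ^ k)
     = (\<Sum>b<CARD('p) ^ Suc n. of_nat b ^ k) - of_nat CARD('p) ^ k * (\<Sum>b<CARD('p) ^ n. of_nat b ^ k :: 'p padic)"
  using sum_lessThan_card_pow[OF prime_card[where 'a = 'p], of "\<lambda>b. of_nat b ^ k :: 'p padic" n]
  by (simp add: power_mult_distrib sum_distrib_left)

text \<open>The multiples of \<open>p\<close> below \<open>p^(n + 1)\<close> contribute
  \<open>p^(k - 1)\<close> times the full average at level \<open>n\<close>; removing them produces
  the Euler factor.\<close>

lemma LIMSEQ_unit_power_sum: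
  assumes k: "k > 0"
  shows "(\<lambda>n. (\<Sum>a\<in>unit_residues CARD('p) n. of_nat a ^ k) / of_nat (CARD('p) ^ n) :: 'p::prime_card padic)
     \<longlonglongrightarrow> (1 - of_nat CARD('p) ^ (k - 1)) * of_rat (bernoulli k)"
proof (rule LIMSEQ_imp_Suc)
  let ?F = "\<lambda>n. (\<Sum>b<CARD('p) ^ n. of_nat b ^ k) / of_nat (CARD('p) ^ n) :: 'p padic"
  let ?p = "of_nat CARD('p) :: 'p padic"
  have "?p ^ k = ?p * ?p ^ (k - 1)" using k by (cases k) auto
  hence "(\<Sum>a\<in>unit_residues CARD('p) (Suc n). of_nat a ^ k) / of_nat (CARD('p) ^ Suc n) = ?F (Suc n) + - (?p ^ (k - 1) * ?F n)" for n
    unfolding sum_unit_residues_power by (simp add: diff_divide_distrib)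
  moreover have "(\<lambda>n. ?F (Suc n) + - (?p ^ (k - 1) * ?F n)) \<longlonglongrightarrow> of_rat (bernoulli k) + - (?p ^ (k - 1) * of_rat (bernoulli k))"
    by (intro tendsto_add tendsto_minus tendsto_mult_left LIMSEQ_power_sum LIMSEQ_Suc[OF LIMSEQ_power_sum])
  ultimately show "(\<lambda>n. (\<Sum>a\<in>unit_residues CARD('p) (Suc n). of_nat a ^ k) / of_nat (CARD('p) ^ Suc n))
      \<longlonglongrightarrow> (1 - ?p ^ (k - 1)) * of_rat (bernoulli k)"
    by (simp only: left_diff_distrib mult_1_left diff_conv_add_uminus[symmetric])
qed

lemma LIMSEQ_unit_power_sum_0:
  "(\<lambda>n. \<Sum>a\<in>unit_residues CARD('p) n. of_nat a ^ k :: 'p::prime_card padic) \<longlonglongrightarrow> 0"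
proof (rule LIMSEQ_imp_Suc)
  let ?F = "\<lambda>n. \<Sum>b<CARD('p) ^ n. of_nat b ^ k :: 'p padic"
  have "(\<lambda>n. of_nat (CARD('p) ^ n) * (?F n / of_nat (CARD('p) ^ n))) \<longlonglongrightarrow> 0 * of_rat (bernoulli k)"
    by (intro tendsto_mult card_pow_tendsto_0 LIMSEQ_power_sum)
  hence F: "?F \<longlonglongrightarrow> 0" by simp
  have "(\<lambda>n. ?F (Suc n) + - (of_nat CARD('p) ^ k * ?F n)) \<longlonglongrightarrow> 0 + - (of_nat CARD('p) ^ k * 0)"
    by (intro tendsto_add tendsto_minus tendsto_mult_left F LIMSEQ_Suc[OF F])
  thus "(\<lambda>n. \<Sum>a\<in>unit_residues CARD('p) (Suc n). of_nat a ^ k :: 'p padic) \<longlonglongrightarrow> 0"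
    unfolding sum_unit_residues_power by simp
qed

lemma card_unit_residues:
  "of_nat (card (unit_residues CARD('p::prime_card) (Suc n))) = of_nat (CARD('p) ^ Suc n) - (of_nat (CARD('p) ^ n) :: 'p padic)"
  using sum_unit_residues_power[where n = n and k = 0 and 'p = 'p] by simp

lemma padic_norm_2: "odd CARD('p::prime_card) \<Longrightarrow> padic_norm (2 :: 'p padic) = 1"
  using padic_norm_of_nat_eq_1_iff[of 2, where 'p = 'p] by simp

text \<open>Pairing \<open>a\<close> with \<open>p^n - a\<close> makes twice the sum divisible by
  \<open>p^n\<close>, and \<open>2\<close> is a unit. This disposes of the correction term when
  \<open>\<phi>\<close> is the logarithm.\<close>

lemma LIMSEQ_unit_inverse_sum:
  assumes odd: "odd CARD('p::prime_card)"
  shows "(\<lambda>n. \<Sum>a\<in>unit_residues CARD('p) n. inverse (of_nat a) :: 'p padic) \<longlonglongrightarrow> 0"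
proof (rule padic_tendsto_le[OF _ inverse_card_pow_tendsto_0[of 1, where 'p = 'p]])
  fix n :: nat assume n: "n \<ge> 1"
  let ?U = "unit_residues CARD('p) n" and ?q = "CARD('p) ^ n"
  have mem: "?q - a \<in> ?U" "a < ?q" "?q - (?q - a) = a" if "a \<in> ?U" for a
  proof -
    have a: "a < ?q" "coprime a ?q" using that by (auto simp: unit_residues_def)
    have "a \<noteq> 0"
    proof
      assume "a = 0"
      hence "?q = 1" using a by simp
      thus False using n by (simp add: power_eq_1_iff)
    qed
    have "coprime (?q - a) ?q"
    proof (rule coprimeI)
      fix d assume d: "d dvd ?q - a" "d dvd ?q"
      have "d dvd ?q - (?q - a)" by (rule dvd_diff_nat[OF d(2,1)])
      moreover have "?q - (?q - a) = a" using a(1) by linarith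
      ultimately have "d dvd a" by (simp only:)
      thus "is_unit d" using coprime_common_divisor[OF a(2)] d(2) by blast
    qed
    thus "?q - a \<in> ?U" "a < ?q" "?q - (?q - a) = a"
      using a \<open>a \<noteq> 0\<close> by (auto simp: unit_residues_def simp del: coprime_power_right_iff)
  qed
  let ?S = "\<Sum>a\<in>?U. inverse (of_nat a) :: 'p padic"
  have "?S = (\<Sum>a\<in>?U. inverse (of_nat (?q - a)))"
    by (rule sum.reindex_bij_witness[of _ "\<lambda>a. ?q - a" "\<lambda>a. ?q - a"]) (auto simp: mem)
  hence "2 * ?S = (\<Sum>a\<in>?U. inverse (of_nat a) + inverse (of_nat (?q - a)))"
    by (simp add: sum.distrib)
  also have "padic_norm \<dots> \<le> 1 / real CARD('p) ^ n"
  proof (intro padic_norm_sum_le)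
    fix a assume a: "a \<in> ?U"
    have u: "padic_norm (of_nat a :: 'p padic) = 1" "padic_norm (of_nat (?q - a) :: 'p padic) = 1"
      using n by (intro padic_norm_unit_residue[where n = n] a mem; simp)+
    hence nz: "of_nat a \<noteq> (0 :: 'p padic)" "of_nat (?q - a) \<noteq> (0 :: 'p padic)" by (metis padic_norm_0 zero_neq_one)+
    have "inverse (of_nat a) + inverse (of_nat (?q - a)) = (of_nat (?q - a) + of_nat a) * (inverse (of_nat a) * inverse (of_nat (?q - a)) :: 'p padic)"
      using nz by (simp add: field_simps)
    also have "of_nat (?q - a) + of_nat a = (of_nat ?q :: 'p padic)" using mem(2)[OF a] by (simp flip: of_nat_add)
    finally show "padic_norm (inverse (of_nat a) + inverse (of_nat (?q - a)) :: 'p padic) \<le> 1 / real CARD('p) ^ n"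
      by (simp add: padic_norm_mult padic_norm_inverse u padic_norm_power padic_norm_card power_one_over)
  qed simp
  finally show "padic_norm (?S - 0) \<le> 1 / real CARD('p) ^ n"
    by (simp add: padic_norm_mult padic_norm_2[OF odd])
qed


subsection \<open>The regularised zeta measures\<close>

definition unit_twist :: "'p::prime_card padic \<Rightarrow> nat \<Rightarrow> nat \<Rightarrow> nat" where
  "unit_twist c n a = unit_residue n (inverse c * of_nat a)"

text \<open>The distribution \<open>B\<^sub>1({a / p\<^sup>n}) - c B\<^sub>1({c\<^sup>-\<^sup>1 a / p\<^sup>n})\<close>.\<close>

definition bernoulli_dist :: "'p::prime_card padic \<Rightarrow> nat \<Rightarrow> nat \<Rightarrow> 'p padic" where
  "bernoulli_dist c n a = (of_nat a - c * of_nat (unit_twist c n a)) / of_nat (CARD('p) ^ n) + (c - 1) / 2"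

text \<open>The density \<open>x^-1\<close> is evaluated at the chosen representative
  \<open>a\<close> of each class, which leaves the family only approximately compatible.\<close>

definition zeta_family :: "'p::prime_card padic \<Rightarrow> nat \<Rightarrow> nat \<Rightarrow> 'p padic" where
  "zeta_family c n a = (if n > 0 \<and> a \<in> unit_residues CARD('p) n
     then inverse (of_nat a) * bernoulli_dist c n a else 0)"

definition residue_fibre :: "nat \<Rightarrow> nat \<Rightarrow> nat \<Rightarrow> nat set" where
  "residue_fibre p n a = {b \<in> unit_residues p (Suc n). b mod p ^ n = a}"

lemma residue_fibre_eq:
  assumes p: "prime p" and n: "n > 0" and a: "a \<in> unit_residues p n"
  shows "residue_fibre p n a = (\<lambda>j. a + j * p ^ n) ` {..<p}"
proof (intro equalityI subsetI)
  fix b assume "b \<in> residue_fibre p n a"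
  hence b: "b < p ^ n * p" "b mod p ^ n = a" by (auto simp: residue_fibre_def unit_residues_def mult.commute)
  have "b div p ^ n < p" using b by (simp add: less_mult_imp_div_less mult.commute)
  moreover have "b = a + (b div p ^ n) * p ^ n" using b(2) by (metis mod_div_decomp add.commute)
  ultimately show "b \<in> (\<lambda>j. a + j * p ^ n) ` {..<p}" by blast
next
  fix b assume "b \<in> (\<lambda>j. a + j * p ^ n) ` {..<p}"
  then obtain j where j: "j < p" "b = a + j * p ^ n" by blast
  have a': "a < p ^ n" "coprime a p" using a n by (auto simp: unit_residues_def)
  have "b < p ^ n + j * p ^ n" using j a' by simp
  also have "\<dots> = Suc j * p ^ n" by simp
  also have "\<dots> \<le> p * p ^ n" using j by (intro mult_le_mono1) simp
  finally have "b < p ^ Suc n" by simp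
  moreover have m: "b mod p ^ n = a" using j a' by simp
  moreover have "coprime b p"
  proof -
    have "p dvd p ^ n" using n by (simp add: dvd_power)
    hence "b mod p = a mod p" using mod_mod_cancel[of p "p ^ n" b] m by simp
    thus ?thesis using a'(2) prime_gt_0_nat[OF p] by (metis coprime_mod_left_iff not_gr_zero)
  qed
  ultimately show "b \<in> residue_fibre p n a" by (simp add: residue_fibre_def unit_residues_def)
qed

lemma double_sum_lessThan: "2 * (\<Sum>j<n. of_nat j) = of_nat n * (of_nat n - 1 :: 'a::comm_ring_1)"
  by (induction n) (simp_all add: algebra_simps)

lemma sum_residue_fibre:
  assumes p: "prime p" and n: "n > 0" and a: "a \<in> unit_residues p n"
  shows "2 * (\<Sum>b\<in>residue_fibre p n a. of_nat b)
       = 2 * of_nat p * of_nat a + of_nat (p ^ n) * (of_nat p * (of_nat p - 1) :: 'a::comm_ring_1)"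
    and "card (residue_fibre p n a) = p"
proof -
  have inj: "inj_on (\<lambda>j. a + j * p ^ n) {..<p}" using prime_gt_0_nat[OF p] by (auto simp: inj_on_def)
  have "(\<Sum>b\<in>residue_fibre p n a. of_nat b) = (\<Sum>j<p. of_nat a + of_nat j * of_nat (p ^ n) :: 'a)"
    unfolding residue_fibre_eq[OF assms] by (subst sum.reindex[OF inj]) simp
  also have "\<dots> = of_nat p * of_nat a + of_nat (p ^ n) * (\<Sum>j<p. of_nat j)"
    by (simp add: sum.distrib mult.commute flip: sum_distrib_right)
  finally have "2 * (\<Sum>b\<in>residue_fibre p n a. of_nat b)
      = 2 * of_nat p * of_nat a + of_nat (p ^ n) * (2 * (\<Sum>j<p. of_nat j) :: 'a)"
    by (simp add: algebra_simps)
  thus "2 * (\<Sum>b\<in>residue_fibre p n a. of_nat b)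
       = 2 * of_nat p * of_nat a + of_nat (p ^ n) * (of_nat p * (of_nat p - 1) :: 'a)"
    by (simp only: double_sum_lessThan)
  show "card (residue_fibre p n a) = p"
    unfolding residue_fibre_eq[OF assms] using card_image[OF inj] by simp
qed

context
  fixes c :: "'p::prime_card padic"
  assumes odd: "odd CARD('p)" and c: "padic_norm c = 1"
begin

lemma unit_twist:
  assumes "n > 0" "a \<in> unit_residues CARD('p) n"
  shows "unit_twist c n a \<in> unit_residues CARD('p) n"
    and "padic_norm (of_nat a - c * of_nat (unit_twist c n a)) \<le> 1 / real CARD('p) ^ n"
proof -
  have c0: "c \<noteq> 0" using c by auto
  have u: "padic_norm (inverse c * of_nat a) = 1"
    using padic_norm_unit_residue[OF assms(2,1)] c by (simp add: padic_norm_mult padic_norm_inverse)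
  show "unit_twist c n a \<in> unit_residues CARD('p) n" unfolding unit_twist_def by (rule unit_residue[OF u])
  have "of_nat a - c * of_nat (unit_twist c n a) = c * (inverse c * of_nat a - of_nat (unit_twist c n a))"
    using c0 by (simp add: algebra_simps)
  thus "padic_norm (of_nat a - c * of_nat (unit_twist c n a)) \<le> 1 / real CARD('p) ^ n"
    using unit_residue(2)[OF u, of n] by (simp add: padic_norm_mult c unit_twist_def)
qed

text \<open>The twist \<open>a'\<close> is characterised by \<open>c a' = a\<close> modulo the
  level, and \<open>c\<close> is a unit. Equal levels give injectivity, consecutive ones
  compatibility with reduction.\<close>

lemma unit_twist_cong_iff:
  assumes n: "n > 0" "n \<le> m" and a: "a \<in> unit_residues CARD('p) m" and b: "b \<in> unit_residues CARD('p) n"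
  shows "unit_twist c m a mod CARD('p) ^ n = unit_twist c n b \<longleftrightarrow> a mod CARD('p) ^ n = b"
proof -
  let ?A = "of_nat a :: 'p padic" and ?B = "of_nat b :: 'p padic"
  let ?a = "of_nat (unit_twist c m a) :: 'p padic" and ?b = "of_nat (unit_twist c n b) :: 'p padic"
  have "1 / real CARD('p) ^ m \<le> 1 / real CARD('p) ^ n"
    using n by (intro divide_left_mono power_increasing) auto
  hence A: "padic_norm (?A - c * ?a) \<le> 1 / real CARD('p) ^ n"
    using unit_twist(2)[OF _ a] n by simp
  have B: "padic_norm (?B - c * ?b) \<le> 1 / real CARD('p) ^ n" by (rule unit_twist(2)[OF n(1) b])
  have "padic_norm (?a - ?b) = padic_norm (c * ?a - c * ?b)"
    using padic_norm_mult[of c "?a - ?b"] c by (simp add: right_diff_distrib)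
  moreover have "padic_norm (c * ?a - c * ?b) \<le> 1 / real CARD('p) ^ n \<longleftrightarrow> padic_norm (?A - ?B) \<le> 1 / real CARD('p) ^ n"
    using padic_norm_diff_le[OF padic_norm_add_le[OF _ A] B, of "c * ?a - c * ?b"]
      padic_norm_add_le[OF padic_norm_diff_le[OF _ A] B, of "?A - ?B"] by (auto simp: algebra_simps)
  ultimately have "[unit_twist c m a = unit_twist c n b] (mod CARD('p) ^ n) \<longleftrightarrow> [a = b] (mod CARD('p) ^ n)"
    using padic_norm_of_nat_diff_le_iff[of "unit_twist c m a" "unit_twist c n b" n, where 'p = 'p]
      padic_norm_of_nat_diff_le_iff[of a b n, where 'p = 'p] by simp
  thus ?thesis using b unit_twist(1)[OF n(1) b] by (simp add: cong_def unit_residues_def)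
qed

lemma unit_twist_inj: "n > 0 \<Longrightarrow> inj_on (unit_twist c n) (unit_residues CARD('p) n)"
proof (rule inj_onI)
  fix a b assume n: "n > 0" and ab: "a \<in> unit_residues CARD('p) n" "b \<in> unit_residues CARD('p) n" "unit_twist c n a = unit_twist c n b"
  thus "a = b"
    using unit_twist_cong_iff[OF n le_refl ab(1,2)] unit_twist(1)[OF n ab(1)] by (simp add: unit_residues_def)
qed

lemma sum_unit_twist:
  assumes n: "n > 0"
  shows "(\<Sum>a\<in>unit_residues CARD('p) n. f (unit_twist c n a)) = (\<Sum>a\<in>unit_residues CARD('p) n. f a)"
proof -
  have "unit_twist c n ` unit_residues CARD('p) n = unit_residues CARD('p) n"
    using unit_twist(1)[OF n] by (intro endo_inj_surj unit_twist_inj n) auto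
  thus ?thesis using sum.reindex[OF unit_twist_inj[OF n], of f] by simp
qed

lemma sum_unit_twist_fibre:
  assumes n: "n > 0" and a: "a \<in> unit_residues CARD('p) n"
  shows "(\<Sum>b\<in>residue_fibre CARD('p) n a. f (unit_twist c (Suc n) b))
       = (\<Sum>b\<in>residue_fibre CARD('p) n (unit_twist c n a). f b)"
proof -
  let ?F = "residue_fibre CARD('p) n"
  have inj: "inj_on (unit_twist c (Suc n)) (?F a)"
    by (rule inj_on_subset[OF unit_twist_inj]) (auto simp: residue_fibre_def)
  have sub: "unit_twist c (Suc n) ` ?F a \<subseteq> ?F (unit_twist c n a)"
    using unit_twist_cong_iff[OF n _ _ a, of "Suc n"] unit_twist(1)[of "Suc n"]
    by (auto simp: residue_fibre_def)
  have "unit_twist c (Suc n) ` ?F a = ?F (unit_twist c n a)"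
  proof (rule card_subset_eq[OF _ sub])
    show "finite (?F (unit_twist c n a))" by (simp add: residue_fibre_def)
    show "card (unit_twist c (Suc n) ` ?F a) = card (?F (unit_twist c n a))"
      using card_image[OF inj] sum_residue_fibre(2)[OF prime_card[where 'a = 'p] n] a unit_twist(1)[OF n a] by simp
  qed
  thus ?thesis using sum.reindex[OF inj, of f] by simp
qed

text \<open>Summed over a fibre, the linear part picks up \<open>(1 - c) (p - 1) / 2\<close>; the
  constant \<open>(c - 1) / 2\<close>, counted \<open>p\<close> times, absorbs this and reproduces
  itself.\<close>

lemma sum_bernoulli_dist_fibre:
  assumes n: "n > 0" and a: "a \<in> unit_residues CARD('p) n"
  shows "(\<Sum>b\<in>residue_fibre CARD('p) n a. bernoulli_dist c (Suc n) b) = bernoulli_dist c n a"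
proof -
  let ?F = "residue_fibre CARD('p) n" and ?p = "of_nat CARD('p) :: 'p padic" and ?q = "of_nat (CARD('p) ^ n) :: 'p padic"
  let ?a = "of_nat a :: 'p padic" and ?a' = "of_nat (unit_twist c n a) :: 'p padic"
  let ?S = "\<lambda>a. \<Sum>b\<in>?F a. of_nat b :: 'p padic"
  have nz: "?p \<noteq> 0" "?q \<noteq> 0" by simp_all
  have S: "2 * ?S a = 2 * ?p * ?a + ?q * (?p * (?p - 1))"
    "2 * ?S (unit_twist c n a) = 2 * ?p * ?a' + ?q * (?p * (?p - 1))"
    by (intro sum_residue_fibre(1) prime_card n a unit_twist(1))+
  have "(\<Sum>b\<in>?F a. bernoulli_dist c (Suc n) b)
      = (?S a - c * (\<Sum>b\<in>?F a. of_nat (unit_twist c (Suc n) b))) / (?p * ?q) + ?p * ((c - 1) / 2)"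
    using sum_residue_fibre(2)[OF prime_card n a]
    by (simp add: bernoulli_dist_def sum.distrib sum_subtractf flip: sum_divide_distrib sum_distrib_left)
  also have "(\<Sum>b\<in>?F a. of_nat (unit_twist c (Suc n) b)) = ?S (unit_twist c n a)"
    by (rule sum_unit_twist_fibre[OF n a])
  also have "(?S a - c * ?S (unit_twist c n a)) / (?p * ?q)
      = (2 * ?S a - c * (2 * ?S (unit_twist c n a))) / (2 * (?p * ?q))"
    by (simp add: field_simps)
  also have "\<dots> = (2 * ?p * (?a - c * ?a') + (1 - c) * ?q * (?p * (?p - 1))) / (2 * (?p * ?q))"
    unfolding S by (simp add: algebra_simps)
  also have "\<dots> = (?a - c * ?a') / ?q + (1 - c) * (?p - 1) / 2"
    using nz by (simp add: add_divide_distrib)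
  also have "\<dots> + ?p * ((c - 1) / 2) = bernoulli_dist c n a"
    by (simp add: bernoulli_dist_def field_simps)
  finally show ?thesis .
qed

text \<open>This is the purpose of the regularisation: \<open>a\<close> and \<open>c a'\<close>
  agree modulo \<open>p^n\<close>, which cancels the denominator of the first Bernoulli
  distribution; the remaining denominator \<open>2\<close> is a unit.\<close>

lemma padic_norm_bernoulli_dist_le:
  assumes "n > 0" "a \<in> unit_residues CARD('p) n"
  shows "padic_norm (bernoulli_dist c n a) \<le> 1"
  unfolding bernoulli_dist_def
proof (rule padic_norm_add_le)
  show "padic_norm ((of_nat a - c * of_nat (unit_twist c n a)) / of_nat (CARD('p) ^ n)) \<le> 1"
    using unit_twist(2)[OF assms]
    by (simp add: padic_norm_divide padic_norm_power padic_norm_card power_one_over field_simps)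
  have "padic_norm (c - 1) \<le> 1" using c by (intro padic_norm_diff_le) auto
  thus "padic_norm ((c - 1) / 2) \<le> 1" by (simp add: padic_norm_divide padic_norm_2[OF odd])
qed

lemma padic_norm_zeta_family_le: "padic_norm (zeta_family c n a) \<le> 1"
  using padic_norm_bernoulli_dist_le[of n a] padic_norm_unit_residue[of a n, where 'p = 'p]
  by (simp add: zeta_family_def padic_norm_mult padic_norm_inverse)

lemma approx_family_zeta_family: "approx_family (zeta_family c)"
  unfolding approx_family_def residue_fibre_def[symmetric]
proof (intro conjI allI ballI padic_norm_zeta_family_le)
  fix n a assume a: "a \<in> unit_residues CARD('p) n"
  let ?F = "residue_fibre CARD('p) n a"
  have F: "b \<in> unit_residues CARD('p) (Suc n)" "b mod CARD('p) ^ n = a" if "b \<in> ?F" for b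
    using that by (auto simp: residue_fibre_def)
  show "padic_norm (sum (zeta_family c (Suc n)) ?F - zeta_family c n a) \<le> 1 / real CARD('p) ^ n"
  proof (cases "n > 0")
    case False
    thus ?thesis
      by (auto simp: zeta_family_def[of c 0] intro!: padic_norm_sum_le padic_norm_zeta_family_le)
  next
    case n: True
    have "sum (zeta_family c (Suc n)) ?F = (\<Sum>b\<in>?F. inverse (of_nat b) * bernoulli_dist c (Suc n) b)"
      using F by (intro sum.cong refl) (simp add: zeta_family_def)
    moreover have "zeta_family c n a = (\<Sum>b\<in>?F. inverse (of_nat a) * bernoulli_dist c (Suc n) b)"
      using a n by (simp add: zeta_family_def sum_bernoulli_dist_fibre flip: sum_distrib_left)
    ultimately have "sum (zeta_family c (Suc n)) ?F - zeta_family c n a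
        = (\<Sum>b\<in>?F. (inverse (of_nat b) - inverse (of_nat a)) * bernoulli_dist c (Suc n) b)"
      by (simp add: left_diff_distrib sum_subtractf)
    also have "padic_norm \<dots> \<le> 1 / real CARD('p) ^ n"
    proof (rule padic_norm_sum_le)
      fix b assume b: "b \<in> ?F"
      have u: "padic_norm (of_nat a :: 'p padic) = 1" "padic_norm (of_nat b :: 'p padic) = 1"
        using padic_norm_unit_residue[OF a n] padic_norm_unit_residue[OF F(1)[OF b]] by simp_all
      hence nz: "of_nat a \<noteq> (0 :: 'p padic)" "of_nat b \<noteq> (0 :: 'p padic)" by (metis padic_norm_0 zero_neq_one)+
      have "inverse (of_nat b) - inverse (of_nat a) = (inverse (of_nat b) * inverse (of_nat a)) * (of_nat a - of_nat b :: 'p padic)"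
        using nz by (simp add: field_simps)
      hence "padic_norm (inverse (of_nat b) - inverse (of_nat a) :: 'p padic) = padic_norm (of_nat b - of_nat a :: 'p padic)"
        by (simp add: padic_norm_mult padic_norm_inverse u padic_norm_minus_commute)
      also have "\<dots> \<le> 1 / real CARD('p) ^ n" using padic_norm_mod_card_pow[of b n, where 'p = 'p] F(2)[OF b] by simp
      finally have "padic_norm ((inverse (of_nat b) - inverse (of_nat a)) * bernoulli_dist c (Suc n) b) \<le> 1 / real CARD('p) ^ n * 1"
        unfolding padic_norm_mult using F(1)[OF b] by (intro mult_mono padic_norm_bernoulli_dist_le) auto
      thus "padic_norm ((inverse (of_nat b) - inverse (of_nat a)) * bernoulli_dist c (Suc n) b) \<le> 1 / real CARD('p) ^ n" by simp
    qed simp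
    finally show ?thesis .
  qed
qed

text \<open>In the applications \<open>\<psi>\<close> is the derivative of \<open>\<phi>\<close>.\<close>

lemma riemann_sum_zeta_family:
  assumes n: "n > 0" and K: "K \<ge> 0"
    and \<phi>: "\<And>x y. padic_norm x = 1 \<Longrightarrow> padic_norm y = 1 \<Longrightarrow> padic_norm (x - y) < 1 \<Longrightarrow>
      padic_norm (\<phi> x - \<phi> y - \<psi> x * (x - y)) \<le> K * padic_norm (x - y) ^ 2"
  shows "padic_norm (riemann_sum (zeta_family c) (\<lambda>x. x * \<psi> x) n
      - ((\<Sum>a\<in>unit_residues CARD('p) n. \<phi> (of_nat a) - \<phi> (c * of_nat (unit_twist c n a))) / of_nat (CARD('p) ^ n)
         + (c - 1) / 2 * (\<Sum>a\<in>unit_residues CARD('p) n. \<psi> (of_nat a)))) \<le> K / real CARD('p) ^ n"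
proof -
  let ?U = "unit_residues CARD('p) n" and ?q = "of_nat (CARD('p) ^ n) :: 'p padic"
  let ?y = "\<lambda>a. c * of_nat (unit_twist c n a)"
  let ?e = "\<lambda>a. \<phi> (of_nat a) - \<phi> (?y a) - \<psi> (of_nat a) * (of_nat a - ?y a)"
  have u: "padic_norm (of_nat a :: 'p padic) = 1" if "a \<in> ?U" for a
    by (rule padic_norm_unit_residue[OF that n])
  have "riemann_sum (zeta_family c) (\<lambda>x. x * \<psi> x) n = (\<Sum>a\<in>?U. \<psi> (of_nat a) * bernoulli_dist c n a)"
    unfolding riemann_sum_def
  proof (rule sum.cong[OF refl])
    fix a assume a: "a \<in> ?U"
    have "of_nat a \<noteq> (0 :: 'p padic)" using u[OF a] by (metis padic_norm_0 zero_neq_one)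
    thus "of_nat a * \<psi> (of_nat a) * zeta_family c n a = \<psi> (of_nat a) * bernoulli_dist c n a"
      using a n by (simp add: zeta_family_def)
  qed
  also have "\<dots> = (\<Sum>a\<in>?U. \<psi> (of_nat a) * (of_nat a - ?y a)) / ?q + (c - 1) / 2 * (\<Sum>a\<in>?U. \<psi> (of_nat a))"
    by (simp add: bernoulli_dist_def distrib_left sum.distrib sum_divide_distrib sum_distrib_left mult.commute del: of_nat_power)
  finally have "riemann_sum (zeta_family c) (\<lambda>x. x * \<psi> x) n
      - ((\<Sum>a\<in>?U. \<phi> (of_nat a) - \<phi> (?y a)) / ?q + (c - 1) / 2 * (\<Sum>a\<in>?U. \<psi> (of_nat a)))
      = - ((\<Sum>a\<in>?U. ?e a) / ?q)"
    by (simp add: sum_subtractf diff_divide_distrib del: of_nat_power)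
  \<comment> \<open>Each error is quadratic in a number divisible by \<open>p^n\<close>, so after
    division by \<open>p^n\<close> a factor \<open>p^-n\<close> is left.\<close>
  moreover have "padic_norm (\<Sum>a\<in>?U. ?e a) \<le> K * (1 / real CARD('p) ^ n) ^ 2"
  proof (rule padic_norm_sum_le)
    fix a assume a: "a \<in> ?U"
    have y: "padic_norm (?y a) = 1" using u[OF unit_twist(1)[OF n a]] by (simp add: padic_norm_mult c)
    note close = unit_twist(2)[OF n a]
    have "1 / real CARD('p) ^ n < 1" using n by simp
    hence "padic_norm (?e a) \<le> K * padic_norm (of_nat a - ?y a) ^ 2"
      using close by (intro \<phi> u[OF a] y) linarith
    also have "\<dots> \<le> K * (1 / real CARD('p) ^ n) ^ 2" by (intro mult_left_mono power_mono close K) auto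
    finally show "padic_norm (?e a) \<le> K * (1 / real CARD('p) ^ n) ^ 2" .
  qed (use K in simp)
  hence "padic_norm ((\<Sum>a\<in>?U. ?e a) / ?q) \<le> K * (1 / real CARD('p) ^ n) ^ 2 / (1 / real CARD('p) ^ n)"
    unfolding padic_norm_divide
    by (intro frac_le) (use K in \<open>simp_all add: padic_norm_power padic_norm_card power_one_over\<close>)
  hence "padic_norm (- ((\<Sum>a\<in>?U. ?e a) / ?q)) \<le> K / real CARD('p) ^ n"
    by (simp add: power2_eq_square del: of_nat_power)
  ultimately show ?thesis by (simp only:)
qed

end


section \<open>Moments and total mass of the zeta measures\<close>

lemma padic_norm_power_diff_deriv_le:
  assumes x: "padic_norm (x :: 'p::prime_card padic) \<le> 1" and y: "padic_norm y \<le> 1"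
  shows "padic_norm (x ^ Suc m - y ^ Suc m - of_nat (Suc m) * x ^ m * (x - y)) \<le> padic_norm (x - y) ^ 2"
proof -
  have "(\<Sum>i<Suc m. x ^ i * y ^ (m - i)) - of_nat (Suc m) * x ^ m = (\<Sum>i<Suc m. x ^ i * (y ^ (m - i) - x ^ (m - i)))"
    by (simp add: algebra_simps sum_subtractf flip: power_add)
  also have "padic_norm \<dots> \<le> padic_norm (x - y)"
  proof (rule padic_norm_sum_le)
    fix i
    have "padic_norm (x ^ i * (y ^ (m - i) - x ^ (m - i))) \<le> 1 * padic_norm (y - x)"
      unfolding padic_norm_mult by (intro mult_mono padic_norm_power_diff_le x y) (auto simp: padic_norm_power power_le_one x)
    thus "padic_norm (x ^ i * (y ^ (m - i) - x ^ (m - i))) \<le> padic_norm (x - y)"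
      by (simp add: padic_norm_minus_commute)
  qed simp
  finally have *: "padic_norm ((\<Sum>i<Suc m. x ^ i * y ^ (m - i)) - of_nat (Suc m) * x ^ m) \<le> padic_norm (x - y)" .
  have "x ^ Suc m - y ^ Suc m - of_nat (Suc m) * x ^ m * (x - y)
      = (x - y) * ((\<Sum>i<Suc m. x ^ i * y ^ (m - i)) - of_nat (Suc m) * x ^ m)"
    unfolding diff_power_eq_sum by (simp only: right_diff_distrib mult_ac)
  thus ?thesis
    using mult_left_mono[OF *, of "padic_norm (x - y)"] by (simp add: padic_norm_mult power2_eq_square)
qed

text \<open>Writing \<open>y = x (1 + t)\<close> reduces the claim to the quadratic estimate for
  \<open>padic_log\<close> at \<open>1 + t\<close>.\<close>

lemma log_unit_diff_deriv_le:
  assumes odd: "odd CARD('p::prime_card)"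
    and x: "padic_norm (x :: 'p padic) = 1" and xy: "padic_norm (x - y) < 1"
  shows "padic_norm (log_unit x - log_unit y - inverse x * (x - y)) \<le> padic_norm (x - y) ^ 2"
proof -
  define t where "t = inverse x * (y - x)"
  have x0: "x \<noteq> 0" using x by auto
  have t: "padic_norm t = padic_norm (x - y)"
    by (simp add: t_def padic_norm_mult padic_norm_inverse x padic_norm_minus_commute)
  have y: "y = x * (1 + t)" using x0 by (simp add: t_def algebra_simps)
  have t1: "padic_norm (1 + t) = 1" using padic_norm_add_eq[of t 1] t xy by (simp add: add.commute)
  have "log_unit y = log_unit x + padic_log (1 + t)"
    unfolding y using log_unit_mult[OF odd x t1] log_unit_eq_padic_log[OF odd, of "1 + t"] t xy by simp
  hence "log_unit x - log_unit y - inverse x * (x - y) = - (padic_log (1 + t) - (1 + t - 1))"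
    by (simp add: t_def algebra_simps)
  also have "padic_norm \<dots> \<le> padic_norm (1 + t - 1) ^ 2"
    unfolding padic_norm_minus by (rule padic_log_minus_le[OF odd]) (use t xy in \<open>simp add: padic_norm_less_1\<close>)
  finally show ?thesis by (simp add: t)
qed

text \<open>The regularising constant \<open>(c - 1) / 2\<close> multiplies the plain sum of
  \<open>\<psi>\<close>, which tends to \<open>0\<close> for a power as well as for the
  inverse.\<close>

lemma LIMSEQ_riemann_sum_zeta_family:
  fixes c :: "'p::prime_card padic"
  assumes odd: "odd CARD('p)" and c: "padic_norm c = 1" and K: "K \<ge> 0"
    and \<phi>: "\<And>x y. padic_norm x = 1 \<Longrightarrow> padic_norm y = 1 \<Longrightarrow> padic_norm (x - y) < 1 \<Longrightarrow>
      padic_norm (\<phi> x - \<phi> y - \<psi> x * (x - y)) \<le> K * padic_norm (x - y) ^ 2"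
    and main: "(\<lambda>n. (\<Sum>a\<in>unit_residues CARD('p) n. \<phi> (of_nat a) - \<phi> (c * of_nat (unit_twist c n a))) / of_nat (CARD('p) ^ n)) \<longlonglongrightarrow> l"
    and \<psi>: "(\<lambda>n. \<Sum>a\<in>unit_residues CARD('p) n. \<psi> (of_nat a)) \<longlonglongrightarrow> 0"
  shows "riemann_sum (zeta_family c) (\<lambda>x. x * \<psi> x) \<longlonglongrightarrow> l"
proof -
  let ?A = "\<lambda>n. (\<Sum>a\<in>unit_residues CARD('p) n. \<phi> (of_nat a) - \<phi> (c * of_nat (unit_twist c n a))) / of_nat (CARD('p) ^ n)"
  let ?B = "\<lambda>n. (c - 1) / 2 * (\<Sum>a\<in>unit_residues CARD('p) n. \<psi> (of_nat a))"
  let ?R = "riemann_sum (zeta_family c) (\<lambda>x. x * \<psi> x)"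
  have "(\<lambda>n. ?R n - (?A n + ?B n)) \<longlonglongrightarrow> 0"
    by (rule padic_tendsto_le[OF _ inverse_card_pow_tendsto_0[of K, where 'p = 'p], of 1])
       (unfold diff_0_right, rule riemann_sum_zeta_family[OF odd c _ K \<phi>], auto)
  moreover have "(\<lambda>n. ?A n + ?B n) \<longlonglongrightarrow> l + (c - 1) / 2 * 0"
    by (intro tendsto_add tendsto_mult_left main \<psi>)
  ultimately have "(\<lambda>n. (?R n - (?A n + ?B n)) + (?A n + ?B n)) \<longlonglongrightarrow> 0 + (l + (c - 1) / 2 * 0)"
    by (rule tendsto_add)
  thus ?thesis by simp
qed

lemma zeta_measure_exists:
  fixes c :: "'p::prime_card padic"
  assumes odd: "odd CARD('p)" and c: "padic_norm c = 1"
  shows "\<exists>\<mu>. (\<forall>k>0. iwasawa_integral \<mu> (\<lambda>x. x ^ k)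
        = (c ^ k - 1) * ((1 - of_nat CARD('p) ^ (k - 1)) * of_rat (zeta_one_minus k))) \<and>
      iwasawa_integral \<mu> (\<lambda>_. 1) = - (1 - inverse (of_nat CARD('p))) * log_unit c"
proof -
  let ?U = "unit_residues CARD('p)"
  obtain \<mu> where \<mu>: "\<And>f. unit_lipschitz f \<Longrightarrow> riemann_sum (zeta_family c) f \<longlonglongrightarrow> iwasawa_integral \<mu> f"
    using measure_of_approx_family[OF approx_family_zeta_family[OF assms]] by blast
  have "iwasawa_integral \<mu> (\<lambda>x. x ^ k) = (c ^ k - 1) * ((1 - of_nat CARD('p) ^ (k - 1)) * of_rat (zeta_one_minus k))"
    if k: "k > 0" for k
  proof -
    let ?k = "of_nat k :: 'p padic"
    obtain m where m: "k = Suc m" using k by (cases k) auto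
    have k0: "?k \<noteq> 0" using k by simp
    \<comment> \<open>The antiderivative of \<open>x^m\<close> is \<open>x^k / k\<close>; its
      denominator is why the quadratic estimate has the constant \<open>1 / |k|\<close>.\<close>
    have "riemann_sum (zeta_family c) (\<lambda>x. x * x ^ m) \<longlonglongrightarrow> (1 - c ^ k) / ?k * ((1 - of_nat CARD('p) ^ (k - 1)) * of_rat (bernoulli k))"
    proof (rule LIMSEQ_riemann_sum_zeta_family[OF assms, where \<phi> = "\<lambda>x. x ^ k / ?k" and K = "1 / padic_norm ?k"])
      fix x y :: "'p padic" assume xy: "padic_norm x = 1" "padic_norm y = 1"
      have "x ^ k / ?k - y ^ k / ?k - x ^ m * (x - y) = (x ^ Suc m - y ^ Suc m - of_nat (Suc m) * x ^ m * (x - y)) / ?k"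
        using k0 unfolding m by (simp add: diff_divide_distrib mult.assoc del: power_Suc of_nat_Suc)
      thus "padic_norm (x ^ k / ?k - y ^ k / ?k - x ^ m * (x - y)) \<le> 1 / padic_norm ?k * padic_norm (x - y) ^ 2"
        using divide_right_mono[OF padic_norm_power_diff_deriv_le[of x y m], of "padic_norm ?k"] xy
        by (simp add: padic_norm_divide)
    next
      let ?A = "\<lambda>n. (\<Sum>a\<in>?U n. of_nat a ^ k / ?k - (c * of_nat (unit_twist c n a)) ^ k / ?k) / of_nat (CARD('p) ^ n)"
      have "(1 - c ^ k) / ?k * ((\<Sum>a\<in>?U n. of_nat a ^ k) / of_nat (CARD('p) ^ n)) = ?A n" if n: "n \<ge> 1" for n
      proof -
        have "(\<Sum>a\<in>?U n. of_nat a ^ k / ?k - (c * of_nat (unit_twist c n a)) ^ k / ?k)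
            = (\<Sum>a\<in>?U n. of_nat a ^ k) / ?k - c ^ k * (\<Sum>a\<in>?U n. of_nat (unit_twist c n a) ^ k) / ?k"
          by (simp add: sum_subtractf power_mult_distrib sum_divide_distrib sum_distrib_left)
        also have "(\<Sum>a\<in>?U n. of_nat (unit_twist c n a) ^ k) = (\<Sum>a\<in>?U n. of_nat a ^ k)"
          using n by (intro sum_unit_twist[OF assms]) simp
        finally have e: "(\<Sum>a\<in>?U n. of_nat a ^ k / ?k - (c * of_nat (unit_twist c n a)) ^ k / ?k)
            = (\<Sum>a\<in>?U n. of_nat a ^ k) / ?k - c ^ k * (\<Sum>a\<in>?U n. of_nat a ^ k) / ?k" .
        show ?thesis unfolding e by (simp add: left_diff_distrib diff_divide_distrib)
      qed
      moreover have "(\<lambda>n. (1 - c ^ k) / ?k * ((\<Sum>a\<in>?U n. of_nat a ^ k) / of_nat (CARD('p) ^ n)))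
          \<longlonglongrightarrow> (1 - c ^ k) / ?k * ((1 - of_nat CARD('p) ^ (k - 1)) * of_rat (bernoulli k))"
        by (intro tendsto_mult_left LIMSEQ_unit_power_sum k)
      ultimately show "?A \<longlonglongrightarrow> (1 - c ^ k) / ?k * ((1 - of_nat CARD('p) ^ (k - 1)) * of_rat (bernoulli k))"
        by (elim Lim_transform_eventually) (auto simp: eventually_sequentially)
    qed (auto intro: LIMSEQ_unit_power_sum_0)
    moreover have "riemann_sum (zeta_family c) (\<lambda>x. x * x ^ m) \<longlonglongrightarrow> iwasawa_integral \<mu> (\<lambda>x. x ^ k)"
      using \<mu>[of "\<lambda>x. x ^ k"] by (simp add: m lipschitz_intros)
    ultimately have "iwasawa_integral \<mu> (\<lambda>x. x ^ k) = (1 - c ^ k) / ?k * ((1 - of_nat CARD('p) ^ (k - 1)) * of_rat (bernoulli k))"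
      using LIMSEQ_unique by blast
    also have "\<dots> = (c ^ k - 1) * ((1 - of_nat CARD('p) ^ (k - 1)) * of_rat (zeta_one_minus k))"
    \<comment> \<open>For \<open>k = 1\<close> the Euler factor \<open>1 - p^0\<close> makes both
      sides \<open>0\<close>; for \<open>k \<ge> 2\<close> the zeta value is
      \<open>- B_k / k\<close>.\<close>
    proof (cases "k = 1")
      case False
      hence "k \<ge> 2" using k by simp
      hence "of_rat (zeta_one_minus k) = - (of_rat (bernoulli k) / ?k)"
        by (simp add: zeta_one_minus_eq of_rat_divide of_rat_minus)
      thus ?thesis by (simp only:) (simp add: algebra_simps diff_divide_distrib)
    qed simp
    finally show ?thesis .
  qed
  moreover have "iwasawa_integral \<mu> (\<lambda>_. 1) = - (1 - inverse (of_nat CARD('p))) * log_unit c"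
  proof -
    \<comment> \<open>The constant \<open>1\<close> is written as \<open>x * inverse x\<close> to
      fit the form \<open>x * \<psi> x\<close> with \<open>\<psi>\<close> the derivative of the
      logarithm.\<close>
    have lip: "unit_lipschitz (\<lambda>x :: 'p padic. x * inverse x)" by (intro lipschitz_intros)
    have "riemann_sum (zeta_family c) (\<lambda>x. x * inverse x) \<longlonglongrightarrow> - (1 - inverse (of_nat CARD('p))) * log_unit c"
    proof (rule LIMSEQ_riemann_sum_zeta_family[OF assms, where \<phi> = log_unit and K = 1])
      fix x y :: "'p padic" assume "padic_norm x = 1" "padic_norm (x - y) < 1"
      thus "padic_norm (log_unit x - log_unit y - inverse x * (x - y)) \<le> 1 * padic_norm (x - y) ^ 2"
        using log_unit_diff_deriv_le[OF odd] by simp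
    next
      let ?A = "\<lambda>n. (\<Sum>a\<in>?U n. log_unit (of_nat a) - log_unit (c * of_nat (unit_twist c n a))) / of_nat (CARD('p) ^ n)"
      \<comment> \<open>No limit is involved: the logarithms of the residues cancel under the
        permutation, leaving \<open>- log_unit c\<close> times the proportion of units modulo
        \<open>p^(n + 1)\<close>.\<close>
      have "?A (Suc n) = - (1 - inverse (of_nat CARD('p))) * log_unit c" for n
      proof -
        have "log_unit (c * of_nat (unit_twist c (Suc n) a)) = log_unit c + log_unit (of_nat (unit_twist c (Suc n) a))"
          if "a \<in> ?U (Suc n)" for a
          by (rule log_unit_mult[OF odd c padic_norm_unit_residue[OF unit_twist(1)[OF assms _ that]]]) auto
        hence "(\<Sum>a\<in>?U (Suc n). log_unit (of_nat a) - log_unit (c * of_nat (unit_twist c (Suc n) a)))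
            = (\<Sum>a\<in>?U (Suc n). log_unit (of_nat a)) - (of_nat (card (?U (Suc n))) * log_unit c
              + (\<Sum>a\<in>?U (Suc n). log_unit (of_nat (unit_twist c (Suc n) a))))"
          by (simp add: sum_subtractf sum.distrib)
        also have "(\<Sum>a\<in>?U (Suc n). log_unit (of_nat (unit_twist c (Suc n) a))) = (\<Sum>a\<in>?U (Suc n). log_unit (of_nat a))"
          by (rule sum_unit_twist[OF assms]) simp
        finally have "?A (Suc n) = - (of_nat (card (?U (Suc n))) / of_nat (CARD('p) ^ Suc n)) * log_unit c" by simp
        also have "of_nat (card (?U (Suc n))) / of_nat (CARD('p) ^ Suc n) = 1 - inverse (of_nat CARD('p) :: 'p padic)"
        proof -
          have "(P * Q - Q) / (P * Q) = 1 - inverse P" if "P \<noteq> 0" "Q \<noteq> 0" for P Q :: "'p padic"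
            using that by (simp add: diff_divide_distrib inverse_eq_divide)
          from this[of "of_nat CARD('p)" "of_nat (CARD('p) ^ n)"] show ?thesis
            unfolding card_unit_residues power_Suc of_nat_mult by simp
        qed
        finally show ?thesis .
      qed
      thus "?A \<longlonglongrightarrow> - (1 - inverse (of_nat CARD('p))) * log_unit c"
        by (intro LIMSEQ_imp_Suc[of ?A]) simp
    qed (use LIMSEQ_unit_inverse_sum[OF odd] in simp_all)
    with \<mu>[OF lip] have "iwasawa_integral \<mu> (\<lambda>x. x * inverse x) = - (1 - inverse (of_nat CARD('p))) * log_unit c"
      using LIMSEQ_unique by blast
    moreover have "iwasawa_integral \<mu> (\<lambda>_. 1) = iwasawa_integral \<mu> (\<lambda>x. x * inverse x)"
    proof (rule iwasawa_integral_cong)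
      fix x :: "'p padic" assume "padic_norm x = 1"
      hence "x \<noteq> 0" by auto
      thus "1 = x * inverse x" by simp
    qed (intro lipschitz_intros)+
    ultimately show ?thesis by simp
  qed
  ultimately show ?thesis by blast
qed


subsection \<open>The branches near \<open>s = 1\<close>\<close>

definition branch_char :: "nat \<Rightarrow> 'p::prime_card padic \<Rightarrow> 'p padic \<Rightarrow> 'p padic" where
  "branch_char i s x = teichmuller x ^ i * padic_power (principal_unit x) (1 - s)"

lemma branch_char_eq: "branch_char i s x = teichmuller x ^ i * padic_exp ((s - 1) * (- log_unit x))"
  by (simp add: branch_char_def padic_power_def log_unit_def algebra_simps)

text \<open>The character is constant on residue classes modulo \<open>p\<close>, and units in
  distinct classes are at distance \<open>1\<close>.\<close>

lemma unit_lipschitz_teichmuller [lipschitz_intros]: "unit_lipschitz teichmuller"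
proof (rule unit_lipschitzI[of _ 1])
  fix x y :: "'a padic" assume x: "padic_norm x = 1" and y: "padic_norm y = 1"
  show "padic_norm (teichmuller x - teichmuller y) \<le> 1 * padic_norm (x - y)"
  proof (cases "padic_norm (x - y) < 1")
    case True
    thus ?thesis using teichmuller_cong[OF x True] by simp
  next
    case False
    have "padic_norm (teichmuller x - teichmuller y) \<le> 1" by (rule padic_norm_diff_le) (simp_all add: x y)
    thus ?thesis using False by linarith
  qed
qed

context
  fixes ty :: "'p::prime_card itself"
  assumes odd: "odd CARD('p)"
begin

lemma unit_lipschitz_log_unit: "unit_lipschitz (log_unit :: 'p padic \<Rightarrow> 'p padic)"
  by (rule unit_lipschitzI[of _ 1]) (simp add: log_unit_diff_le[OF odd])

lemma log_unit_1: "log_unit (1 :: 'p padic) = 0"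
proof -
  have "padic_norm (log_unit (1 :: 'p padic)) \<le> 0" using log_unit_close_1[OF odd, of 1] by simp
  hence "padic_norm (log_unit (1 :: 'p padic)) = 0" using padic_norm_nonneg by (rule antisym)
  thus ?thesis by simp
qed

lemma padic_norm_mult_log_unit_le:
  assumes "padic_norm (u :: 'p padic) \<le> 1" "padic_norm x = 1"
  shows "padic_norm (u * - log_unit x) \<le> 1 / real CARD('p)"
proof -
  have "padic_norm (u * - log_unit x) \<le> 1 * (1 / real CARD('p))"
    unfolding padic_norm_mult padic_norm_minus using assms by (intro mult_mono log_unit_le[OF odd]) auto
  thus ?thesis by simp
qed

lemma unit_lipschitz_exp_log_unit:
  assumes u: "padic_norm (u :: 'p padic) \<le> 1"
  shows "unit_lipschitz (\<lambda>x. padic_exp (u * - log_unit x))"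
proof (rule unit_lipschitzI[of _ 1])
  fix x y :: "'p padic" assume x: "padic_norm x = 1" and y: "padic_norm y = 1"
  have "padic_norm (padic_exp (u * - log_unit x) - padic_exp (u * - log_unit y)) \<le> padic_norm (u * - log_unit x - u * - log_unit y)"
    by (intro padic_exp_diff_le odd padic_norm_mult_log_unit_le u x y)
  also have "u * - log_unit x - u * - log_unit y = - (u * (log_unit x - log_unit y))" by (simp add: algebra_simps)
  also have "padic_norm \<dots> \<le> 1 * padic_norm (x - y)"
    unfolding padic_norm_minus padic_norm_mult by (intro mult_mono u log_unit_diff_le[OF odd] x y) auto
  finally show "padic_norm (padic_exp (u * - log_unit x) - padic_exp (u * - log_unit y)) \<le> 1 * padic_norm (x - y)" .
qed

lemma unit_character_branch_char:
  assumes s: "s \<in> (padic_ints :: 'p padic set)"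
  shows "unit_character (branch_char i s)"
proof -
  have u: "padic_norm (s - 1) \<le> 1" using s by (intro padic_norm_diff_le) (auto simp: padic_ints_def)
  show ?thesis unfolding unit_character_def
  proof (intro conjI allI impI)
    show "unit_lipschitz (branch_char i s)"
      unfolding branch_char_eq[abs_def] by (intro lipschitz_intros unit_lipschitz_exp_log_unit u)
    show "branch_char i s 1 = 1" by (simp add: branch_char_eq log_unit_1 teichmuller_1)
    fix x y :: "'p padic" assume xy: "padic_norm x = 1" "padic_norm y = 1"
    have "(s - 1) * - log_unit (x * y) = (s - 1) * - log_unit x + (s - 1) * - log_unit y"
      by (simp add: log_unit_mult[OF odd xy] algebra_simps)
    hence "padic_exp ((s - 1) * - log_unit (x * y)) = padic_exp ((s - 1) * - log_unit x) * padic_exp ((s - 1) * - log_unit y)"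
      using padic_exp_add[OF odd padic_norm_mult_log_unit_le[OF u xy(1)] padic_norm_mult_log_unit_le[OF u xy(2)]] by (simp only:)
    thus "branch_char i s (x * y) = branch_char i s x * branch_char i s y"
      by (simp only: branch_char_eq teichmuller_mult[OF xy] power_mult_distrib mult_ac)
  qed
qed

definition branch_coeff :: "'p iwasawa \<Rightarrow> nat \<Rightarrow> nat \<Rightarrow> 'p padic" where
  "branch_coeff \<mu> i n = iwasawa_integral \<mu> (\<lambda>x. teichmuller x ^ i * ((- log_unit x) ^ n / fact n))"

lemma unit_lipschitz_branch_term:
  "unit_lipschitz (\<lambda>x :: 'p padic. teichmuller x ^ i * ((- log_unit x) ^ n / fact n))"
  unfolding divide_inverse by (intro lipschitz_intros unit_lipschitz_log_unit)

lemma padic_norm_branch_coeff_le: "padic_norm (branch_coeff \<mu> i n) \<le> 1"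
  unfolding branch_coeff_def
proof (rule iwasawa_integral_norm_le[OF unit_lipschitz_branch_term])
  fix x :: "'p padic" assume x: "padic_norm x = 1"
  have "padic_norm ((- log_unit x) ^ n / fact n) \<le> exp_rate TYPE('p) ^ n"
    using log_unit_le[OF odd x] by (intro padic_exp_term_le odd) simp
  also have "\<dots> \<le> 1" using exp_rate[where 'p = 'p] by (simp add: power_le_one)
  finally show "padic_norm (teichmuller x ^ i * ((- log_unit x) ^ n / fact n)) \<le> 1"
    unfolding padic_norm_mult[of "teichmuller x ^ i"] by (simp add: padic_norm_power x)
qed simp

text \<open>The exponential series converges at the geometric rate \<open>exp_rate\<close>,
  uniformly in the unit \<open>x\<close>, so it may be integrated term by term.\<close>

lemma branch_integral_sums:
  assumes s: "s \<in> (padic_ints :: 'p padic set)"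
  shows "(\<lambda>n. branch_coeff \<mu> i n * (s - 1) ^ n) sums iwasawa_integral \<mu> (branch_char i s)"
proof -
  have u: "padic_norm (s - 1) \<le> 1" using s by (intro padic_norm_diff_le) (auto simp: padic_ints_def)
  let ?t = "\<lambda>n x. (s - 1) ^ n * (teichmuller x ^ i * ((- log_unit x) ^ n / fact n))"
  have lip: "unit_lipschitz (?t n)" for n by (intro unit_lipschitz_mult unit_lipschitz_const unit_lipschitz_branch_term)
  have part: "(\<Sum>n<m. branch_coeff \<mu> i n * (s - 1) ^ n) = iwasawa_integral \<mu> (\<lambda>x. \<Sum>n<m. ?t n x)" for m
  proof -
    have "iwasawa_integral \<mu> (?t n) = (s - 1) ^ n * branch_coeff \<mu> i n" for n
      unfolding branch_coeff_def by (rule iwasawa_integral_cmult[OF unit_lipschitz_branch_term])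
    thus ?thesis unfolding iwasawa_integral_sum[OF lip] by (simp only: mult.commute)
  qed
  show ?thesis unfolding sums_def part
  proof (rule padic_tendsto_le[of 0 _ _ "\<lambda>m. exp_rate TYPE('p) ^ m"])
    show "(\<lambda>m. exp_rate TYPE('p) ^ m) \<longlonglongrightarrow> 0"
      using exp_rate[where 'p = 'p] by (intro LIMSEQ_realpow_zero) auto
    fix m :: nat
    show "padic_norm (iwasawa_integral \<mu> (\<lambda>x. \<Sum>n<m. ?t n x) - iwasawa_integral \<mu> (branch_char i s)) \<le> exp_rate TYPE('p) ^ m"
    proof (rule iwasawa_integral_diff_le)
      show "unit_lipschitz (\<lambda>x. \<Sum>n<m. ?t n x)" by (intro unit_lipschitz_sum lip)
      show "unit_lipschitz (branch_char i s)" by (rule unit_characterD(1)[OF unit_character_branch_char[OF s]])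
      fix x :: "'p padic" assume x: "padic_norm x = 1"
      let ?y = "(s - 1) * - log_unit x"
      note y = padic_norm_mult_log_unit_le[OF u x]
      have "padic_norm (padic_exp ?y - (\<Sum>n<m. ?y ^ n / fact n)) \<le> exp_rate TYPE('p) ^ m"
      proof (rule padic_suminf_tail_le[OF padic_exp_sums[OF odd y]])
        fix n assume "n \<ge> m"
        hence "exp_rate TYPE('p) ^ n \<le> exp_rate TYPE('p) ^ m"
          using exp_rate[where 'p = 'p] by (intro power_decreasing) auto
        thus "padic_norm (?y ^ n / fact n) \<le> exp_rate TYPE('p) ^ m"
          using padic_exp_term_le[OF odd y, of n] by linarith
      qed (use exp_rate(1)[where 'p = 'p] in simp)
      moreover have "(\<Sum>n<m. ?t n x) - branch_char i s x = - (teichmuller x ^ i * (padic_exp ?y - (\<Sum>n<m. ?y ^ n / fact n)))"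
      proof -
        have "?t n x = teichmuller x ^ i * (?y ^ n / fact n)" for n
          by (simp only: power_mult_distrib divide_inverse mult_ac)
        thus ?thesis by (simp only: branch_char_eq right_diff_distrib sum_distrib_left minus_diff_eq)
      qed
      ultimately show "padic_norm ((\<Sum>n<m. ?t n x) - branch_char i s x) \<le> exp_rate TYPE('p) ^ m"
        by (simp add: padic_norm_mult padic_norm_power x)
    qed (use exp_rate(1)[where 'p = 'p] in simp)
  qed
qed

end

section \<open>Quotients of power series with integral coefficients\<close>

fun series_quotient :: "(nat \<Rightarrow> 'a::comm_ring_1) \<Rightarrow> (nat \<Rightarrow> 'a) \<Rightarrow> nat \<Rightarrow> 'a" where
  "series_quotient a e n = a n - (\<Sum>i<n. series_quotient a e i * e (n - i))"

declare series_quotient.simps [simp del]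

lemma series_quotient_mult:
  assumes "e 0 = 1"
  shows "(\<Sum>i\<le>n. series_quotient a e i * e (n - i)) = a n"
  unfolding lessThan_Suc_atMost[symmetric] by (simp add: assms series_quotient.simps[of a e n])

text \<open>The recursion for the quotient by a series with constant term \<open>1\<close> contains
  no division, so integrality is inherited.\<close>

lemma padic_norm_series_quotient_le:
  fixes a e :: "nat \<Rightarrow> 'p::prime_card padic"
  assumes "\<And>n. padic_norm (a n) \<le> 1" "\<And>n. padic_norm (e n) \<le> 1"
  shows "padic_norm (series_quotient a e n) \<le> 1"
proof (induction n rule: less_induct)
  case (less n)
  have "padic_norm (series_quotient a e i * e (n - i)) \<le> 1" if "i < n" for i
    unfolding padic_norm_mult using less[OF that] assms(2) by (simp add: mult_le_one)
  thus ?case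
    by (subst series_quotient.simps) (intro padic_norm_diff_le padic_norm_sum_le assms, auto)
qed

lemma bounded_series_term_le:
  assumes "padic_norm (a :: 'p::prime_card padic) \<le> 1"
  shows "padic_norm (a * u ^ n) \<le> padic_norm u ^ n"
  using mult_right_mono[OF assms, of "padic_norm u ^ n"] by (simp add: padic_norm_mult padic_norm_power)

lemma bounded_series_sums:
  fixes a :: "nat \<Rightarrow> 'p::prime_card padic"
  assumes "\<And>n. padic_norm (a n) \<le> 1" "padic_norm u < 1"
  shows "(\<lambda>n. a n * u ^ n) sums (\<Sum>n. a n * u ^ n)"
  by (rule summable_sums, rule geometric_le_sums_summable[where r = "padic_norm u"])
     (use assms in \<open>auto intro: bounded_series_term_le\<close>)

lemma bounded_series_close:
  fixes a :: "nat \<Rightarrow> 'p::prime_card padic"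
  assumes "\<And>n. padic_norm (a n) \<le> 1" "padic_norm u < 1"
  shows "padic_norm ((\<Sum>n. a n * u ^ n) - a 0) \<le> padic_norm u"
proof -
  have "padic_norm ((\<Sum>n. a n * u ^ n) - (\<Sum>n<1. a n * u ^ n)) \<le> padic_norm u"
  proof (rule padic_suminf_tail_le[OF bounded_series_sums[OF assms]])
    fix n :: nat assume "n \<ge> 1"
    hence "padic_norm u ^ n \<le> padic_norm u ^ 1" using assms(2) by (intro power_decreasing) auto
    thus "padic_norm (a n * u ^ n) \<le> padic_norm u"
      using bounded_series_term_le[OF assms(1)[of n], of u n] by simp
  qed auto
  thus ?thesis by simp
qed

text \<open>Splitting off \<open>u L\<close> exposes the zero at \<open>u = 0\<close>; the remaining
  series has integral coefficients and constant term \<open>1\<close>, hence no zero where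
  \<open>u\<close> has norm below \<open>1\<close>.\<close>

lemma padic_exp_minus_1_series:
  assumes odd: "odd CARD('p::prime_card)" and L: "padic_norm (L :: 'p padic) \<le> 1 / real CARD('p)"
    and u: "padic_norm u < 1"
  shows "padic_exp (u * L) - 1 = u * L * (\<Sum>n. L ^ n / fact (Suc n) * u ^ n)"
proof -
  have "padic_norm (u * L) \<le> 1 * (1 / real CARD('p))"
    unfolding padic_norm_mult using u L by (intro mult_mono) auto
  hence uL: "padic_norm (u * L) \<le> 1 / real CARD('p)" by simp
  have "(\<lambda>n. 1 + (\<Sum>k<n. (u * L) ^ Suc k / fact (Suc k))) \<longlonglongrightarrow> padic_exp (u * L)"
    using LIMSEQ_Suc[OF padic_exp_sums[OF odd uL, unfolded sums_def]]
    by (simp only: sum.lessThan_Suc_shift power_0 fact_0 div_by_1)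
  hence "(\<lambda>n. (1 + (\<Sum>k<n. (u * L) ^ Suc k / fact (Suc k))) + (- 1)) \<longlonglongrightarrow> padic_exp (u * L) + (- 1)"
    by (intro tendsto_add tendsto_const)
  hence s: "(\<lambda>k. (u * L) ^ Suc k / fact (Suc k)) sums (padic_exp (u * L) - 1)"
    by (simp add: sums_def del: fact_Suc power_Suc)
  have "(\<lambda>k. u * L * (L ^ k / fact (Suc k) * u ^ k)) sums (u * L * (\<Sum>n. L ^ n / fact (Suc n) * u ^ n))"
    by (intro sums_mult_padic bounded_series_sums padic_exp_shifted_term_le odd L u)
  moreover have "u * L * (L ^ k / fact (Suc k) * u ^ k) = (u * L) ^ Suc k / fact (Suc k)" for k
    by (simp add: power_mult_distrib mult_ac del: fact_Suc)
  ultimately have "(\<lambda>k. (u * L) ^ Suc k / fact (Suc k)) sums (u * L * (\<Sum>n. L ^ n / fact (Suc n) * u ^ n))"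
    by (simp only:)
  thus ?thesis by (rule sums_unique2[OF s])
qed


section \<open>The branches as quotients of integrals\<close>

lemma padic_zeta_branch_eq:
  assumes odd: "odd CARD('p::prime_card)"
    and s: "s \<in> (padic_ints :: 'p padic set)" and g: "padic_norm g = 1" "branch_char i s g \<noteq> 1"
  shows "padic_zeta_branch i s = inverse (branch_char i s g - 1)
     * iwasawa_integral (pseudo_measure_coeff padic_zeta g) (branch_char i s)"
proof -
  from zeta_measure_exists[OF odd] obtain M where
    "\<And>g k. padic_norm g = 1 \<Longrightarrow> k > 0 \<Longrightarrow> iwasawa_integral (M g) (\<lambda>x :: 'p padic. x ^ k)
      = (g ^ k - 1) * ((1 - of_nat CARD('p) ^ (k - 1)) * of_rat (zeta_one_minus k))"
    by metis
  hence "pseudo_measure (padic_zeta :: 'p iwasawa total_fract)" by (rule padic_zeta_eq(1))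
  from pseudo_integral_eq[OF this unit_character_branch_char[OF odd s] g]
  show ?thesis unfolding padic_zeta_branch_def branch_char_def[symmetric, abs_def] .
qed

lemma iwasawa_integral_padic_zeta_1:
  assumes odd: "odd CARD('p::prime_card)" and g: "padic_norm (g :: 'p padic) = 1"
  shows "iwasawa_integral (pseudo_measure_coeff padic_zeta g) (\<lambda>_. 1) = - (1 - inverse (of_nat CARD('p))) * log_unit g"
proof -
  from zeta_measure_exists[OF odd] obtain M where
    M: "\<And>g k. padic_norm g = 1 \<Longrightarrow> k > 0 \<Longrightarrow> iwasawa_integral (M g) (\<lambda>x :: 'p padic. x ^ k)
      = (g ^ k - 1) * ((1 - of_nat CARD('p) ^ (k - 1)) * of_rat (zeta_one_minus k))"
    "\<And>g :: 'p padic. padic_norm g = 1 \<Longrightarrow> iwasawa_integral (M g) (\<lambda>_. 1) = - (1 - inverse (of_nat CARD('p))) * log_unit g"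
    by metis
  have "pseudo_measure_coeff padic_zeta g = M g" by (rule padic_zeta_eq(2)[OF M(1) g])
  thus ?thesis using M(2)[OF g] by simp
qed

text \<open>The Teichmueller lift of a primitive root modulo \<open>p\<close> works: a relation
  \<open>g^i = 1\<close> would reduce to one modulo \<open>p\<close>.\<close>

lemma teichmuller_generator_exists:
  obtains g :: "'p::prime_card padic" where "padic_norm g = 1" "teichmuller g = g"
    "\<And>i. 0 < i \<Longrightarrow> i < CARD('p) - 1 \<Longrightarrow> g ^ i \<noteq> 1"
proof -
  let ?p = "CARD('p)"
  obtain x where x: "residue_primroot ?p x" using prime_primitive_root_exists[of ?p] prime_card by auto
  hence cop: "coprime x ?p" and ord: "ord ?p x = ?p - 1"
    by (auto simp: residue_primroot_def coprime_commute totient_prime prime_card)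
  have nx: "padic_norm (of_nat x :: 'p padic) = 1" using cop by (simp add: padic_norm_of_nat_eq_1_iff)
  let ?g = "teichmuller (of_nat x :: 'p padic)"
  have ng: "padic_norm ?g = 1" by (rule padic_norm_teichmuller[OF nx])
  have "?g ^ i \<noteq> 1" if i: "0 < i" "i < ?p - 1" for i
  proof
    assume gi: "?g ^ i = 1"
    have "padic_norm (?g ^ i - of_nat x ^ i) \<le> padic_norm (?g - of_nat x)"
      by (intro padic_norm_power_diff_le) (simp_all add: ng nx)
    also have "\<dots> < 1" by (rule teichmuller_close[OF nx])
    finally have "padic_norm (of_nat (x ^ i) - of_nat 1 :: 'p padic) \<le> 1 / real ?p ^ 1"
      using padic_norm_less_1[of "1 - of_nat x ^ i :: 'p padic"] by (simp add: gi padic_norm_minus_commute)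
    hence "[x ^ i = 1] (mod ?p ^ 1)" by (simp only: padic_norm_of_nat_diff_le_iff)
    hence "[x ^ i = 1] (mod ?p)" by (simp only: power_one_right)
    hence "ord ?p x dvd i" by (simp only: ord_divides)
    thus False using i ord by (auto dest: dvd_imp_le)
  qed
  moreover have "teichmuller ?g = ?g"
    by (rule teichmuller_eqI[OF ng teichmuller_root[OF nx]]) simp
  ultimately show ?thesis using that[of ?g] ng by blast
qed

lemma padic_zeta_branch_analytic:
  assumes odd: "odd CARD('p::prime_card)" and i: "0 < i" "i < CARD('p) - 1"
  shows "padic_analytic_at (padic_zeta_branch i :: 'p padic \<Rightarrow> 'p padic) 1"
proof -
  obtain g :: "'p padic" where g: "padic_norm g = 1" "teichmuller g = g" "g ^ i \<noteq> 1"
    using teichmuller_generator_exists i by metis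
  let ?\<mu> = "pseudo_measure_coeff padic_zeta g"
  have "g \<noteq> 0" using g(1) by auto
  \<comment> \<open>As its own Teichmueller lift, \<open>g\<close> has trivial principal part and
    logarithm \<open>0\<close>, so the character takes the value \<open>g^i\<close> at
    \<open>g\<close> for every \<open>s\<close>.\<close>
  hence "principal_unit g = 1" by (simp add: principal_unit_def g)
  hence "log_unit g = log_unit 1" by (simp add: log_unit_def principal_unit_def teichmuller_1)
  hence char: "branch_char i s g = g ^ i" for s
    by (simp add: branch_char_eq log_unit_1[OF odd] g)
  have "(\<lambda>n. inverse (g ^ i - 1) * branch_coeff ?\<mu> i n * (s - 1) ^ n) sums padic_zeta_branch i s"
    if s: "s \<in> padic_ints" for s
  proof -
    have "padic_zeta_branch i s = inverse (g ^ i - 1) * iwasawa_integral ?\<mu> (branch_char i s)"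
      using padic_zeta_branch_eq[OF odd s g(1), of i] g(3) by (simp add: char)
    thus ?thesis
      using sums_mult_padic[OF branch_integral_sums[OF odd s, of ?\<mu> i], of "inverse (g ^ i - 1)"]
      by (simp only: mult.assoc)
  qed
  thus ?thesis unfolding padic_analytic_at_def
    by (intro exI[of _ "\<lambda>n. inverse (g ^ i - 1) * branch_coeff ?\<mu> i n"] exI[of _ 1]) simp
qed

text \<open>With \<open>u = s - 1\<close>, the numerator is the series with coefficients
  \<open>N\<close> and the denominator is \<open>u L\<close> times the one with coefficients
  \<open>e\<close>. Their quotient as power series has integral coefficients \<open>d\<close>, so
  the pole comes from \<open>u\<close> alone, and \<open>C = 1 / L\<close>.\<close>

lemma padic_zeta_branch_pole:
  assumes odd: "odd CARD('p::prime_card)"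
  shows "\<exists>d C. (\<forall>n. padic_norm (d n) \<le> 1) \<and> C * d 0 = 1 - inverse (of_nat CARD('p)) \<and>
     (\<forall>s\<in>padic_ints. dist s 1 < 1 \<longrightarrow> s \<noteq> 1 \<longrightarrow>
        padic_zeta_branch (CARD('p) - 1) s = C * (\<Sum>n. d n * (s - 1 :: 'p padic) ^ n) / (s - 1))"
proof -
  let ?p = "CARD('p)"
  define g :: "'p padic" where "g = 1 + of_nat ?p"
  let ?\<mu> = "pseudo_measure_coeff padic_zeta g"
  have g: "padic_norm g = 1" unfolding g_def by (rule padic_norm_1_plus_card)
  have g1: "padic_norm (g - 1) = 1 / real ?p" by (simp add: g_def padic_norm_card)
  \<comment> \<open>The sign is chosen so that the character at \<open>g\<close> is
    \<open>exp (u L)\<close> with \<open>u = s - 1\<close>.\<close>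
  define L where "L = - log_unit g"
  have logg: "log_unit g = padic_log g"
    by (rule log_unit_eq_padic_log[OF odd]) (simp add: g1)
  have L: "padic_norm L \<le> 1 / real ?p" unfolding L_def padic_norm_minus by (rule log_unit_le[OF odd g])
  \<comment> \<open>The logarithm differs from \<open>g - 1 = p\<close> by at most
    \<open>p^-2\<close> in norm, whereas \<open>p\<close> itself has norm
    \<open>1 / p\<close>.\<close>
  have L0: "L \<noteq> 0"
  proof
    assume "L = 0"
    hence "padic_norm (g - 1) = padic_norm (padic_log g - (g - 1))"
      using logg by (simp add: L_def padic_norm_minus_commute)
    also have "\<dots> \<le> padic_norm (g - 1) ^ 2"
      by (rule padic_log_minus_le[OF odd]) (simp add: g1)
    also have "\<dots> < padic_norm (g - 1) * 1"
      unfolding power2_eq_square g1 by (intro mult_strict_left_mono inverse_card_le_1(2)) simp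
    finally show False by simp
  qed
  define N where "N = branch_coeff ?\<mu> (?p - 1)"
  define e where "e = (\<lambda>n. L ^ n / fact (Suc n))"
  define d where "d = series_quotient N e"
  have N1: "padic_norm (N n) \<le> 1" for n unfolding N_def by (rule padic_norm_branch_coeff_le[OF odd])
  have e1: "padic_norm (e n) \<le> 1" for n unfolding e_def by (rule padic_exp_shifted_term_le[OF odd L])
  have e0: "e 0 = 1" by (simp add: e_def)
  have d1: "padic_norm (d n) \<le> 1" for n unfolding d_def by (rule padic_norm_series_quotient_le[OF N1 e1])
  have root: "teichmuller x ^ (?p - 1) = 1" if "padic_norm x = 1" for x :: "'p padic"
    by (rule teichmuller_root[OF that])
  have "d 0 = N 0" by (simp add: d_def series_quotient.simps[of N e 0])
  \<comment> \<open>For the exponent \<open>p - 1\<close> the Teichmueller factor is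
    \<open>1\<close>, so the constant coefficient is the total mass.\<close>
  also have "N 0 = iwasawa_integral ?\<mu> (\<lambda>_. 1)"
    unfolding N_def branch_coeff_def[OF odd]
    by (rule iwasawa_integral_cong)
       (auto simp: root simp del: One_nat_def intro: lipschitz_intros unit_lipschitz_branch_term[OF odd])
  also have "\<dots> = (1 - inverse (of_nat ?p)) * L"
    unfolding iwasawa_integral_padic_zeta_1[OF odd g] L_def by (simp add: algebra_simps)
  finally have d0: "inverse L * d 0 = 1 - inverse (of_nat ?p)" using L0 by simp
  have "padic_zeta_branch (?p - 1) s = inverse L * (\<Sum>n. d n * (s - 1) ^ n) / (s - 1)"
    if s: "s \<in> padic_ints" "dist s 1 < 1" "s \<noteq> 1" for s
  proof -
    let ?u = "s - 1"
    have u: "padic_norm ?u < 1" using s(2) by (simp add: dist_padic_def)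
    have u0: "?u \<noteq> 0" using s(3) by simp
    define D E where "D = (\<Sum>n. d n * ?u ^ n)" and "E = (\<Sum>n. e n * ?u ^ n)"
    have "padic_norm (E - 1) < 1"
      using bounded_series_close[of e, OF e1 u] u unfolding E_def e0 by linarith
    hence E0: "E \<noteq> 0" by auto
    have DE: "(\<lambda>n. \<Sum>k\<le>n. (d k * ?u ^ k) * (e (n - k) * ?u ^ (n - k))) sums (D * E)"
      unfolding D_def E_def
      by (rule padic_Cauchy_product[where r = "padic_norm ?u"])
         (use u in \<open>auto intro: bounded_series_sums bounded_series_term_le d1 e1\<close>)
    have "(\<Sum>k\<le>n. (d k * ?u ^ k) * (e (n - k) * ?u ^ (n - k))) = N n * ?u ^ n" for n
    proof -
      have "(\<Sum>k\<le>n. (d k * ?u ^ k) * (e (n - k) * ?u ^ (n - k))) = (\<Sum>k\<le>n. d k * e (n - k)) * ?u ^ n"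
        unfolding sum_distrib_right
      proof (intro sum.cong refl)
        fix k assume "k \<in> {..n}"
        hence "?u ^ n = ?u ^ k * ?u ^ (n - k)" by (simp flip: power_add)
        thus "d k * ?u ^ k * (e (n - k) * ?u ^ (n - k)) = d k * e (n - k) * ?u ^ n" by (simp only: mult_ac)
      qed
      thus ?thesis unfolding d_def series_quotient_mult[of e N, OF e0] .
    qed
    with DE have "(\<lambda>n. N n * ?u ^ n) sums (D * E)" by simp
    hence int: "iwasawa_integral ?\<mu> (branch_char (?p - 1) s) = D * E"
      using sums_unique2[OF branch_integral_sums[OF odd s(1), of ?\<mu> "?p - 1"]] unfolding N_def by blast
    have "branch_char (?p - 1) s g = padic_exp (?u * L)"
      by (simp only: branch_char_eq root[OF g] L_def mult_1_left)
    hence char: "branch_char (?p - 1) s g - 1 = ?u * L * E"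
      unfolding E_def e_def using padic_exp_minus_1_series[OF odd L u] by simp
    hence "branch_char (?p - 1) s g \<noteq> 1" using u0 L0 E0 by auto
    from padic_zeta_branch_eq[OF odd s(1) g this]
    have "padic_zeta_branch (?p - 1) s = inverse (?u * L * E) * (D * E)" by (simp only: char int)
    also have "\<dots> = inverse L * D / ?u" using u0 L0 E0 by (simp add: field_simps)
    finally show ?thesis unfolding D_def .
  qed
  with d1 d0 show ?thesis by blast
qed

theorem theorem7p1:
  fixes p i :: nat
  assumes "p = CARD('p::prime_card)" and "odd p" and "i \<in> {1..p - 1}"
  shows "(i \<noteq> p - 1 \<longrightarrow> padic_analytic_at (padic_zeta_branch i :: 'p padic \<Rightarrow> 'p padic) 1)
    \<and> padic_simple_pole_at (padic_zeta_branch (p - 1) :: 'p padic \<Rightarrow> 'p padic) 1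
        (1 - inverse (of_nat p))
    \<and> ((\<lambda>s :: 'p padic. (s - 1) * padic_zeta_branch (p - 1) s) \<longlongrightarrow> 1 - inverse (of_nat p))
        (at 1 within padic_ints)"
proof -
  have odd: "odd CARD('p)" using assms by simp
  let ?R = "1 - inverse (of_nat p) :: 'p padic"
  let ?f = "padic_zeta_branch (p - 1) :: 'p padic \<Rightarrow> 'p padic"
  obtain d C where d: "\<And>n. padic_norm (d n) \<le> 1" and C: "C * d 0 = ?R"
    and f: "\<And>s. s \<in> padic_ints \<Longrightarrow> dist s 1 < 1 \<Longrightarrow> s \<noteq> 1 \<Longrightarrow> ?f s = C * (\<Sum>n. d n * (s - 1) ^ n) / (s - 1)"
    using padic_zeta_branch_pole[OF odd] unfolding assms(1) by blast
  \<comment> \<open>The product of \<open>s - 1\<close> with the branch, continued across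
    \<open>s = 1\<close>; its constant coefficient is the residue.\<close>
  define h where "h = (\<lambda>s. C * (\<Sum>n. d n * (s - 1) ^ n))"
  have h_sums: "(\<lambda>n. C * d n * (s - 1) ^ n) sums h s" if "dist s 1 < 1" for s
    using sums_mult_padic[OF bounded_series_sums[of d "s - 1", OF d], of C] that
    by (simp add: h_def dist_padic_def mult.assoc)
  \<comment> \<open>One estimate yields the value at \<open>1\<close>, by putting
    \<open>s = 1\<close>, and the limit.\<close>
  have h_close: "padic_norm (h s - ?R) \<le> padic_norm C * padic_norm (s - 1)" if "dist s 1 < 1" for s
  proof -
    have "h s - ?R = C * ((\<Sum>n. d n * (s - 1) ^ n) - d 0)" by (simp add: h_def right_diff_distrib C)
    thus ?thesis
      using bounded_series_close[of d "s - 1", OF d] that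
      by (simp add: padic_norm_mult dist_padic_def mult_left_mono)
  qed
  have h1: "h 1 = ?R" using h_close[of 1] by (simp add: padic_norm_le_0_iff)
  have ev: "\<forall>\<^sub>F s in at 1 within padic_ints. ?f s = h s / (s - 1)"
    unfolding eventually_at by (intro exI[of _ 1]) (auto simp: f h_def simp del: One_nat_def)
  have "?R \<noteq> 0"
  proof
    assume "?R = 0"
    hence "of_nat p = (of_nat 1 :: 'p padic)" by (metis inverse_1 inverse_inverse_eq of_nat_1 right_minus_eq)
    hence "p = 1" by (simp only: of_nat_eq_iff)
    thus False using card_neq_1[where 'p = 'p] assms(1) by simp
  qed
  moreover have "padic_analytic_at h 1"
    unfolding padic_analytic_at_def
    by (intro exI[of _ "\<lambda>n. C * d n"] exI[of _ 1]) (auto intro: h_sums)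
  ultimately have pole: "padic_simple_pole_at ?f 1 ?R"
    unfolding padic_simple_pole_at_def using h1 ev by blast
  have "((\<lambda>s :: 'p padic. padic_norm C * dist s 1) \<longlongrightarrow> padic_norm C * dist (1 :: 'p padic) 1) (at 1 within padic_ints)"
    by (intro tendsto_intros)
  hence lim0: "((\<lambda>s :: 'p padic. padic_norm C * dist s 1) \<longlongrightarrow> 0) (at 1 within padic_ints)" by simp
  have "\<forall>\<^sub>F s in at 1 within padic_ints. norm (padic_norm (h s - ?R)) \<le> norm (padic_norm C * dist s 1) * 1"
    unfolding eventually_at
    by (intro exI[of _ 1]) (auto simp: dist_padic_def abs_mult intro: h_close[unfolded dist_padic_def])
  from tendsto_0_le[OF lim0 this] have "(h \<longlongrightarrow> ?R) (at 1 within padic_ints)"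
    unfolding padic_tendsto_iff .
  moreover have "\<forall>\<^sub>F s in at 1 within padic_ints. h s = (s - 1) * ?f s"
    unfolding eventually_at by (intro exI[of _ 1]) (auto simp: f h_def simp del: One_nat_def)
  ultimately have "((\<lambda>s. (s - 1) * ?f s) \<longlongrightarrow> ?R) (at 1 within padic_ints)"
    by (rule Lim_transform_eventually)
  moreover have "padic_analytic_at (padic_zeta_branch i :: 'p padic \<Rightarrow> 'p padic) 1" if "i \<noteq> p - 1"
    using that assms by (intro padic_zeta_branch_analytic) auto
  ultimately show ?thesis using pole by blast
qed

end
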